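(* Let $k$ be a field with $\operatorname{char}k\neq 2$ and let $M\supseteq k$ be an infinite field. For $\mathbf a=(a,b),\ \mathbf a'=(a',b')\in M^2$ with $D_{\mathbf a}D_{\mathbf a'}\neq 0$, assume that $f_{\mathbf a}(X)=X^4+aX^2+bX+b$ and $f_{\mathbf a'}(X)=X^4+a'X^2+b'X+b'$ are both irreducible over $M$, that $\#G_{\mathbf a}\ge \#G_{\mathbf a'}$, and that $G_{\mathbf a}\cong\mathcal S_4$ or $G_{\mathbf a}\cong\mathcal A_4$. Then, for the given pair $(G_{\mathbf a},G_{\mathbf a'})$, the triple (isomorphism type of $G_{\mathbf a,\mathbf a'}$, relation between $L_{\mathbf a}$ and $L_{\mathbf a'}$, $\mathrm{DT}(\mathcal R_{\mathbf a,\mathbf a'})$) is given by one of the rows listed below for that pair (rows are labelled; GAP SmallGroup IDs of $G_{\mathbf a,\mathbf a'}$ in brackets; $[\,L_{\mathbf a}\cap L_{\mathbf a'}:M]=n$ is abbreviated "$n$"): $(G_{\mathbf a},G_{\mathbf a'})=(\mathcal S_4,\mathcal S_4)$: (I-1) $[576,8653]$, $\mathcal S_4\times\mathcal S_4$, $L_{\mathbf a}\cap L_{\mathbf a'}=M$, DT $24$; (I-2) $[288,1026]$, $(\mathcal A_4\times\mathcal A_4)\rtimes\mathcal C_2$, $2$, DT $12,12$; (I-3) $[96,227]$, $(\mathcal V_4\times\mathcal V_4)\rtimes\mathcal S_3$, $6$, DT $12,8,4$; (I-4) $[24,12]$, $\mathcal S_4$, $L_{\mathbf a}=L_{\mathbf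 a'}$, DT $8,6,6,3,1$. $(\mathcal S_4,\mathcal A_4)$: (I-5) $[288,1024]$, $\mathcal S_4\times\mathcal A_4$, $L_{\mathbf a}\cap L_{\mathbf a'}=M$, DT $24$. $(\mathcal S_4,\mathcal D_4)$: (I-6) $[192,1472]$, $\mathcal S_4\times\mathcal D_4$, $L_{\mathbf a}\cap L_{\mathbf a'}=M$, DT $24$; (I-7) $[96,187]$, $(\mathcal A_4\times\mathcal C_4)\rtimes\mathcal C_2$, $2$, DT $24$; (I-8) $[96,195]$, $(\mathcal A_4\times\mathcal V_4)\rtimes\mathcal C_2$, $2$, DT $24$; (I-9) $[96,195]$, $(\mathcal A_4\times\mathcal V_4)\rtimes\mathcal C_2$, $2$, DT $12,12$. $(\mathcal S_4,\mathcal C_4)$: (I-10) $[96,186]$, $\mathcal S_4\times\mathcal C_4$, $L_{\mathbf a}\neq L_{\mathbf a'}$, DT $24$; (I-11) $[48,30]$, $\mathcal A_4\rtimes\mathcal C_4$, $2$, DT $12,12$. $(\mathcal S_4,\mathcal V_4)$: (I-12) $[96,226]$, $\mathcal S_4\times\mathcal V_4$, $L_{\mathbf a}\neq L_{\mathbf a'}$, DT $24$; (I-13) $[48,48]$, $\mathcal S_4\times\mathcal C_2$, $2$, DT $24$. $(\mathcal A_4,\mathcal A_4)$: (I-14) $[144,184]$, $\mathcal A_4\times\mathcal A_4$, $L_{\mathbf a}\cap L_{\mathbf a'}=M$, DT $12,12$; (I-15) $[48,50]$, $(\mathcal V_4\times\mathcal V_4)\rtimes\mathcal C_3$, $3$,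 DT $12,4,4,4$; (I-16) $[12,3]$, $\mathcal A_4$, $L_{\mathbf a}=L_{\mathbf a'}$, DT $6,6,4,4,3,1$. $(\mathcal A_4,\mathcal D_4)$: (I-17) $[96,197]$, $\mathcal A_4\times\mathcal D_4$, $L_{\mathbf a}\cap L_{\mathbf a'}=M$, DT $24$. $(\mathcal A_4,\mathcal C_4)$: (I-18) $[48,31]$, $\mathcal A_4\times\mathcal C_4$, $L_{\mathbf a}\cap L_{\mathbf a'}=M$, DT $24$. $(\mathcal A_4,\mathcal V_4)$: (I-19) $[48,49]$, $\mathcal A_4\times\mathcal V_4$, $L_{\mathbf a}\cap L_{\mathbf a'}=M$, DT $12,12$.
   Context: For $\mathbf a=(a,b)\in M^2$, $f_{\mathbf a}(X)=X^4+aX^2+bX+b$ and $D_{\mathbf a}=b(16a^4-128a^2b-4a^3b+256b^2+144ab^2-27b^3)$ is its discriminant. $L_{\mathbf a}$ is the splitting field of $f_{\mathbf a}$ over $M$ (inside a fixed algebraic closure), $G_{\mathbf a}=\mathrm{Gal}(f_{\mathbf a}/M)$ viewed as a subgroup of $\mathcal S_4$ up to conjugacy via the action on roots, and $G_{\mathbf a,\mathbf a'}=\mathrm{Gal}(L_{\mathbf a}L_{\mathbf a'}/M)$ (Galois group of $f_{\mathbf a}f_{\mathbf a'}$). $\mathcal S_n,\mathcal A_n,\mathcal D_n,\mathcal C_n$ denote the symmetric, alternating, dihedral (of order $2n$) and cyclic groups of degree $n$; $\mathcal V_4\cong\mathcal C_2\times\mathcal C_2$. Let $\alpha_1,\dots,\alpha_4$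 be the roots of $f_{\mathbf a}$ and $\beta_1,\dots,\beta_4$ those of $f_{\mathbf a'}$. Define $\mathcal R_{\mathbf a,\mathbf a'}(X)=\prod_{\pi\in\mathcal S_4}\bigl(X-\sum_{i=1}^4\alpha_i\beta_{\pi(i)}\bigr)\in M[X]$. Its decomposition type $\mathrm{DT}(\mathcal R_{\mathbf a,\mathbf a'})$ is the partition of $24$ given by the sizes of the orbits of $G_{\mathbf a,\mathbf a'}$ acting on the $24$ bijections $\varphi:\{\alpha_i\}\to\{\beta_j\}$ by $(\sigma\cdot\varphi)(\alpha)=\sigma(\varphi(\sigma^{-1}\alpha))$; when $\mathcal R_{\mathbf a,\mathbf a'}$ has no repeated factors this is the multiset of degrees of its irreducible factors over $M$. Exponents denote repetition (e.g. $8^2=8,8$). *)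

theory Defs
  imports "HOL-Algebra.Algebra" "HOL-Algebra.Algebraic_Closure_Type"
    "HOL-Library.Multiset"
begin

section \<open>Splitting fields and Galois groups inside the algebraic closure\<close>

abbreviation ac_ring :: "'m::field alg_closure ring"
  where "ac_ring \<equiv> ring_of_type_algebra"

abbreviation base_field :: "'m::field alg_closure set"
  where "base_field \<equiv> range to_ac"

definition roots_ac :: "'m::field poly \<Rightarrow> 'm alg_closure set"
  where "roots_ac p = {x. poly (map_poly to_ac p) x = 0}"

definition splitting_field :: "'m::field poly \<Rightarrow> 'm alg_closure set"
  where "splitting_field p = generate_field ac_ring (base_field \<union> roots_ac p)"

definition compositum ::
  "'m::field alg_closure set \<Rightarrow> 'm alg_closure set \<Rightarrow> 'm alg_closure set"
  where "compositum K L = generate_field ac_ring (K \<union> L)"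

text \<open>As in \<^const>\<open>BijGroup\<close>, automorphisms of \<^term>\<open>L\<close> are extensional functions, so each is
  counted once; the product is composition.\<close>

definition galois_group ::
  "'m::field alg_closure set \<Rightarrow> ('m alg_closure \<Rightarrow> 'm alg_closure) monoid"
  where "galois_group L = BijGroup L \<lparr> carrier :=
    {\<sigma> \<in> Bij L. (\<forall>x\<in>L. \<forall>y\<in>L. \<sigma> (x + y) = \<sigma> x + \<sigma> y \<and> \<sigma> (x * y) = \<sigma> x * \<sigma> y) \<and>
                 (\<forall>c\<in>base_field. \<sigma> c = c)} \<rparr>"

abbreviation degree_over_base :: "'m::field alg_closure set \<Rightarrow> nat \<Rightarrow> bool"
  where "degree_over_base L n \<equiv> ring.dimension ac_ring n base_field L"


section \<open>The family of quartics\<close>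

definition quartic :: "'m::field \<times> 'm \<Rightarrow> 'm poly"
  where "quartic = (\<lambda>(a, b). [:b, b, a, 0, 1:])"

definition quartic_disc :: "'m::field \<times> 'm \<Rightarrow> 'm"
  where "quartic_disc = (\<lambda>(a, b). b * (16 * a ^ 4 - 128 * a ^ 2 * b - 4 * a ^ 3 * b
           + 256 * b ^ 2 + 144 * a * b ^ 2 - 27 * b ^ 3))"

definition Lf :: "'m::field \<times> 'm \<Rightarrow> 'm alg_closure set"
  where "Lf u = splitting_field (quartic u)"

definition Gal :: "'m::field \<times> 'm \<Rightarrow> ('m alg_closure \<Rightarrow> 'm alg_closure) monoid"
  where "Gal u = galois_group (Lf u)"

definition Gal2 ::
  "'m::field \<times> 'm \<Rightarrow> 'm \<times> 'm \<Rightarrow> ('m alg_closure \<Rightarrow> 'm alg_closure) monoid"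
  where "Gal2 u v = galois_group (compositum (Lf u) (Lf v))"


section \<open>Decomposition type of the resolvent\<close>

text \<open>A bijection \<open>\<phi>\<close> between the roots of the two quartics corresponds to the factor
  \<open>X - (\<Sum>\<alpha>. \<alpha> * \<phi> \<alpha>)\<close> of the degree 24 resolvent \<open>R\<close>. The decomposition type is taken from the orbits
  on bijections, so that it makes sense also when \<open>R\<close> has repeated factors.\<close>

definition root_bijections ::
  "'m::field \<times> 'm \<Rightarrow> 'm \<times> 'm \<Rightarrow> ('m alg_closure \<Rightarrow> 'm alg_closure) set"
  where "root_bijections u v =
    {\<phi> \<in> extensional (roots_ac (quartic u)).
       bij_betw \<phi> (roots_ac (quartic u)) (roots_ac (quartic v))}"

definition bijection_action ::
  "'m::field \<times> 'm \<Rightarrow> 'm \<times> 'm \<Rightarrow> ('m alg_closure \<Rightarrow> 'm alg_closure) \<Rightarrow>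
   ('m alg_closure \<Rightarrow> 'm alg_closure) \<Rightarrow> ('m alg_closure \<Rightarrow> 'm alg_closure)"
  where "bijection_action u v \<sigma> \<phi> =
    (\<lambda>\<alpha>\<in>roots_ac (quartic u). \<sigma> (\<phi> ((inv\<^bsub>Gal2 u v\<^esub> \<sigma>) \<alpha>)))"

definition decomposition_type :: "'m::field \<times> 'm \<Rightarrow> 'm \<times> 'm \<Rightarrow> nat multiset"
  where "decomposition_type u v =
    image_mset card (mset_set (orbits (Gal2 u v) (root_bijections u v) (bijection_action u v)))"


section \<open>The finite groups in the table\<close>

definition semidirect ::
  "('a, 'c) monoid_scheme \<Rightarrow> ('b, 'd) monoid_scheme \<Rightarrow> ('b \<Rightarrow> 'a \<Rightarrow> 'a) \<Rightarrow> ('a \<times> 'b) monoid"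
  where "semidirect N H \<theta> =
    \<lparr> carrier = carrier N \<times> carrier H,
      monoid.mult = (\<lambda>(n, h) (n', h'). (n \<otimes>\<^bsub>N\<^esub> \<theta> h n', h \<otimes>\<^bsub>H\<^esub> h')),
      one = (\<one>\<^bsub>N\<^esub>, \<one>\<^bsub>H\<^esub>) \<rparr>"

abbreviation Cyc :: "nat \<Rightarrow> int monoid" where "Cyc \<equiv> integer_mod_group"
abbreviation S4 :: "(nat \<Rightarrow> nat) monoid" where "S4 \<equiv> sym_group 4"
abbreviation A4 :: "(nat \<Rightarrow> nat) monoid" where "A4 \<equiv> alt_group 4"

definition V4 :: "(nat \<Rightarrow> nat) monoid"
  where "V4 = (sym_group 4) \<lparr> carrier :=
    {id,
     Transposition.transpose 1 2 \<circ> Transposition.transpose 3 4,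
     Transposition.transpose 1 3 \<circ> Transposition.transpose 2 4,
     Transposition.transpose 1 4 \<circ> Transposition.transpose 2 3} \<rparr>"

text \<open>The action of a cyclic group of even order whose generator \<open>1\<close> acts as the involution
  \<open>\<phi>\<close>.\<close>

definition via_involution :: "('a \<Rightarrow> 'a) \<Rightarrow> int \<Rightarrow> 'a \<Rightarrow> 'a"
  where "via_involution \<phi> h = \<phi> ^^ nat h"

definition conj_by :: "(nat \<Rightarrow> nat) \<Rightarrow> (nat \<Rightarrow> nat) \<Rightarrow> nat \<Rightarrow> nat"
  where "conj_by s p = s \<circ> p \<circ> Hilbert_Choice.inv s"

abbreviation conj12 :: "(nat \<Rightarrow> nat) \<Rightarrow> nat \<Rightarrow> nat"
  where "conj12 \<equiv> conj_by (Transposition.transpose 1 2)"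

definition Dih :: "nat \<Rightarrow> (int \<times> int) monoid"
  where "Dih n = semidirect (Cyc n) (Cyc 2) (via_involution (\<lambda>x. inv\<^bsub>Cyc n\<^esub> x))"

text \<open>The GAP identifier \<open>[n, i]\<close> is recorded in the name \<open>G_n_i\<close>. The actions that the symbols
  for the semidirect products leave implicit are the following. Wherever \<open>C\<^sub>2\<close> or \<open>C\<^sub>4\<close> acts on
  \<open>A\<^sub>4\<close>, its generator acts as an odd permutation (so \<open>A\<^sub>4 \<rtimes> C\<^sub>2 = S\<^sub>4\<close>); on \<open>V\<^sub>4\<close> it swaps two of
  the three involutions, and on \<open>C\<^sub>4\<close> it inverts. \<open>S\<^sub>3\<close> and \<open>C\<^sub>3 = A\<^sub>3\<close> act on both copies of \<open>V\<^sub>4\<close>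
  by permuting the involutions, being embedded in \<open>S\<^sub>4\<close> as fixing the point \<open>4\<close>.\<close>

definition G_288_1026 :: "(((nat \<Rightarrow> nat) \<times> (nat \<Rightarrow> nat)) \<times> int) monoid"
  where "G_288_1026 = semidirect (A4 \<times>\<times> A4) (Cyc 2) (via_involution (map_prod conj12 conj12))"

definition G_96_227 :: "(((nat \<Rightarrow> nat) \<times> (nat \<Rightarrow> nat)) \<times> (nat \<Rightarrow> nat)) monoid"
  where "G_96_227 =
    semidirect (V4 \<times>\<times> V4) (sym_group 3) (\<lambda>s. map_prod (conj_by s) (conj_by s))"

definition G_96_187 :: "(((nat \<Rightarrow> nat) \<times> int) \<times> int) monoid"
  where "G_96_187 = semidirect (A4 \<times>\<times> Cyc 4) (Cyc 2)
           (via_involution (map_prod conj12 (\<lambda>x. inv\<^bsub>Cyc 4\<^esub> x)))"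

definition G_96_195 :: "(((nat \<Rightarrow> nat) \<times> (nat \<Rightarrow> nat)) \<times> int) monoid"
  where "G_96_195 = semidirect (A4 \<times>\<times> V4) (Cyc 2) (via_involution (map_prod conj12 conj12))"

definition G_48_30 :: "((nat \<Rightarrow> nat) \<times> int) monoid"
  where "G_48_30 = semidirect A4 (Cyc 4) (via_involution conj12)"

definition G_48_50 :: "(((nat \<Rightarrow> nat) \<times> (nat \<Rightarrow> nat)) \<times> (nat \<Rightarrow> nat)) monoid"
  where "G_48_50 =
    semidirect (V4 \<times>\<times> V4) (alt_group 3) (\<lambda>s. map_prod (conj_by s) (conj_by s))"

end

(*
  Labelling the roots of the two quartics by four points identifies Gal(L L'/M) with a subgroup Gamma of
  S4 x S4 whose first projection is S4 or A4 and whose second projection is transitive. Goursat's lemma,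
  applied through the kernel N of the second projection (a normal subgroup of the first one: 1, V4, A4 or
  S4), leaves nineteen possibilities for Gamma up to relabelling the roots of the second quartic. For each
  of them the isomorphism type and the orbits of (s, t) . phi = t phi s^-1 on S4 are read off; the orbits
  are cosets of A4 or S4 when A4 is contained in N. The intersection of L and L' is the fixed field of the
  product of the two kernels, of degree [fst Gamma : N] by the Galois correspondence. Irreducible quartics
  of the family are separable because the coefficient 4 of X^3 in the derivative is nonzero.
*)
theory Submission
  imports Defs
begin

section \<open>Subfields and embeddings\<close>

text \<open>Neither the joint group nor the degree of the intersection determines the row: two rows
  agree in both (\<open>G_96_195\<close>) and differ only in the decomposition type. What decides is
  parity. An element (s, t) changes the parity of a bijection iff the signs of s and t differ, and
  A4 x 1 joins all bijections of equal parity. For a fibre product of S4 and P over C2, with E the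
  index-two subgroup of P, the question becomes whether E consists exactly of the even elements of
  P. Of the three index-two subgroups of D4 only the transitive four-group does; the cyclic group
  and the intransitive four-group do not. The field theory lives on subsets of a single
  algebraically closed type. Splitting fields are generated by finitely many roots, so embeddings
  extend one root at a time. Infinitude of M supplies elements that avoid finitely many
  coincidences; from them come primitive elements and the basis of powers that computes a degree in
  the sense of \<open>ring.dimension\<close>.\<close>

definition subfld :: "'a::field set \<Rightarrow> bool" where
  "subfld K \<longleftrightarrow> 0 \<in> K \<and> 1 \<in> K \<and> (\<forall>x\<in>K. \<forall>y\<in>K. x + y \<in> K \<and> x * y \<in> K) \<and>
     (\<forall>x\<in>K. - x \<in> K \<and> inverse x \<in> K)"

definition fgen :: "'a::field set \<Rightarrow> 'a set" where
  "fgen S = \<Inter>{K. subfld K \<and> S \<subseteq> K}"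

definition polys_over :: "'a::field set \<Rightarrow> 'a poly set" where
  "polys_over K = {p. \<forall>i. Polynomial.coeff p i \<in> K}"

text \<open>Additivity and multiplicativity are required only on K, and values outside K are
  arbitrary. With \<open>\<sigma> 1 = 1\<close> excluding the zero map, injectivity and
  compatibility with inverses follow.\<close>

definition emb :: "'a::field set \<Rightarrow> ('a \<Rightarrow> 'a) \<Rightarrow> bool" where
  "emb K \<sigma> \<longleftrightarrow> \<sigma> 1 = 1 \<and> (\<forall>x\<in>K. \<forall>y\<in>K. \<sigma> (x + y) = \<sigma> x + \<sigma> y \<and> \<sigma> (x * y) = \<sigma> x * \<sigma> y)"

text \<open>Least degree takes the place of irreducibility, and the leading coefficient is not
  normalized. Existence is then the least-number principle, and divisibility follows from one
  division with remainder.\<close>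

definition min_poly :: "'a::field set \<Rightarrow> 'a \<Rightarrow> 'a poly \<Rightarrow> bool" where
  "min_poly K x p \<longleftrightarrow> p \<in> polys_over K \<and> p \<noteq> 0 \<and> poly p x = 0 \<and>
     (\<forall>q\<in>polys_over K. q \<noteq> 0 \<longrightarrow> poly q x = 0 \<longrightarrow> Polynomial.degree p \<le> Polynomial.degree q)"

definition algebraic_over :: "'a::field set \<Rightarrow> bool" where
  "algebraic_over K \<longleftrightarrow> (\<forall>x. \<exists>p\<in>polys_over K. p \<noteq> 0 \<and> poly p x = 0)"

text \<open>The ring K[x]; \<open>adj_eq_fgen\<close> identifies it with the field K(x) when the
  ambient field is algebraic over K.\<close>

definition adj :: "'a::field set \<Rightarrow> 'a \<Rightarrow> 'a set" where
  "adj K x = (\<lambda>p. poly p x) ` polys_over K"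

text \<open>The witness f may be any polynomial over K with as many roots as its degree, not only
  the minimal one. The same f therefore serves over every larger base field, which is what an
  induction over generators needs.\<close>

definition separable_over :: "'a::field set \<Rightarrow> 'a \<Rightarrow> bool" where
  "separable_over K x \<longleftrightarrow>
     (\<exists>f\<in>polys_over K. f \<noteq> 0 \<and> poly f x = 0 \<and> card {z. poly f z = 0} = Polynomial.degree f)"

lemma subfldD:
  assumes "subfld K"
  shows "0 \<in> K" "1 \<in> K" "x \<in> K \<Longrightarrow> y \<in> K \<Longrightarrow> x + y \<in> K" "x \<in> K \<Longrightarrow> y \<in> K \<Longrightarrow> x * y \<in> K"
    "x \<in> K \<Longrightarrow> - x \<in> K" "x \<in> K \<Longrightarrow> inverse x \<in> K"
    "x \<in> K \<Longrightarrow> y \<in> K \<Longrightarrow> x - y \<in> K" "x \<in> K \<Longrightarrow> y \<in> K \<Longrightarrow> x / y \<in> K"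
proof -
  show "0 \<in> K" "1 \<in> K" "x \<in> K \<Longrightarrow> y \<in> K \<Longrightarrow> x + y \<in> K" "x \<in> K \<Longrightarrow> y \<in> K \<Longrightarrow> x * y \<in> K"
    "x \<in> K \<Longrightarrow> - x \<in> K" "x \<in> K \<Longrightarrow> inverse x \<in> K"
    using assms by (auto simp: subfld_def)
  show "x \<in> K \<Longrightarrow> y \<in> K \<Longrightarrow> x - y \<in> K"
    using assms unfolding subfld_def by (metis uminus_add_conv_diff add.commute)
  show "x \<in> K \<Longrightarrow> y \<in> K \<Longrightarrow> x / y \<in> K"
    using assms unfolding subfld_def by (metis field_class.field_divide_inverse)
qed

lemma subfld_sum: "subfld K \<Longrightarrow> (\<And>i. i \<in> I \<Longrightarrow> f i \<in> K) \<Longrightarrow> (\<Sum>i\<in>I. f i) \<in> K"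
  by (induction I rule: infinite_finite_induct) (auto simp: subfldD)

lemma subfld_prod: "subfld K \<Longrightarrow> (\<And>i. i \<in> I \<Longrightarrow> f i \<in> K) \<Longrightarrow> (\<Prod>i\<in>I. f i) \<in> K"
  by (induction I rule: infinite_finite_induct) (auto simp: subfldD)

lemma subfld_Inter: "(\<And>K. K \<in> \<K> \<Longrightarrow> subfld K) \<Longrightarrow> subfld (\<Inter>\<K>)"
  by (auto simp: subfld_def)

lemma subfld_fgen: "subfld (fgen S)"
  unfolding fgen_def by (rule subfld_Inter) auto

lemma fgen_incl: "S \<subseteq> fgen S"
  by (auto simp: fgen_def)

lemma fgen_least: "subfld K \<Longrightarrow> S \<subseteq> K \<Longrightarrow> fgen S \<subseteq> K"
  by (auto simp: fgen_def)

lemma fgen_eq: "subfld K \<Longrightarrow> fgen K = K"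
  using fgen_incl fgen_least by blast

lemma fgen_mono: "S \<subseteq> T \<Longrightarrow> fgen S \<subseteq> fgen T"
  by (auto simp: fgen_def)

lemma fgen_Un_fgen: "fgen (fgen S \<union> T) = fgen (S \<union> T)"
proof
  show "fgen (fgen S \<union> T) \<subseteq> fgen (S \<union> T)"
    by (intro fgen_least subfld_fgen Un_least fgen_mono Un_upper1 order_trans[OF Un_upper2 fgen_incl])
  show "fgen (S \<union> T) \<subseteq> fgen (fgen S \<union> T)"
    by (intro fgen_mono Un_mono fgen_incl order_refl)
qed

lemma polys_over_mono: "K \<subseteq> L \<Longrightarrow> polys_over K \<subseteq> polys_over L"
  by (auto simp: polys_over_def)

lemma algebraic_over_mono: "algebraic_over K \<Longrightarrow> K \<subseteq> L \<Longrightarrow> algebraic_over L"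
  unfolding algebraic_over_def using polys_over_mono by blast

lemma separable_over_mono: "separable_over K x \<Longrightarrow> K \<subseteq> L \<Longrightarrow> separable_over L x"
  unfolding separable_over_def using polys_over_mono by blast

section \<open>Polynomials with coefficients in a subfield\<close>

lemma polys_over_closed:
  assumes K: "subfld K"
  shows "0 \<in> polys_over K" "1 \<in> polys_over K"
    "p \<in> polys_over K \<Longrightarrow> q \<in> polys_over K \<Longrightarrow> p + q \<in> polys_over K"
    "p \<in> polys_over K \<Longrightarrow> q \<in> polys_over K \<Longrightarrow> p - q \<in> polys_over K"
    "p \<in> polys_over K \<Longrightarrow> q \<in> polys_over K \<Longrightarrow> p * q \<in> polys_over K"
    "p \<in> polys_over K \<Longrightarrow> - p \<in> polys_over K"
    "c \<in> K \<Longrightarrow> monom c n \<in> polys_over K" "c \<in> K \<Longrightarrow> [:c:] \<in> polys_over K"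
    "c \<in> K \<Longrightarrow> p \<in> polys_over K \<Longrightarrow> Polynomial.smult c p \<in> polys_over K"
    "pCons c p \<in> polys_over K \<longleftrightarrow> c \<in> K \<and> p \<in> polys_over K"
proof -
  show "pCons c p \<in> polys_over K \<longleftrightarrow> c \<in> K \<and> p \<in> polys_over K"
    by (auto simp: polys_over_def coeff_pCons split: nat.splits)
qed (auto simp: polys_over_def coeff_mult coeff_pCons subfldD[OF K]
     split: nat.splits intro!: subfld_sum[OF K])

lemma polys_over_prod:
  "subfld K \<Longrightarrow> (\<And>i. i \<in> I \<Longrightarrow> f i \<in> polys_over K) \<Longrightarrow> (\<Prod>i\<in>I. f i) \<in> polys_over K"
  by (induction I rule: infinite_finite_induct) (auto simp: polys_over_closed)

text \<open>R is only assumed closed under sums and products, so that the lemma already applies to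
  K[x] before that ring is known to be a field.\<close>

lemma poly_in_ring:
  assumes "K \<subseteq> R" "0 \<in> R" "\<And>a b. a \<in> R \<Longrightarrow> b \<in> R \<Longrightarrow> a + b \<in> R \<and> a * b \<in> R"
    "p \<in> polys_over K" "z \<in> R"
  shows "poly p z \<in> R"
  using assms(4)
proof (induction p)
  case (pCons a p)
  then have "a \<in> K" "p \<in> polys_over K"
    by (auto simp: polys_over_def coeff_pCons split: nat.splits)
  with pCons show ?case using assms by auto
qed (use assms in auto)

lemma poly_in_subfld: "subfld K \<Longrightarrow> p \<in> polys_over K \<Longrightarrow> z \<in> K \<Longrightarrow> poly p z \<in> K"
  by (rule poly_in_ring[of K K]) (auto simp: subfldD)

text \<open>Long division divides only leading coefficients, so quotient and remainder stay over K.
  The induction on the degree cancels one leading term at a time.\<close>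

lemma polys_over_div:
  assumes K: "subfld K" and p: "p \<in> polys_over K" "p \<noteq> 0" and q: "q \<in> polys_over K"
  shows "\<exists>r\<in>polys_over K. \<exists>s\<in>polys_over K. q = p * r + s \<and>
    (s = 0 \<or> Polynomial.degree s < Polynomial.degree p)"
  using q
proof (induction "Polynomial.degree q" arbitrary: q rule: less_induct)
  case less
  show ?case
  proof (cases "q = 0 \<or> Polynomial.degree q < Polynomial.degree p")
    case True
    then show ?thesis
      using less.prems polys_over_closed(1)[OF K] by (intro bexI[of _ 0] bexI[of _ q]) auto
  next
    case False
    define m where "m = monom (Polynomial.lead_coeff q / Polynomial.lead_coeff p)
      (Polynomial.degree q - Polynomial.degree p)"
    have m: "m \<in> polys_over K"
      using less.prems p unfolding m_def
      by (intro polys_over_closed subfldD K) (auto simp: polys_over_def)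
    define q' where "q' = q - p * m"
    have q': "q' \<in> polys_over K"
      unfolding q'_def using m p less.prems by (intro polys_over_closed K)
    have "Polynomial.lead_coeff q \<noteq> 0" using False by auto
    then have c0: "Polynomial.lead_coeff q / Polynomial.lead_coeff p \<noteq> 0" using p by auto
    then have dm: "Polynomial.degree (p * m) = Polynomial.degree q"
      using False p by (subst degree_mult_eq) (auto simp: m_def degree_monom_eq monom_eq_0_iff)
    have "Polynomial.coeff q' (Polynomial.degree q) = 0"
      using False p by (simp add: q'_def m_def mult.commute[of p] coeff_monom_mult)
    moreover have "Polynomial.degree q' \<le> Polynomial.degree q"
      unfolding q'_def using dm by (intro degree_diff_le) auto
    ultimately have *: "q' = 0 \<or> Polynomial.degree q' < Polynomial.degree q"
      by (metis eq_zero_or_degree_less)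
    have "\<exists>r\<in>polys_over K. \<exists>s\<in>polys_over K. q' = p * r + s \<and>
      (s = 0 \<or> Polynomial.degree s < Polynomial.degree p)"
    proof (cases "q' = 0")
      case True
      then show ?thesis using polys_over_closed(1)[OF K] by (intro bexI[of _ 0]) auto
    next
      case False
      then show ?thesis using * less.hyps q' by blast
    qed
    then obtain r s where rs: "r \<in> polys_over K" "s \<in> polys_over K" "q' = p * r + s"
      "s = 0 \<or> Polynomial.degree s < Polynomial.degree p" by blast
    then have "q = p * (r + m) + s" by (simp add: q'_def algebra_simps)
    then show ?thesis using rs m polys_over_closed(3)[OF K] by blast
  qed
qed

lemma min_poly_dvd:
  assumes K: "subfld K" and p: "min_poly K x p" and q: "q \<in> polys_over K" "poly q x = 0"
  obtains r where "r \<in> polys_over K" "q = p * r"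
proof -
  have pK: "p \<in> polys_over K" "p \<noteq> 0" "poly p x = 0" using p by (auto simp: min_poly_def)
  obtain r s where rs: "r \<in> polys_over K" "s \<in> polys_over K" "q = p * r + s"
    "s = 0 \<or> Polynomial.degree s < Polynomial.degree p"
    using polys_over_div[OF K pK(1,2) q(1)] by blast
  then have "poly s x = 0" using q pK by simp
  then have "s = 0" using p rs unfolding min_poly_def by (metis leD)
  then show ?thesis using rs that by simp
qed

lemma min_poly_exists:
  assumes "algebraic_over K" shows "\<exists>p. min_poly K x p"
proof -
  let ?P = "\<lambda>p. p \<in> polys_over K \<and> p \<noteq> 0 \<and> poly p x = 0"
  obtain p where "?P p" using assms by (auto simp: algebraic_over_def)
  then have "is_arg_min Polynomial.degree ?P (arg_min Polynomial.degree ?P)"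
    by (intro is_arg_min_arg_min_nat) auto
  then show ?thesis by (auto simp: is_arg_min_linorder min_poly_def)
qed

lemma min_poly_root:
  assumes "min_poly K x p" shows "Polynomial.degree p > 0"
proof (rule ccontr)
  assume "\<not> ?thesis"
  then obtain c where "p = [:c:]" by (metis degree_eq_zeroE gr0I)
  then show False using assms by (auto simp: min_poly_def)
qed

section \<open>Simple algebraic extensions\<close>

lemma adj_ring:
  assumes K: "subfld K"
  shows "K \<subseteq> adj K x" "x \<in> adj K x" "0 \<in> adj K x"
    "a \<in> adj K x \<Longrightarrow> b \<in> adj K x \<Longrightarrow> a + b \<in> adj K x \<and> a * b \<in> adj K x"
proof -
  show "K \<subseteq> adj K x"
    unfolding adj_def using polys_over_closed(8)[OF K] by (auto intro!: image_eqI[of _ _ "[:_:]"])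
  then show "0 \<in> adj K x" using subfldD[OF K] by auto
  have "[:0,1:] \<in> polys_over K" by (simp add: polys_over_closed[OF K] subfldD[OF K])
  then show "x \<in> adj K x" unfolding adj_def by (intro image_eqI[of _ _ "[:0,1:]"]) auto
  assume "a \<in> adj K x" "b \<in> adj K x"
  then obtain p q where "p \<in> polys_over K" "q \<in> polys_over K" "a = poly p x" "b = poly q x"
    by (auto simp: adj_def)
  then show "a + b \<in> adj K x \<and> a * b \<in> adj K x"
    unfolding adj_def using polys_over_closed(3,5)[OF K]
    by (metis imageI poly_add poly_mult)
qed

text \<open>The minimal polynomial of \<open>z\<close> expresses \<open>1 / z\<close> as a polynomial in \<open>z\<close>, so every ring over
  \<open>K\<close> that consists of algebraic elements is a field.\<close>

lemma algebraic_inverse: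
  assumes K: "subfld K" "algebraic_over K" and "z \<noteq> 0"
  obtains p where "p \<in> polys_over K" "inverse z = poly p z"
proof -
  obtain m where m: "min_poly K z m" using min_poly_exists K by blast
  obtain c p where mp: "m = pCons c p" by (cases m)
  have mK: "c \<in> K" "p \<in> polys_over K" using m K by (auto simp: min_poly_def mp polys_over_closed)
  have eq: "c + z * poly p z = 0" using m by (auto simp: min_poly_def mp)
  have "c \<noteq> 0"
  proof
    assume "c = 0"
    then have "poly p z = 0" "p \<noteq> 0" using eq assms m by (auto simp: min_poly_def mp)
    then show False using m mK by (auto simp: min_poly_def mp)
  qed
  then have "inverse z = poly (Polynomial.smult (- inverse c) p) z"
    using eq \<open>z \<noteq> 0\<close> by (simp add: field_simps add_eq_0_iff)
  moreover have "Polynomial.smult (- inverse c) p \<in> polys_over K"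
    using mK K by (intro polys_over_closed subfldD) auto
  ultimately show ?thesis using that by blast
qed

lemma adj_eq_fgen:
  assumes K: "subfld K" "algebraic_over K"
  shows "adj K x = fgen (insert x K)"
proof
  have "- a \<in> adj K x" if "a \<in> adj K x" for a
  proof -
    have "- 1 \<in> adj K x" using adj_ring(1)[OF K(1)] subfldD[OF K(1)] by blast
    then have "- 1 * a \<in> adj K x" using adj_ring(4)[OF K(1)] that by blast
    then show ?thesis by simp
  qed
  moreover have "inverse a \<in> adj K x" if a: "a \<in> adj K x" for a
  proof (cases "a = 0")
    case False
    then obtain p where p: "p \<in> polys_over K" "inverse a = poly p a"
      using algebraic_inverse[OF K] by blast
    then show ?thesis using poly_in_ring[of K "adj K x" p a] adj_ring[OF K(1)] a by metis
  qed (use adj_ring[OF K(1)] in auto)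
  ultimately have "subfld (adj K x)"
    unfolding subfld_def using adj_ring[OF K(1)] subfldD(2)[OF K(1)] by blast
  then show "fgen (insert x K) \<subseteq> adj K x" using adj_ring[OF K(1)] by (intro fgen_least) auto
  show "adj K x \<subseteq> fgen (insert x K)"
    using fgen_incl[of "insert x K"] subfldD[OF subfld_fgen[of "insert x K"]]
    unfolding adj_def by (auto intro!: poly_in_ring[of K])
qed

section \<open>Embeddings of subfields and their extension\<close>

context
  fixes K :: "'a::field set" and \<sigma>
  assumes K: "subfld K" and \<sigma>: "emb K \<sigma>"
begin

lemma emb_simps:
  shows "\<sigma> 1 = 1" "\<sigma> 0 = 0"
    "x \<in> K \<Longrightarrow> y \<in> K \<Longrightarrow> \<sigma> (x + y) = \<sigma> x + \<sigma> y" "x \<in> K \<Longrightarrow> y \<in> K \<Longrightarrow> \<sigma> (x * y) = \<sigma> x * \<sigma> y"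
    "x \<in> K \<Longrightarrow> \<sigma> (- x) = - \<sigma> x" "x \<in> K \<Longrightarrow> y \<in> K \<Longrightarrow> \<sigma> (x - y) = \<sigma> x - \<sigma> y"
    "x \<in> K \<Longrightarrow> \<sigma> (inverse x) = inverse (\<sigma> x)" "x \<in> K \<Longrightarrow> \<sigma> x = 0 \<longleftrightarrow> x = 0"
proof -
  note k = subfldD[OF K]
  show 1: "\<sigma> 1 = 1" and add: "\<And>x y. x \<in> K \<Longrightarrow> y \<in> K \<Longrightarrow> \<sigma> (x + y) = \<sigma> x + \<sigma> y"
    and mult: "\<And>x y. x \<in> K \<Longrightarrow> y \<in> K \<Longrightarrow> \<sigma> (x * y) = \<sigma> x * \<sigma> y"
    using \<sigma> by (auto simp: emb_def)
  have "\<sigma> 0 + \<sigma> 0 = \<sigma> 0" using add[of 0 0] k by simp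
  then show 0: "\<sigma> 0 = 0" by (metis add_cancel_right_right)
  have "\<sigma> x + \<sigma> (- x) = 0" if "x \<in> K" for x using add[of x "- x"] k that 0 by simp
  then show um: "\<And>x. x \<in> K \<Longrightarrow> \<sigma> (- x) = - \<sigma> x" by (metis add_eq_0_iff)
  then show "x \<in> K \<Longrightarrow> y \<in> K \<Longrightarrow> \<sigma> (x - y) = \<sigma> x - \<sigma> y"
    using add[of x "- y"] k by simp
  have inv1: "\<sigma> x * \<sigma> (inverse x) = 1" if "x \<in> K" "x \<noteq> 0" for x
    using mult[of x "inverse x"] k that 1 by simp
  show z: "x \<in> K \<Longrightarrow> \<sigma> x = 0 \<longleftrightarrow> x = 0" for x using inv1 0 by fastforce
  show "x \<in> K \<Longrightarrow> \<sigma> (inverse x) = inverse (\<sigma> x)"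
    using inv1[of x] 0 by (cases "x = 0") (auto simp: inverse_unique)
qed

lemma emb_inj: "inj_on \<sigma> K"
proof (rule inj_onI)
  fix x y assume "x \<in> K" "y \<in> K" "\<sigma> x = \<sigma> y"
  then have "\<sigma> (x - y) = 0" "x - y \<in> K" using emb_simps(6) subfldD[OF K] by auto
  then show "x = y" using emb_simps(8) by auto
qed

lemma emb_sum: "(\<And>i. i \<in> I \<Longrightarrow> f i \<in> K) \<Longrightarrow> \<sigma> (\<Sum>i\<in>I. f i) = (\<Sum>i\<in>I. \<sigma> (f i))"
  by (induction I rule: infinite_finite_induct) (auto simp: emb_simps subfld_sum[OF K])

lemma emb_prod: "(\<And>i. i \<in> I \<Longrightarrow> f i \<in> K) \<Longrightarrow> \<sigma> (\<Prod>i\<in>I. f i) = (\<Prod>i\<in>I. \<sigma> (f i))"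
  by (induction I rule: infinite_finite_induct) (auto simp: emb_simps subfld_prod[OF K])

lemma coeff_map_emb: "Polynomial.coeff (map_poly \<sigma> p) n = \<sigma> (Polynomial.coeff p n)"
  by (simp add: coeff_map_poly emb_simps)

lemma map_emb_add: "p \<in> polys_over K \<Longrightarrow> q \<in> polys_over K \<Longrightarrow>
    map_poly \<sigma> (p + q) = map_poly \<sigma> p + map_poly \<sigma> q"
  by (rule poly_eqI) (simp add: coeff_map_emb emb_simps polys_over_def)

lemma map_emb_diff: "p \<in> polys_over K \<Longrightarrow> q \<in> polys_over K \<Longrightarrow>
    map_poly \<sigma> (p - q) = map_poly \<sigma> p - map_poly \<sigma> q"
  by (rule poly_eqI) (simp add: coeff_map_emb emb_simps polys_over_def)

lemma map_emb_mult: "p \<in> polys_over K \<Longrightarrow> q \<in> polys_over K \<Longrightarrow>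
    map_poly \<sigma> (p * q) = map_poly \<sigma> p * map_poly \<sigma> q"
  by (rule poly_eqI)
    (auto simp: coeff_map_emb emb_simps polys_over_def coeff_mult emb_sum subfldD[OF K]
      intro!: sum.cong)

lemma degree_map_emb: "p \<in> polys_over K \<Longrightarrow> Polynomial.degree (map_poly \<sigma> p) = Polynomial.degree p"
  by (cases "p = 0") (auto intro!: map_poly_degree_eq simp: polys_over_def emb_simps)

lemma emb_poly: "p \<in> polys_over K \<Longrightarrow> x \<in> K \<Longrightarrow> \<sigma> (poly p x) = poly (map_poly \<sigma> p) (\<sigma> x)"
proof (induction p)
  case (pCons a p)
  then have "a \<in> K" "p \<in> polys_over K" by (auto simp: polys_over_closed[OF K])
  then show ?case using pCons
    by (simp add: emb_simps subfldD[OF K] poly_in_subfld[OF K] map_poly_pCons)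
qed (simp add: emb_simps)

end

lemma emb_mono: "emb L \<sigma> \<Longrightarrow> K \<subseteq> L \<Longrightarrow> emb K \<sigma>"
  by (auto simp: emb_def)

lemma map_poly_id_on: "p \<in> polys_over K \<Longrightarrow> \<sigma> 0 = 0 \<Longrightarrow> (\<And>c. c \<in> K \<Longrightarrow> \<sigma> c = c) \<Longrightarrow> map_poly \<sigma> p = p"
  by (rule poly_eqI) (simp add: coeff_map_poly polys_over_def)

text \<open>A value q(x) is sent to the value at y of the polynomial with transported coefficients.
  Two polynomials with equal value at x differ by a multiple of p, and the transported p vanishes at
  y, so the image does not depend on the choice of q.\<close>

lemma emb_extend_adj:
  assumes K: "subfld K" and \<sigma>: "emb K \<sigma>" and p: "min_poly K x p"
    and y: "poly (map_poly \<sigma> p) y = 0"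
  obtains \<tau> where "emb (adj K x) \<tau>" "\<And>c. c \<in> K \<Longrightarrow> \<tau> c = \<sigma> c"
    "\<And>q. q \<in> polys_over K \<Longrightarrow> \<tau> (poly q x) = poly (map_poly \<sigma> q) y"
proof -
  define \<tau> where "\<tau> z = poly (map_poly \<sigma> (SOME q. q \<in> polys_over K \<and> poly q x = z)) y" for z
  have pK: "p \<in> polys_over K" using p by (auto simp: min_poly_def)
  have eq: "poly (map_poly \<sigma> q) y = poly (map_poly \<sigma> q') y"
    if q: "q \<in> polys_over K" "q' \<in> polys_over K" "poly q x = poly q' x" for q q'
  proof -
    obtain r where r: "r \<in> polys_over K" "q - q' = p * r"
      using min_poly_dvd[OF K p, of "q - q'"] q polys_over_closed(4)[OF K] by auto
    have "map_poly \<sigma> q - map_poly \<sigma> q' = map_poly \<sigma> p * map_poly \<sigma> r"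
      using map_emb_diff[OF K \<sigma> q(1,2)] map_emb_mult[OF K \<sigma> pK r(1)] r by simp
    then have "poly (map_poly \<sigma> q - map_poly \<sigma> q') y = 0" using y by simp
    then show ?thesis by simp
  qed
  have \<tau>: "\<tau> (poly q x) = poly (map_poly \<sigma> q) y" if "q \<in> polys_over K" for q
  proof -
    have "\<exists>q'. q' \<in> polys_over K \<and> poly q' x = poly q x" using that by blast
    from someI_ex[OF this] show ?thesis unfolding \<tau>_def using eq that by blast
  qed
  have c: "\<tau> c = \<sigma> c" if "c \<in> K" for c
    using \<tau>[of "[:c:]"] that polys_over_closed(8)[OF K] emb_simps[OF K \<sigma>]
    by (simp add: map_poly_pCons)
  have "emb (adj K x) \<tau>"
    unfolding emb_def
  proof (intro conjI ballI)
    show "\<tau> 1 = 1" using c subfldD[OF K] emb_simps[OF K \<sigma>] by simp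
    fix a b assume "a \<in> adj K x" "b \<in> adj K x"
    then obtain q r where qr: "q \<in> polys_over K" "r \<in> polys_over K" "a = poly q x" "b = poly r x"
      by (auto simp: adj_def)
    show "\<tau> (a + b) = \<tau> a + \<tau> b"
      using \<tau>[of "q + r"] \<tau>[of q] \<tau>[of r] qr polys_over_closed(3)[OF K]
      by (simp add: map_emb_add[OF K \<sigma>])
    show "\<tau> (a * b) = \<tau> a * \<tau> b"
      using \<tau>[of "q * r"] \<tau>[of q] \<tau>[of r] qr polys_over_closed(5)[OF K]
      by (simp add: map_emb_mult[OF K \<sigma>])
  qed
  then show ?thesis using that c \<tau> by blast
qed

text \<open>The generators are adjoined one by one. The transported minimal polynomial has positive
  degree, hence a root in the algebraically closed ambient type, and that root is the image of the
  new generator.\<close>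

lemma emb_extend_finite:
  fixes K :: "'a::alg_closed_field set"
  assumes "finite S" "subfld K" "algebraic_over K" "emb K \<sigma>"
  shows "\<exists>\<tau>. emb (fgen (K \<union> S)) \<tau> \<and> (\<forall>c\<in>K. \<tau> c = \<sigma> c)"
  using assms
proof (induction S arbitrary: K \<sigma>)
  case empty
  then show ?case by (auto simp: fgen_eq)
next
  case (insert x S)
  note K = \<open>subfld K\<close> and \<sigma> = \<open>emb K \<sigma>\<close>
  obtain p where p: "min_poly K x p" using min_poly_exists insert by blast
  then have "Polynomial.degree (map_poly \<sigma> p) > 0"
    using degree_map_emb[OF K \<sigma>, of p] min_poly_root[OF p] by (auto simp: min_poly_def)
  then obtain y where "poly (map_poly \<sigma> p) y = 0"
    using alg_closed_imp_poly_has_root by blast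
  then obtain \<tau> where \<tau>: "emb (adj K x) \<tau>" "\<And>c. c \<in> K \<Longrightarrow> \<tau> c = \<sigma> c"
    using emb_extend_adj[OF K \<sigma> p] by metis
  have adj: "adj K x = fgen (insert x K)" using adj_eq_fgen insert by blast
  then have sub: "K \<subseteq> adj K x" "subfld (adj K x)"
    using adj_ring(1)[OF K] subfld_fgen by auto
  obtain \<tau>' where \<tau>': "emb (fgen (adj K x \<union> S)) \<tau>'" "\<forall>c\<in>adj K x. \<tau>' c = \<tau> c"
    using insert.IH[OF sub(2) algebraic_over_mono[OF insert.prems(2) sub(1)] \<tau>(1)] by blast
  have "fgen (adj K x \<union> S) = fgen (K \<union> insert x S)"
    unfolding adj fgen_Un_fgen by simp
  then show ?case using \<tau>' \<tau>(2) sub(1) by (metis subsetD)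
qed

section \<open>Separability and elements fixed by all embeddings\<close>

lemma card_roots_le: "p \<noteq> 0 \<Longrightarrow> card {x. poly p x = 0} \<le> Polynomial.degree (p::'a::field poly)"
  by (rule card_poly_roots_bound)

text \<open>The minimal polynomial divides the separable witness, f = p r. Since f has deg p + deg r
  roots and neither factor can have more roots than its degree, both bounds are attained.\<close>

lemma separable_min_poly:
  assumes K: "subfld K" and x: "separable_over K x" and p: "min_poly K x p"
  shows "card {z. poly p z = 0} = Polynomial.degree p"
proof -
  obtain f where f: "f \<in> polys_over K" "f \<noteq> 0" "poly f x = 0"
    "card {z. poly f z = 0} = Polynomial.degree f"
    using x by (auto simp: separable_over_def)
  obtain r where r: "f = p * r" using min_poly_dvd[OF K p f(1,3)] by blast
  then have nz: "p \<noteq> 0" "r \<noteq> 0" using f by auto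
  have "{z. poly f z = 0} = {z. poly p z = 0} \<union> {z. poly r z = 0}" using r by auto
  then have "card {z. poly f z = 0} \<le> card {z. poly p z = 0} + card {z. poly r z = 0}"
    by (simp add: card_Un_le)
  moreover have "Polynomial.degree f = Polynomial.degree p + Polynomial.degree r"
    using r nz degree_mult_eq by blast
  ultimately show ?thesis using card_roots_le[OF nz(1)] card_roots_le[OF nz(2)] f(4) by linarith
qed

lemma min_poly_remainder:
  assumes K: "subfld K" and p: "min_poly K x p" and z: "z \<in> adj K x"
  obtains q where "q \<in> polys_over K" "poly q x = z" "Polynomial.degree q < Polynomial.degree p"
proof -
  obtain q where q: "q \<in> polys_over K" "poly q x = z" using z by (auto simp: adj_def)
  have pK: "p \<in> polys_over K" "p \<noteq> 0" "poly p x = 0" using p by (auto simp: min_poly_def)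
  obtain r s where "r \<in> polys_over K" "s \<in> polys_over K" "q = p * r + s"
    "s = 0 \<or> Polynomial.degree s < Polynomial.degree p"
    using polys_over_div[OF K pK(1,2) q(1)] by blast
  then show ?thesis using that[of s] pK q min_poly_root[OF p] by auto
qed

text \<open>Induction on the number of generators. An \<open>x = q(r)\<close> in \<open>K(r)\<close> that no embedding moves makes
  \<open>q\<close> take the value \<open>x\<close> at all conjugates of \<open>r\<close>, and there are more of them than the degree of \<open>q\<close>.\<close>

lemma fixed_by_embeddings:
  fixes K :: "'a::alg_closed_field set"
  assumes "finite S" "subfld K" "algebraic_over K" "\<And>s. s \<in> S \<Longrightarrow> separable_over K s"
    "x \<in> fgen (K \<union> S)"
    "\<And>\<tau>. emb (fgen (K \<union> S)) \<tau> \<Longrightarrow> (\<forall>c\<in>K. \<tau> c = c) \<Longrightarrow> \<tau> x = x"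
  shows "x \<in> K"
  using assms
proof (induction S arbitrary: K)
  case empty
  then show ?case by (simp add: fgen_eq)
next
  case (insert r S)
  note K = \<open>subfld K\<close>
  have id: "emb K id" by (simp add: emb_def)
  have adj: "adj K r = fgen (insert r K)" using adj_eq_fgen insert by blast
  then have sub: "K \<subseteq> adj K r" "subfld (adj K r)"
    using adj_ring(1)[OF K] subfld_fgen by auto
  have eq: "fgen (adj K r \<union> S) = fgen (K \<union> insert r S)"
    unfolding adj fgen_Un_fgen by simp
  \<comment> \<open>An embedding that fixes K(r) also fixes K, so the hypothesis on x passes to the
    larger base and the induction hypothesis places x in K(r).\<close>
  have "x \<in> adj K r"
  proof (rule insert.IH[OF sub(2)])
    show "algebraic_over (adj K r)" using insert.prems(2) sub(1) by (rule algebraic_over_mono)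
    show "separable_over (adj K r) s" if "s \<in> S" for s
      using insert.prems(3) that sub(1) separable_over_mono by blast
    show "x \<in> fgen (adj K r \<union> S)" using insert.prems(4) eq by simp
    show "\<tau> x = x" if "emb (fgen (adj K r \<union> S)) \<tau>" "\<forall>c\<in>adj K r. \<tau> c = c" for \<tau>
      using insert.prems(5) that eq sub(1) by (metis subsetD)
  qed
  obtain p where p: "min_poly K r p" using min_poly_exists insert by blast
  obtain q where q: "q \<in> polys_over K" "poly q r = x" "Polynomial.degree q < Polynomial.degree p"
    using min_poly_remainder[OF K p \<open>x \<in> adj K r\<close>] .
  have "poly q y = x" if y: "poly p y = 0" for y
  proof -
    obtain \<tau> where \<tau>: "emb (adj K r) \<tau>" "\<And>c. c \<in> K \<Longrightarrow> \<tau> c = id c"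
      "\<And>q. q \<in> polys_over K \<Longrightarrow> \<tau> (poly q r) = poly (map_poly id q) y"
      using emb_extend_adj[OF K id p, of y] y by (metis map_poly_id id_apply)
    obtain \<tau>' where \<tau>': "emb (fgen (adj K r \<union> S)) \<tau>'" "\<forall>c\<in>adj K r. \<tau>' c = \<tau> c"
      using emb_extend_finite[OF \<open>finite S\<close> sub(2) algebraic_over_mono[OF insert.prems(2) sub(1)] \<tau>(1)]
      by blast
    have "\<forall>c\<in>K. \<tau>' c = c" using \<tau>'(2) \<tau>(2) sub(1) by auto
    then have "\<tau>' x = x" using insert.prems(5) \<tau>'(1) eq by simp
    then show ?thesis using \<tau>'(2) \<tau>(3)[OF q(1)] q(2) \<open>x \<in> adj K r\<close> by simp
  qed
  then have "{z. poly p z = 0} \<subseteq> {z. poly (q - [:x:]) z = 0}" by auto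
  moreover have "card {z. poly p z = 0} = Polynomial.degree p"
    using separable_min_poly[OF K _ p] insert.prems(3) by blast
  moreover have "Polynomial.degree (q - [:x:]) < Polynomial.degree p"
    using q(3) by (intro degree_diff_less) auto
  ultimately have "q - [:x:] = 0"
    using card_roots_le[of "q - [:x:]"] poly_roots_finite[of "q - [:x:]"]
    by (metis card_mono leD order.trans)
  then have "q = [:x:]" by simp
  then show ?case using q(1) polys_over_closed(10)[OF K] by simp
qed

section \<open>Finite groups of field automorphisms\<close>

lemma rta_simps [simp]:
  "carrier ring_of_type_algebra = UNIV" "x \<otimes>\<^bsub>ring_of_type_algebra\<^esub> y = x * y"
  "\<one>\<^bsub>ring_of_type_algebra\<^esub> = 1" "\<zero>\<^bsub>ring_of_type_algebra\<^esub> = 0"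
  "x \<oplus>\<^bsub>ring_of_type_algebra\<^esub> y = (x + y :: 'a::field)"
  by (simp_all add: ring_of_type_algebra_def)

lemma rta_a_inv [simp]: "\<ominus>\<^bsub>ring_of_type_algebra\<^esub> x = (- x :: 'a::field)"
proof -
  interpret R: field "ring_of_type_algebra :: 'a ring" by (rule field_from_type_algebra)
  show ?thesis using R.sum_zero_eq_neg[of "- x" x] by simp
qed

lemma rta_m_inv [simp]:
  assumes "x \<noteq> 0" shows "inv\<^bsub>ring_of_type_algebra\<^esub> x = inverse (x :: 'a::field)"
proof -
  interpret R: field "ring_of_type_algebra :: 'a ring" by (rule field_from_type_algebra)
  show ?thesis using R.inv_unique'[of x "inverse x"] assms by simp
qed

lemma subfld_imp_subfield:
  assumes "subfld (K :: 'a::field set)" shows "subfield K ring_of_type_algebra"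
proof -
  interpret R: field "ring_of_type_algebra :: 'a ring" by (rule field_from_type_algebra)
  note k = subfldD[OF assms]
  show ?thesis
    by (rule R.subfieldI', rule R.subringI) (auto simp: k)
qed

text \<open>Splitting fields and composita of the statement are built with
  \<open>generate_field\<close>; this turns them into intersections of type-level subfields.\<close>

lemma generate_field_eq_fgen: "generate_field ring_of_type_algebra S = fgen (S :: 'a::field set)"
proof
  interpret R: field "ring_of_type_algebra :: 'a ring" by (rule field_from_type_algebra)
  show "generate_field ring_of_type_algebra S \<subseteq> fgen S"
    by (rule R.generate_field_min_subfield1[OF _ subfld_imp_subfield[OF subfld_fgen] fgen_incl]) simp
  have "subfld (generate_field ring_of_type_algebra S)"
    unfolding subfld_def
  proof (intro conjI ballI)
    show "0 \<in> generate_field ring_of_type_algebra S" using R.zero_in_generate[of S] by simp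
    show "1 \<in> generate_field ring_of_type_algebra S"
      using generate_field.one[of ring_of_type_algebra S] by simp
    fix x assume x: "x \<in> generate_field ring_of_type_algebra S"
    show "- x \<in> generate_field ring_of_type_algebra S" using generate_field.a_inv[OF x] by simp
    \<comment> \<open>The inversion rule of \<open>generate_field\<close> covers nonzero elements;
      for 0 the convention \<open>inverse 0 = 0\<close> and membership of 0 are used.\<close>
    show "inverse x \<in> generate_field ring_of_type_algebra S"
      using generate_field.m_inv[OF x] R.zero_in_generate[of S] by (cases "x = 0") auto
    fix y assume y: "y \<in> generate_field ring_of_type_algebra S"
    show "x + y \<in> generate_field ring_of_type_algebra S"
      "x * y \<in> generate_field ring_of_type_algebra S"
      using generate_field.eng_add[OF x y] generate_field.eng_mult[OF x y] by simp_all
  qed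
  then show "fgen S \<subseteq> generate_field ring_of_type_algebra S"
    by (intro fgen_least) (auto intro: generate_field.incl)
qed

section \<open>Degrees from bases of powers\<close>

lemma dimension_powers:
  fixes M :: "'a::field set"
  assumes M: "subfld M" and n: "n > 0"
    and indep: "\<And>p. p \<in> polys_over M \<Longrightarrow> Polynomial.degree p < n \<Longrightarrow> poly p y = 0 \<Longrightarrow> p = 0"
  shows "ring.dimension ring_of_type_algebra n M
    {poly p y | p. p \<in> polys_over M \<and> Polynomial.degree p < n}"
proof -
  interpret R: field "ring_of_type_algebra :: 'a ring" by (rule field_from_type_algebra)
  have sf: "subfield M ring_of_type_algebra" by (rule subfld_imp_subfield[OF M])
  define Us where "Us = map (\<lambda>i. y ^ i) [0..<n]"
  \<comment> \<open>Combining coefficients with z, z y, z y^2, ... is Horner evaluation; the free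
    factor z absorbs one power of y in each induction step.\<close>
  have comb: "R.combine Ks (map (\<lambda>i. z * y ^ i) [0..<length Ks]) = z * poly (Poly Ks) y" for Ks z
  proof (induction Ks arbitrary: z)
    case (Cons a Ks)
    have "map (\<lambda>i. z * y ^ i) [0..<length (a # Ks)] =
        z # map (\<lambda>i. (z * y) * y ^ i) [0..<length Ks]"
      by (simp del: upt_Suc add: upt_conv_Cons map_Suc_upt[symmetric] o_def algebra_simps)
    then show ?case using Cons[of "z * y"] by (simp add: algebra_simps)
  qed simp
  have combU: "R.combine Ks Us = poly (Poly Ks) y" if "length Ks = n" for Ks
    using comb[of Ks 1] that by (simp add: Us_def)
  have PolyM: "Poly Ks \<in> polys_over M" if "set Ks \<subseteq> M" for Ks
    using that subfldD[OF M] by (auto simp: polys_over_def nth_default_def)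
  have degP: "Polynomial.degree (Poly Ks) < n" if "length Ks = n" for Ks
    using that n by (intro degree_lessI) (auto simp: nth_default_def)
  have Span: "R.Span M Us = {poly p y | p. p \<in> polys_over M \<and> Polynomial.degree p < n}"
  proof -
    have "R.Span M Us = {R.combine Ks Us |Ks. length Ks = length Us \<and> set Ks \<subseteq> M}"
      using R.Span_eq_combine_set_length_version[OF sf] by simp
    also have "\<dots> = {poly p y | p. p \<in> polys_over M \<and> Polynomial.degree p < n}"
    proof safe
      fix Ks assume "length Ks = length Us" "set Ks \<subseteq> M"
      then show "\<exists>p. R.combine Ks Us = poly p y \<and> p \<in> polys_over M \<and> Polynomial.degree p < n"
        using combU PolyM degP by (intro exI[of _ "Poly Ks"]) (simp add: Us_def)
    next
      fix p assume p: "p \<in> polys_over M" "Polynomial.degree p < n"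
      define Ks where "Ks = map (Polynomial.coeff p) [0..<n]"
      have "Poly Ks = p"
        using p by (intro poly_eqI) (auto simp: Ks_def nth_default_def coeff_eq_0)
      moreover have "set Ks \<subseteq> M" using p by (auto simp: Ks_def polys_over_def)
      ultimately show "\<exists>Ks. poly p y = R.combine Ks Us \<and> length Ks = length Us \<and> set Ks \<subseteq> M"
        using combU[of Ks] by (intro exI[of _ Ks]) (simp add: Ks_def Us_def)
    qed
    finally show ?thesis .
  qed
  have "R.independent M Us"
  proof (rule R.trivial_combine_imp_independent[OF sf])
    fix Ks assume Ks: "set Ks \<subseteq> M" "R.combine Ks Us = \<zero>\<^bsub>ring_of_type_algebra\<^esub>"
    \<comment> \<open>\<open>combine\<close> accepts lists of unequal length, so a relation is first
      brought to length exactly n before it is read as a polynomial of degree below n.\<close>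
    obtain Ks' where Ks': "set (take (length Us) Ks) \<subseteq> set Ks'"
      "set Ks' \<subseteq> set (take (length Us) Ks) \<union> {\<zero>\<^bsub>ring_of_type_algebra\<^esub>}"
      "length Ks' = length Us" "R.combine Ks' Us = \<zero>\<^bsub>ring_of_type_algebra\<^esub>"
      using R.combine_normalize[of Ks Us] Ks by auto
    have "set Ks' \<subseteq> M" using Ks'(2) Ks(1) subfldD(1)[OF M] set_take_subset[of "length Us" Ks] by auto
    moreover have l: "length Ks' = n" using Ks'(3) by (simp add: Us_def)
    ultimately have "Poly Ks' = 0"
      using indep[OF PolyM degP[OF l]] combU[OF l] Ks'(4) by simp
    then have "set Ks' \<subseteq> {0}"
      by (metis Poly_eq_0 set_replicate_conv_if set_replicate subset_refl empty_subsetI)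
    then show "set (take (length Us) Ks) \<subseteq> {\<zero>\<^bsub>ring_of_type_algebra\<^esub>}" using Ks'(1) by auto
  qed simp
  from R.dimension_independent[OF this] show ?thesis
    unfolding Span by (simp add: Us_def)
qed

text \<open>Newton's scheme: a multiple of the product of the X - v over the old nodes corrects the
  value at the new node and leaves the others unchanged. The alternative g = 0 takes care of an
  empty set of nodes, where no degree is below the bound 0.\<close>

lemma interpolation:
  assumes K: "subfld K" and "finite Y" "Y \<subseteq> K" "\<And>w. w \<in> Y \<Longrightarrow> f w \<in> K"
  shows "\<exists>g\<in>polys_over K. (g = 0 \<or> Polynomial.degree g < card Y) \<and> (\<forall>w\<in>Y. poly g w = f w)"
  using assms(2-)
proof (induction Y)
  case empty
  then show ?case using polys_over_closed(1)[OF K] by auto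
next
  case (insert w Y)
  then obtain g where g: "g \<in> polys_over K" "g = 0 \<or> Polynomial.degree g < card Y"
    "\<forall>w\<in>Y. poly g w = f w" by auto
  define q where "q = (\<Prod>v\<in>Y. [:- v, 1:])"
  have q: "q \<in> polys_over K"
    unfolding q_def using insert.prems
    by (intro polys_over_prod[OF K]) (auto simp: polys_over_closed[OF K] subfldD[OF K])
  have qw: "poly q w \<noteq> 0" using insert by (auto simp: q_def poly_prod)
  have q0: "poly q v = 0" if "v \<in> Y" for v using insert that by (auto simp: q_def poly_prod)
  have dq: "Polynomial.degree q = card Y"
    unfolding q_def by (subst degree_prod_eq_sum_degree) auto
  define c where "c = (f w - poly g w) / poly q w"
  have "c \<in> K" unfolding c_def using insert.prems g q by (intro subfldD K poly_in_subfld) auto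
  show ?case
  proof (intro bexI[of _ "g + Polynomial.smult c q"] conjI ballI disjI2)
    show "g + Polynomial.smult c q \<in> polys_over K" using g q \<open>c \<in> K\<close> by (intro polys_over_closed K)
    show "Polynomial.degree (g + Polynomial.smult c q) < card (insert w Y)"
    proof -
      have "Polynomial.degree g \<le> card Y" using g(2) by auto
      then have "Polynomial.degree (g + Polynomial.smult c q) \<le> card Y"
        using dq by (intro degree_add_le) auto
      then show ?thesis using insert by simp
    qed
    show "poly (g + Polynomial.smult c q) v = f v" if "v \<in> insert w Y" for v
      using that g(3) q0 qw by (auto simp: c_def)
  qed
qed

text \<open>Galois theory of K over M in abstract form: a finite group acting faithfully on K whose
  fixed field is exactly M. Products and equality of group elements are tested on K only, because
  automorphisms are stored as extensional functions.\<close>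

locale aut_group =
  fixes K M :: "'a::field set" and G :: "('a \<Rightarrow> 'a) monoid"
  assumes K: "subfld K" and M: "subfld M" and MK: "M \<subseteq> K" and infM: "infinite M"
    and grp: "group G" and fin: "finite (carrier G)"
    and G_emb: "\<sigma> \<in> carrier G \<Longrightarrow> emb K \<sigma>"
    and G_closed: "\<sigma> \<in> carrier G \<Longrightarrow> x \<in> K \<Longrightarrow> \<sigma> x \<in> K"
    and G_fix: "\<sigma> \<in> carrier G \<Longrightarrow> c \<in> M \<Longrightarrow> \<sigma> c = c"
    and G_mult: "\<sigma> \<in> carrier G \<Longrightarrow> \<tau> \<in> carrier G \<Longrightarrow> x \<in> K \<Longrightarrow> (\<sigma> \<otimes>\<^bsub>G\<^esub> \<tau>) x = \<sigma> (\<tau> x)"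
    and G_ext: "\<sigma> \<in> carrier G \<Longrightarrow> \<tau> \<in> carrier G \<Longrightarrow> (\<And>x. x \<in> K \<Longrightarrow> \<sigma> x = \<tau> x) \<Longrightarrow> \<sigma> = \<tau>"
    and fixed: "x \<in> K \<Longrightarrow> (\<And>\<sigma>. \<sigma> \<in> carrier G \<Longrightarrow> \<sigma> x = x) \<Longrightarrow> x \<in> M"
begin

interpretation G: group G by (rule grp)

lemma G_one: "x \<in> K \<Longrightarrow> \<one>\<^bsub>G\<^esub> x = x"
  using G_mult[of "\<one>\<^bsub>G\<^esub>" "\<one>\<^bsub>G\<^esub>" x] emb_inj[OF K G_emb[of "\<one>\<^bsub>G\<^esub>"]] G_closed[of "\<one>\<^bsub>G\<^esub>"]
  by (auto dest: inj_onD)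

text \<open>Let \<theta> separate the old pairs and y the new one. A pair that agrees on \<theta> +
  c y admits at most one value of c, so all but finitely many c in the infinite field M work for
  every pair at once.\<close>

lemma avoid_coincidences:
  assumes "finite D" "D \<subseteq> carrier G \<times> carrier G" "\<And>\<sigma>. (\<sigma>, \<sigma>) \<notin> D"
  shows "\<exists>\<theta>\<in>K. \<forall>(\<sigma>, \<tau>)\<in>D. \<sigma> \<theta> \<noteq> \<tau> \<theta>"
  using assms
proof (induction D)
  case empty
  then show ?case using subfldD[OF K] by auto
next
  case (insert d D)
  obtain \<sigma> \<tau> where d: "d = (\<sigma>, \<tau>)" by (cases d)
  obtain \<theta> where \<theta>: "\<theta> \<in> K" "\<forall>(\<sigma>, \<tau>)\<in>D. \<sigma> \<theta> \<noteq> \<tau> \<theta>" using insert by auto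
  obtain y where y: "y \<in> K" "\<sigma> y \<noteq> \<tau> y" using G_ext[of \<sigma> \<tau>] insert.prems d by auto
  define B where "B e = {c. (fst e \<theta> - snd e \<theta>) + c * (fst e y - snd e y) = 0}" for e :: "('a \<Rightarrow> 'a) \<times> ('a \<Rightarrow> 'a)"
  have "finite (B e)" if "e \<in> insert d D" for e
  proof (cases "fst e y - snd e y = 0")
    case True
    then have "e \<in> D" using that d y by auto
    then have "fst e \<theta> \<noteq> snd e \<theta>" using \<theta> by auto
    then show ?thesis using True by (auto simp: B_def)
  next
    case False
    then have "B e \<subseteq> {- (fst e \<theta> - snd e \<theta>) / (fst e y - snd e y)}"
      by (auto simp only: B_def mem_Collect_eq singleton_iff nonzero_eq_divide_eq[OF False]
          add_eq_0_iff minus_minus insert_iff subset_iff)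
    then show ?thesis using finite_subset by blast
  qed
  then have "finite (\<Union>e\<in>insert d D. B e)" using insert by auto
  then obtain c where c: "c \<in> M" "c \<notin> (\<Union>e\<in>insert d D. B e)"
    using infM by (meson finite_subset subsetI)
  have cK: "c \<in> K" using c MK by auto
  have "fst e (\<theta> + c * y) \<noteq> snd e (\<theta> + c * y)" if e: "e \<in> insert d D" for e
  proof -
    have m: "\<rho> (\<theta> + c * y) = \<rho> \<theta> + c * \<rho> y" if "\<rho> \<in> carrier G" for \<rho>
      using emb_simps[OF K G_emb[OF that]] \<theta> y cK G_fix[OF that c(1)] subfldD[OF K] by simp
    have "fst e \<in> carrier G" "snd e \<in> carrier G" using e insert.prems by auto
    moreover have "c \<notin> B e" using c e by blast
    ultimately show ?thesis using m by (auto simp: B_def algebra_simps)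
  qed
  moreover have "\<theta> + c * y \<in> K" using \<theta> y cK subfldD[OF K] by auto
  ultimately show ?case by (intro bexI[of _ "\<theta> + c * y"]) auto
qed

lemma primitive_element: "\<exists>\<theta>\<in>K. inj_on (\<lambda>\<sigma>. \<sigma> \<theta>) (carrier G)"
proof -
  let ?D = "{(\<sigma>, \<tau>). \<sigma> \<in> carrier G \<and> \<tau> \<in> carrier G \<and> \<sigma> \<noteq> \<tau>}"
  have "finite ?D" by (rule finite_subset[of _ "carrier G \<times> carrier G"]) (use fin in auto)
  from avoid_coincidences[OF this] obtain \<theta> where "\<theta> \<in> K" "\<forall>(\<sigma>, \<tau>)\<in>?D. \<sigma> \<theta> \<noteq> \<tau> \<theta>" by auto
  then show ?thesis by (intro bexI[of _ \<theta>] inj_onI) auto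
qed

text \<open>If \<open>\<theta>\<close> has distinct conjugates, then so have the polynomials \<open>\<Prod>h\<in>H. (X - \<sigma> (h \<theta>))\<close> for the distinct
  cosets of \<open>H\<close>; a value \<open>c\<close> of \<open>X\<close> that keeps them apart exists because \<open>M\<close> is infinite.\<close>

lemma subgroup_separation:
  assumes H: "subgroup H G"
  obtains y where "y \<in> K"
    "\<And>\<sigma> \<tau>. \<sigma> \<in> carrier G \<Longrightarrow> \<tau> \<in> carrier G \<Longrightarrow> \<sigma> y = \<tau> y \<longleftrightarrow> (\<exists>h\<in>H. \<sigma> = \<tau> \<otimes>\<^bsub>G\<^esub> h)"
proof -
  obtain \<theta> where \<theta>: "\<theta> \<in> K" "inj_on (\<lambda>\<sigma>. \<sigma> \<theta>) (carrier G)" using primitive_element by blast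
  have HG: "H \<subseteq> carrier G" using subgroup.subset[OF H] .
  have finH: "finite H" using HG fin finite_subset by blast
  define P where "P \<sigma> = (\<Prod>h\<in>H. [:- (\<sigma> \<otimes>\<^bsub>G\<^esub> h) \<theta>, 1:])" for \<sigma>
  define B where "B e = {c. poly (P (fst e) - P (snd e)) c = 0}" for e
  let ?D = "{e \<in> carrier G \<times> carrier G. P (fst e) \<noteq> P (snd e)}"
  have "finite (\<Union>e\<in>?D. B e)"
    using fin by (auto simp: B_def simp del: poly_diff intro!: poly_roots_finite)
  then obtain c where c: "c \<in> M" "c \<notin> (\<Union>e\<in>?D. B e)"
    using infM by (meson finite_subset subsetI)
  have cK: "c \<in> K" using c MK by auto
  \<comment> \<open>The polynomial P of the identity, evaluated at c; applying \<sigma> to it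
    evaluates \<open>P \<sigma>\<close> instead.\<close>
  define y where "y = (\<Prod>h\<in>H. c - h \<theta>)"
  have yK: "y \<in> K"
    unfolding y_def using cK \<theta> HG G_closed by (intro subfld_prod[OF K] subfldD[OF K]) auto
  have \<sigma>y: "\<sigma> y = poly (P \<sigma>) c" if \<sigma>: "\<sigma> \<in> carrier G" for \<sigma>
  proof -
    have "\<sigma> y = (\<Prod>h\<in>H. \<sigma> (c - h \<theta>))"
      unfolding y_def using cK \<theta> HG G_closed subfldD(7)[OF K]
      by (intro emb_prod[OF K G_emb[OF \<sigma>]]) auto
    also have "\<dots> = (\<Prod>h\<in>H. c - (\<sigma> \<otimes>\<^bsub>G\<^esub> h) \<theta>)"
    proof (intro prod.cong refl)
      fix h assume "h \<in> H"
      then have "h \<in> carrier G" using HG by auto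
      then show "\<sigma> (c - h \<theta>) = c - (\<sigma> \<otimes>\<^bsub>G\<^esub> h) \<theta>"
        using emb_simps(6)[OF K G_emb[OF \<sigma>] cK, of "h \<theta>"] \<theta> G_closed G_fix[OF \<sigma> c(1)] G_mult \<sigma> by simp
    qed
    finally show ?thesis by (simp add: P_def poly_prod)
  qed
  have "\<sigma> y = \<tau> y \<longleftrightarrow> (\<exists>h\<in>H. \<sigma> = \<tau> \<otimes>\<^bsub>G\<^esub> h)" if s: "\<sigma> \<in> carrier G" "\<tau> \<in> carrier G" for \<sigma> \<tau>
  proof
    assume "\<sigma> y = \<tau> y"
    then have "poly (P \<sigma> - P \<tau>) c = 0" using \<sigma>y[OF s(1)] \<sigma>y[OF s(2)] by simp
    then have "P \<sigma> = P \<tau>" using c(2) s by (auto simp: B_def)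
    moreover have "poly (P \<sigma>) (\<sigma> \<theta>) = 0"
      using finH subgroup.one_closed[OF H] s by (auto simp: P_def poly_prod intro!: bexI[of _ "\<one>\<^bsub>G\<^esub>"])
    ultimately have "poly (P \<tau>) (\<sigma> \<theta>) = 0" by simp
    then obtain h where h: "h \<in> H" "\<sigma> \<theta> = (\<tau> \<otimes>\<^bsub>G\<^esub> h) \<theta>" using finH by (auto simp: P_def poly_prod)
    then have "\<sigma> = \<tau> \<otimes>\<^bsub>G\<^esub> h" using inj_onD[OF \<theta>(2), of \<sigma> "\<tau> \<otimes>\<^bsub>G\<^esub> h"] s HG by auto
    then show "\<exists>h\<in>H. \<sigma> = \<tau> \<otimes>\<^bsub>G\<^esub> h" using h by blast
  next
    assume "\<exists>h\<in>H. \<sigma> = \<tau> \<otimes>\<^bsub>G\<^esub> h"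
    then obtain h where h: "h \<in> H" "\<sigma> = \<tau> \<otimes>\<^bsub>G\<^esub> h" by blast
    \<comment> \<open>Left translation by h permutes H, so the factors for \<sigma> = \<tau> h are
      those for \<tau> in another order.\<close>
    have "P \<sigma> = P \<tau>"
      unfolding P_def h(2)
    proof (rule prod.reindex_bij_witness[of _ "\<lambda>k. inv\<^bsub>G\<^esub> h \<otimes>\<^bsub>G\<^esub> k" "\<lambda>k. h \<otimes>\<^bsub>G\<^esub> k"])
      fix k assume k: "k \<in> H"
      show "inv\<^bsub>G\<^esub> h \<otimes>\<^bsub>G\<^esub> (h \<otimes>\<^bsub>G\<^esub> k) = k" "h \<otimes>\<^bsub>G\<^esub> (inv\<^bsub>G\<^esub> h \<otimes>\<^bsub>G\<^esub> k) = k"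
        using h(1) k HG by (simp_all add: G.m_assoc[symmetric] subset_iff)
      show "h \<otimes>\<^bsub>G\<^esub> k \<in> H" "inv\<^bsub>G\<^esub> h \<otimes>\<^bsub>G\<^esub> k \<in> H"
        using subgroup.m_closed[OF H] subgroup.m_inv_closed[OF H] h(1) k by auto
      show "[:- (\<tau> \<otimes>\<^bsub>G\<^esub> (h \<otimes>\<^bsub>G\<^esub> k)) \<theta>, 1:] = [:- (\<tau> \<otimes>\<^bsub>G\<^esub> h \<otimes>\<^bsub>G\<^esub> k) \<theta>, 1:]"
        using h(1) k HG s by (simp add: G.m_assoc subset_iff)
    qed
    then show "\<sigma> y = \<tau> y" using \<sigma>y[OF s(1)] \<sigma>y[OF s(2)] by simp
  qed
  then show ?thesis using that yK by blast
qed

text \<open>Take \<open>y\<close> separating the cosets of \<open>H\<close>. Lagrange interpolation at the conjugates of \<open>y\<close> writes each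
  element of the fixed field as a polynomial in \<open>y\<close> over \<open>M\<close>, so the powers of \<open>y\<close> form a basis.\<close>

theorem dimension_fixed_field:
  assumes H: "subgroup H G" and n: "n * card H = Coset.order G"
  shows "ring.dimension ring_of_type_algebra n M {x \<in> K. \<forall>h\<in>H. h x = x}"
proof -
  obtain y where y: "y \<in> K"
    "\<And>\<sigma> \<tau>. \<sigma> \<in> carrier G \<Longrightarrow> \<tau> \<in> carrier G \<Longrightarrow> \<sigma> y = \<tau> y \<longleftrightarrow> (\<exists>h\<in>H. \<sigma> = \<tau> \<otimes>\<^bsub>G\<^esub> h)"
    using subgroup_separation[OF H] by blast
  have HG: "H \<subseteq> carrier G" using subgroup.subset[OF H] .
  define Y where "Y = (\<lambda>\<sigma>. \<sigma> y) ` carrier G"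
  have finY: "finite Y" using fin by (simp add: Y_def)
  have YK: "Y \<subseteq> K" using y(1) G_closed by (auto simp: Y_def)
  \<comment> \<open>Each conjugate of y is attained on exactly one coset of H, so there are |G| /
    |H| = n conjugates.\<close>
  have fib: "card {\<sigma> \<in> carrier G. \<sigma> y = w} = card H" if w: "w \<in> Y" for w
  proof -
    obtain \<tau> where \<tau>: "\<tau> \<in> carrier G" "w = \<tau> y" using w by (auto simp: Y_def)
    have "\<sigma> \<in> carrier G \<and> \<sigma> y = w \<longleftrightarrow> (\<exists>h\<in>H. \<sigma> = \<tau> \<otimes>\<^bsub>G\<^esub> h)" for \<sigma>
      using y(2)[of \<sigma> \<tau>] \<tau> HG by (auto simp: subset_iff)
    then have "{\<sigma> \<in> carrier G. \<sigma> y = w} = (\<lambda>h. \<tau> \<otimes>\<^bsub>G\<^esub> h) ` H" by auto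
    moreover have "inj_on (\<lambda>h. \<tau> \<otimes>\<^bsub>G\<^esub> h) H"
      using HG \<tau> G.l_cancel[of \<tau>] by (intro inj_onI) (auto simp: subset_iff)
    ultimately show ?thesis by (simp add: card_image)
  qed
  have "Coset.order G = (\<Sum>w\<in>Y. card {\<sigma> \<in> carrier G. \<sigma> y = w})"
    using sum.image_gen[OF fin, of "\<lambda>_. 1::nat" "\<lambda>\<sigma>. \<sigma> y"] by (simp add: Coset.order_def Y_def)
  also have "\<dots> = card Y * card H" using fib by simp
  finally have "n * card H = card Y * card H" using n by simp
  moreover have "card H > 0"
    using HG fin finite_subset subgroup.one_closed[OF H] card_gt_0_iff by blast
  ultimately have cY: "card Y = n" by simp
  have "y \<in> Y" unfolding Y_def using G_one[OF y(1)] by (intro image_eqI[of _ _ "\<one>\<^bsub>G\<^esub>"]) auto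
  then have n0: "n > 0" using cY finY card_gt_0_iff by blast
  have mapM: "map_poly \<sigma> p = p" if "p \<in> polys_over M" "\<sigma> \<in> carrier G" for p \<sigma>
    using that G_fix emb_simps(2)[OF K G_emb] by (intro map_poly_id_on[of _ M]) auto
  have polyM: "\<sigma> (poly p x) = poly p (\<sigma> x)" if "p \<in> polys_over M" "\<sigma> \<in> carrier G" "x \<in> K" for p \<sigma> x
    using emb_poly[OF K G_emb[OF that(2)], of p x] mapM[OF that(1,2)] polys_over_mono[OF MK] that by auto
  have dim: "ring.dimension ring_of_type_algebra n M
    {poly p y | p. p \<in> polys_over M \<and> Polynomial.degree p < n}"
  proof (rule dimension_powers[OF M n0])
    fix p assume p: "p \<in> polys_over M" "Polynomial.degree p < n" "poly p y = 0"
    \<comment> \<open>A polynomial over M that kills y kills all n conjugates, too many for a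
      nonzero polynomial of degree below n.\<close>
    have "poly p w = 0" if w: "w \<in> Y" for w
    proof -
      obtain \<tau> where \<tau>: "\<tau> \<in> carrier G" "w = \<tau> y" using w by (auto simp: Y_def)
      then show ?thesis using polyM[OF p(1) \<tau>(1) y(1)] p emb_simps(2)[OF K G_emb[OF \<tau>(1)]] by simp
    qed
    then show "p = 0" using p(2) cY n0 by (intro poly_eqI_degree[of Y]) auto
  qed
  have "{poly p y | p. p \<in> polys_over M \<and> Polynomial.degree p < n} = {x \<in> K. \<forall>h\<in>H. h x = x}"
  proof safe
    fix p assume p: "p \<in> polys_over M"
    show "poly p y \<in> K" using p polys_over_mono[OF MK] y(1) by (intro poly_in_subfld[OF K]) auto
    fix h assume h: "h \<in> H"
    then have "h y = y"
      using y(2)[of h "\<one>\<^bsub>G\<^esub>"] HG G_one[OF y(1)]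
      by (metis G.l_one G.one_closed subsetD)
    then show "h (poly p y) = poly p y" using polyM[OF p, of h y] h HG y(1) by auto
  next
    fix z assume z: "z \<in> K" "\<forall>h\<in>H. h z = z"
    \<comment> \<open>The data to interpolate: the conjugate \<sigma> y is assigned the value
      \<sigma> z. This is well defined since \<sigma> y determines \<sigma> up to H and H fixes
      z.\<close>
    define f where "f w = (SOME \<sigma>. \<sigma> \<in> carrier G \<and> \<sigma> y = w) z" for w
    have f: "f (\<sigma> y) = \<sigma> z" if \<sigma>: "\<sigma> \<in> carrier G" for \<sigma>
    proof -
      define \<tau> where "\<tau> = (SOME \<tau>. \<tau> \<in> carrier G \<and> \<tau> y = \<sigma> y)"
      have \<tau>: "\<tau> \<in> carrier G" "\<tau> y = \<sigma> y"
        using someI[of "\<lambda>\<tau>. \<tau> \<in> carrier G \<and> \<tau> y = \<sigma> y" \<sigma>] \<sigma> by (auto simp: \<tau>_def)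
      then obtain h where h: "h \<in> H" "\<tau> = \<sigma> \<otimes>\<^bsub>G\<^esub> h" using y(2) \<sigma> by blast
      have "\<tau> z = \<sigma> (h z)" using G_mult[OF \<sigma> _ z(1), of h] h HG by auto
      also have "h z = z" using z(2) h(1) by blast
      finally show ?thesis by (simp add: f_def \<tau>_def)
    qed
    have "f w \<in> K" if "w \<in> Y" for w using that f G_closed z by (auto simp: Y_def)
    from interpolation[OF K finY YK, of f, OF this] obtain g where
      g: "g \<in> polys_over K" "g = 0 \<or> Polynomial.degree g < card Y" "\<forall>w\<in>Y. poly g w = f w" by auto
    then have dg: "Polynomial.degree g < n" using cY n0 by auto
    \<comment> \<open>Applying \<sigma> permutes the pairs (\<tau> y, \<tau> z), so the transported
      polynomial solves the same interpolation problem, and uniqueness below degree n makes it equal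
      to g. The coefficients of g are then fixed by G and lie in M.\<close>
    have "map_poly \<sigma> g = g" if \<sigma>: "\<sigma> \<in> carrier G" for \<sigma>
    proof (rule poly_eqI_degree[of Y])
      note e = G_emb[OF \<sigma>]
      show "Polynomial.degree (map_poly \<sigma> g) < card Y" "Polynomial.degree g < card Y"
        using dg cY degree_map_emb[OF K e g(1)] by auto
      fix w assume "w \<in> Y"
      then obtain \<tau> where \<tau>: "\<tau> \<in> carrier G" "w = \<tau> y" by (auto simp: Y_def)
      define \<rho> where "\<rho> = inv\<^bsub>G\<^esub> \<sigma> \<otimes>\<^bsub>G\<^esub> \<tau>"
      have \<rho>: "\<rho> \<in> carrier G" "\<sigma> \<otimes>\<^bsub>G\<^esub> \<rho> = \<tau>"
        using \<sigma> \<tau> by (auto simp: \<rho>_def G.m_assoc[symmetric])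
      then have w: "w = \<sigma> (\<rho> y)" "\<tau> z = \<sigma> (\<rho> z)" using G_mult[OF \<sigma> \<rho>(1)] \<tau> y(1) z(1) by auto
      have "\<rho> y \<in> Y" using \<rho> by (auto simp: Y_def)
      have "poly (map_poly \<sigma> g) w = \<sigma> (poly g (\<rho> y))"
        using emb_poly[OF K e g(1)] \<open>\<rho> y \<in> Y\<close> YK w by auto
      also have "\<dots> = \<tau> z" using g(3) \<open>\<rho> y \<in> Y\<close> f[OF \<rho>(1)] w by simp
      also have "\<dots> = poly g w" using g(3) \<open>w \<in> Y\<close> f[OF \<tau>(1)] \<tau> by simp
      finally show "poly (map_poly \<sigma> g) w = poly g w" .
    qed
    then have "g \<in> polys_over M"
      unfolding polys_over_def using g(1) coeff_map_emb[OF K G_emb, of _ g]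
      by (auto simp: polys_over_def intro!: fixed) metis
    moreover have "poly g y = z"
      using g(3) \<open>y \<in> Y\<close> f[of "\<one>\<^bsub>G\<^esub>"] G_one y(1) z(1) by simp
    ultimately show "\<exists>p. z = poly p y \<and> p \<in> polys_over M \<and> Polynomial.degree p < n"
      using dg by blast
  qed
  then show ?thesis using dim by simp
qed

end

section \<open>Splitting fields\<close>

lemma subfld_base: "subfld base_field"
proof -
  have "inverse (to_ac x) \<in> base_field" for x :: 'a using to_ac_inverse[of x] by (metis rangeI)
  moreover have "- to_ac x \<in> base_field" for x :: 'a using to_ac_minus[of x] by (metis rangeI)
  moreover have "to_ac x + to_ac y \<in> base_field" "to_ac x * to_ac y \<in> base_field" for x y :: 'a
    using to_ac_add[of x y] to_ac_mult[of x y] by (metis rangeI)+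
  moreover have "0 \<in> range (to_ac :: 'a \<Rightarrow> _)" "1 \<in> range (to_ac :: 'a \<Rightarrow> _)"
    using to_ac_0 to_ac_1 by (metis rangeI)+
  ultimately show ?thesis by (auto simp: subfld_def)
qed

lemma map_to_ac_over: "map_poly to_ac p \<in> polys_over base_field"
  by (auto simp: polys_over_def coeff_map_poly)

lemma polys_over_baseE:
  assumes "p \<in> polys_over base_field" obtains q where "p = map_poly to_ac q"
proof
  show "p = map_poly to_ac (map_poly of_ac p)"
    using assms by (intro poly_eqI) (auto simp: polys_over_def coeff_map_poly to_ac_of_ac)
qed

lemma map_to_ac_mult: "map_poly to_ac (p * q) = map_poly to_ac p * map_poly to_ac q"
  by (rule poly_eqI) (simp add: coeff_map_poly coeff_mult to_ac_sum)

lemma map_to_ac_pderiv: "map_poly to_ac (pderiv p) = pderiv (map_poly to_ac p)"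
  by (rule poly_eqI) (simp add: coeff_map_poly coeff_pderiv flip: to_ac_of_nat)

lemma degree_map_to_ac: "Polynomial.degree (map_poly to_ac p) = Polynomial.degree p"
  by (intro degree_map_poly) auto

lemma map_to_ac_inj: "map_poly to_ac p = map_poly to_ac q \<longleftrightarrow> p = q"
  by (auto simp: poly_eq_iff coeff_map_poly)

lemma map_to_ac_eq_0: "map_poly to_ac p = 0 \<longleftrightarrow> p = 0"
  using map_to_ac_inj[of p 0] by simp

lemma algebraic_over_base: "algebraic_over base_field"
  unfolding algebraic_over_def
proof
  fix x :: "'a alg_closure"
  obtain p :: "'a poly" where "p \<noteq> 0" "poly (map_poly to_ac p) x = 0"
    by (rule alg_closure_algebraic)
  then show "\<exists>p\<in>polys_over base_field. p \<noteq> 0 \<and> poly p x = 0"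
    using map_to_ac_over map_to_ac_eq_0 by blast
qed

lemma roots_ac_mult: "roots_ac (p * q) = roots_ac p \<union> roots_ac q"
  by (auto simp: roots_ac_def map_to_ac_mult)

lemma finite_roots_ac: "p \<noteq> 0 \<Longrightarrow> finite (roots_ac p)"
  unfolding roots_ac_def by (intro poly_roots_finite) (simp add: map_to_ac_eq_0)

lemma splitting_field_fgen: "splitting_field p = fgen (base_field \<union> roots_ac p)"
  by (simp add: splitting_field_def generate_field_eq_fgen)

text \<open>This makes the joint Galois group that of a single polynomial, the product of the two
  quartics, so that only splitting fields have to be studied.\<close>

lemma compositum_splitting:
  "compositum (splitting_field p) (splitting_field q) = splitting_field (p * q)"
proof -
  have "fgen (fgen (base_field \<union> roots_ac p) \<union> fgen (base_field \<union> roots_ac q)) =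
      fgen (base_field \<union> roots_ac p \<union> (base_field \<union> roots_ac q))"
    using fgen_Un_fgen[of "base_field \<union> roots_ac p" "fgen (base_field \<union> roots_ac q)"]
      fgen_Un_fgen[of "base_field \<union> roots_ac q" "base_field \<union> roots_ac p"]
    by (simp only: Un_commute[of "base_field \<union> roots_ac p"])
  also have "base_field \<union> roots_ac p \<union> (base_field \<union> roots_ac q) = base_field \<union> roots_ac (p * q)"
    by (auto simp: roots_ac_mult)
  finally show ?thesis by (simp add: compositum_def generate_field_eq_fgen splitting_field_fgen)
qed

lemma subfld_splitting: "subfld (splitting_field p)"
  by (simp add: splitting_field_fgen subfld_fgen)

lemma base_le_splitting: "base_field \<subseteq> splitting_field p"
  and roots_le_splitting: "roots_ac p \<subseteq> splitting_field p"
  using fgen_incl[of "base_field \<union> roots_ac p"] by (auto simp: splitting_field_fgen)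

lemma splitting_least: "subfld K \<Longrightarrow> base_field \<subseteq> K \<Longrightarrow> roots_ac p \<subseteq> K \<Longrightarrow> splitting_field p \<subseteq> K"
  by (simp add: splitting_field_fgen fgen_least)

definition fixes_base :: "('a::field alg_closure \<Rightarrow> 'a alg_closure) \<Rightarrow> bool" where
  "fixes_base \<sigma> \<longleftrightarrow> (\<forall>c\<in>base_field. \<sigma> c = c)"

lemma emb_root:
  assumes "subfld K" "emb K \<sigma>" "base_field \<subseteq> K" "fixes_base \<sigma>" "r \<in> roots_ac p" "r \<in> K"
  shows "\<sigma> r \<in> roots_ac p"
proof -
  have "map_poly \<sigma> (map_poly to_ac p) = map_poly to_ac p"
    using assms(4) emb_simps(2)[OF assms(1,2)]
    by (intro map_poly_id_on[OF map_to_ac_over]) (auto simp: fixes_base_def)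
  moreover have "map_poly to_ac p \<in> polys_over K"
    using map_to_ac_over polys_over_mono[OF assms(3)] by blast
  ultimately show ?thesis
    using emb_poly[OF assms(1,2) _ assms(6), of "map_poly to_ac p"] assms(5) emb_simps(2)[OF assms(1,2)]
    by (simp add: roots_ac_def)
qed

text \<open>Reduces equality of two embeddings on a generated field to equality on the
  generators.\<close>

lemma emb_agree_subfld:
  assumes "subfld K" "emb K \<sigma>" "emb K \<tau>" shows "subfld {x \<in> K. \<sigma> x = \<tau> x}"
  using subfldD[OF assms(1)]
  by (auto simp: subfld_def emb_simps[OF assms(1,2)] emb_simps[OF assms(1,3)])

lemma emb_image_subfld:
  assumes K: "subfld K" "emb K \<sigma>" shows "subfld (\<sigma> ` K)"
  unfolding subfld_def
proof (intro conjI ballI)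
  note e = emb_simps[OF K] and k = subfldD[OF K(1)]
  show "0 \<in> \<sigma> ` K" "1 \<in> \<sigma> ` K" using e(1,2) k(1,2) by (metis imageI)+
  fix x assume "x \<in> \<sigma> ` K"
  then obtain a where a: "a \<in> K" "x = \<sigma> a" by auto
  show "- x \<in> \<sigma> ` K" "inverse x \<in> \<sigma> ` K" using a e(5,7) k(5,6) by (metis imageI)+
  fix y assume "y \<in> \<sigma> ` K"
  then obtain b where b: "b \<in> K" "y = \<sigma> b" by auto
  show "x + y \<in> \<sigma> ` K" "x * y \<in> \<sigma> ` K" using a b e(3,4) k(3,4) by (metis imageI)+
qed

text \<open>Normality of splitting fields. An injective map of the finite root set into itself is
  onto, so the image of the field contains all generators; conversely the elements sent back into
  the field form a subfield that contains them.\<close>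

lemma splitting_emb_bij:
  assumes p: "p \<noteq> 0" and \<sigma>: "emb (splitting_field p) \<sigma>" "fixes_base \<sigma>"
  shows "bij_betw \<sigma> (splitting_field p) (splitting_field p)"
proof -
  let ?K = "splitting_field p"
  note K = subfld_splitting[of p]
  have inj: "inj_on \<sigma> ?K" using emb_inj[OF K \<sigma>(1)] .
  have "\<sigma> ` roots_ac p \<subseteq> roots_ac p"
    using emb_root[OF K \<sigma>(1) base_le_splitting \<sigma>(2)] roots_le_splitting by blast
  then have R: "\<sigma> ` roots_ac p = roots_ac p"
    using inj_on_subset[OF inj roots_le_splitting] finite_roots_ac[OF p] endo_inj_surj by blast
  have "?K \<subseteq> \<sigma> ` ?K"
  proof (rule splitting_least[OF emb_image_subfld[OF K \<sigma>(1)]])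
    show "base_field \<subseteq> \<sigma> ` ?K"
    proof
      fix c :: "'a alg_closure" assume "c \<in> base_field"
      then have "c = \<sigma> c" "c \<in> ?K" using \<sigma>(2) base_le_splitting by (auto simp: fixes_base_def)
      then show "c \<in> \<sigma> ` ?K" by (metis imageI)
    qed
    show "roots_ac p \<subseteq> \<sigma> ` ?K" using R roots_le_splitting by blast
  qed
  moreover have "\<sigma> ` ?K \<subseteq> ?K"
  proof -
    have "subfld {x \<in> ?K. \<sigma> x \<in> ?K}"
      using subfldD[OF K] by (auto simp: subfld_def emb_simps[OF K \<sigma>(1)])
    then have "?K \<subseteq> {x \<in> ?K. \<sigma> x \<in> ?K}"
    proof (rule splitting_least)
      show "base_field \<subseteq> {x \<in> ?K. \<sigma> x \<in> ?K}"
        using \<sigma>(2) base_le_splitting[of p] by (auto simp: fixes_base_def)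
      show "roots_ac p \<subseteq> {x \<in> ?K. \<sigma> x \<in> ?K}" using R roots_le_splitting[of p] by blast
    qed
    then show ?thesis by auto
  qed
  ultimately show ?thesis using inj by (auto simp: bij_betw_def)
qed

section \<open>The Galois group of a splitting field\<close>

lemma galois_carrier:
  "\<sigma> \<in> carrier (galois_group K) \<longleftrightarrow> \<sigma> \<in> extensional K \<and> bij_betw \<sigma> K K \<and>
    (\<forall>x\<in>K. \<forall>y\<in>K. \<sigma> (x + y) = \<sigma> x + \<sigma> y \<and> \<sigma> (x * y) = \<sigma> x * \<sigma> y) \<and> fixes_base \<sigma>"
  by (auto simp: galois_group_def Bij_def fixes_base_def)

lemma galois_emb:
  assumes "\<sigma> \<in> carrier (galois_group K)" shows "emb K \<sigma>"
  unfolding emb_def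
proof
  have "1 \<in> base_field" using subfldD[OF subfld_base] by auto
  then show "\<sigma> 1 = 1" using assms unfolding galois_carrier fixes_base_def by blast
qed (use assms in \<open>auto simp: galois_carrier\<close>)

lemma restrict_galois:
  assumes "p \<noteq> 0" "emb (splitting_field p) \<sigma>" "fixes_base \<sigma>"
  shows "restrict \<sigma> (splitting_field p) \<in> carrier (galois_group (splitting_field p))"
proof -
  let ?K = "splitting_field p"
  have "bij_betw (restrict \<sigma> ?K) ?K ?K"
    using splitting_emb_bij[OF assms] by (metis bij_betw_restrict_eq)
  moreover have "fixes_base (restrict \<sigma> ?K)"
    using assms(3) base_le_splitting[of p] by (auto simp: fixes_base_def)
  ultimately show ?thesis
    using assms(2) subfldD[OF subfld_splitting[of p]] by (auto simp: galois_carrier emb_def)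
qed

lemma galois_mult:
  assumes "\<sigma> \<in> carrier (galois_group K)" "\<tau> \<in> carrier (galois_group K)"
  shows "\<sigma> \<otimes>\<^bsub>galois_group K\<^esub> \<tau> = compose K \<sigma> \<tau>"
  using assms by (simp add: galois_group_def BijGroup_def)

text \<open>The group axioms are inherited from \<open>BijGroup K\<close>; what needs care is that
  the restricted inverse function is again additive, multiplicative and trivial on the base.\<close>

lemma group_galois:
  assumes K: "subfld K" "base_field \<subseteq> K" shows "group (galois_group K)"
proof -
  interpret B: group "BijGroup K" by (rule group_BijGroup)
  have sub: "subgroup (carrier (galois_group K)) (BijGroup K)"
  proof (rule B.subgroupI)
    show le: "carrier (galois_group K) \<subseteq> carrier (BijGroup K)"
      by (auto simp: galois_carrier BijGroup_def Bij_def)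
    have "(\<lambda>x\<in>K. x) \<in> carrier (galois_group K)"
      using id_Bij[of K] subfldD[OF K(1)] K(2)
      by (auto simp: galois_carrier Bij_def fixes_base_def subset_iff)
    then show "carrier (galois_group K) \<noteq> {}" by blast
    fix \<sigma> assume s: "\<sigma> \<in> carrier (galois_group K)"
    have \<sigma>: "\<sigma> \<in> Bij K" using s le by (auto simp: BijGroup_def)
    have bij: "bij_betw \<sigma> K K" using s by (simp add: galois_carrier)
    let ?i = "\<lambda>x\<in>K. inv_into K \<sigma> x"
    have i: "?i x \<in> K" "\<sigma> (?i x) = x" if "x \<in> K" for x
      using that bij bij_betw_inv_into_right[OF bij] Bij_inv_into_mem[OF \<sigma>] by auto
    have eq: "?i y = x" if "x \<in> K" "\<sigma> x = y" for x y
      using that bij bij_betw_inv_into_left[OF bij] bij_betwE[OF bij] by auto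
    have "?i \<in> carrier (galois_group K)"
      unfolding galois_carrier
    proof (intro conjI ballI)
      show "?i \<in> extensional K" by simp
      show "bij_betw ?i K K" using restrict_inv_into_Bij[OF \<sigma>] by (simp add: Bij_def)
      show "fixes_base ?i" using s K(2) by (auto simp: fixes_base_def galois_carrier simp del: restrict_apply intro!: eq)
      fix x y assume "x \<in> K" "y \<in> K"
      then show "?i (x + y) = ?i x + ?i y" "?i (x * y) = ?i x * ?i y"
        using s i[of x] i[of y] subfldD[OF K(1)] by (auto simp: galois_carrier simp del: restrict_apply intro!: eq)
    qed
    moreover have "inv\<^bsub>BijGroup K\<^esub> \<sigma> = ?i"
      using \<sigma> restrict_inv_into_Bij[OF \<sigma>] Bij_compose_restrict_eq[OF \<sigma>]
      by (intro B.inv_equality) (simp_all add: BijGroup_def)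
    ultimately show "inv\<^bsub>BijGroup K\<^esub> \<sigma> \<in> carrier (galois_group K)" by simp
    fix \<tau> assume t: "\<tau> \<in> carrier (galois_group K)"
    then have \<tau>: "\<tau> \<in> Bij K" using le by (auto simp: BijGroup_def)
    have cl: "\<tau> x \<in> K" if "x \<in> K" for x using that t bij_betwE by (fastforce simp: galois_carrier)
    have "compose K \<sigma> \<tau> \<in> carrier (galois_group K)"
      using compose_Bij[OF \<sigma> \<tau>] s t cl subfldD[OF K(1)] K(2)
      by (auto simp: galois_carrier Bij_def fixes_base_def compose_def subset_iff)
    then show "\<sigma> \<otimes>\<^bsub>BijGroup K\<^esub> \<tau> \<in> carrier (galois_group K)"
      using \<sigma> \<tau> by (simp add: BijGroup_def)
  qed
  have "BijGroup K\<lparr>carrier := carrier (galois_group K)\<rparr> = galois_group K"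
    by (simp add: galois_group_def)
  then show ?thesis using subgroup.subgroup_is_group[OF sub group_BijGroup] by simp
qed

lemma galois_ext:
  assumes "\<sigma> \<in> carrier (galois_group (splitting_field p))" "\<tau> \<in> carrier (galois_group (splitting_field p))"
    and "\<And>r. r \<in> roots_ac p \<Longrightarrow> \<sigma> r = \<tau> r"
  shows "\<sigma> = \<tau>"
proof -
  let ?K = "splitting_field p"
  have "?K \<subseteq> {x \<in> ?K. \<sigma> x = \<tau> x}"
    using assms base_le_splitting[of p] roots_le_splitting[of p]
    by (intro splitting_least emb_agree_subfld subfld_splitting galois_emb)
      (auto simp: galois_carrier fixes_base_def)
  then show ?thesis using assms by (intro extensionalityI[of \<sigma> ?K \<tau>]) (auto simp: galois_carrier)
qed

lemma galois_root:
  assumes "\<sigma> \<in> carrier (galois_group (splitting_field q))" "roots_ac p \<subseteq> splitting_field q" "r \<in> roots_ac p"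
  shows "\<sigma> r \<in> roots_ac p"
  using assms emb_root[OF subfld_splitting galois_emb[OF assms(1)] base_le_splitting]
  by (auto simp: galois_carrier)

lemma finite_galois:
  assumes "p \<noteq> 0" shows "finite (carrier (galois_group (splitting_field p)))"
proof (rule inj_on_finite)
  let ?G = "carrier (galois_group (splitting_field p))"
  show "inj_on (\<lambda>\<sigma>. restrict \<sigma> (roots_ac p)) ?G"
  proof (rule inj_onI)
    fix \<sigma> \<tau> assume s: "\<sigma> \<in> ?G" "\<tau> \<in> ?G" "restrict \<sigma> (roots_ac p) = restrict \<tau> (roots_ac p)"
    show "\<sigma> = \<tau>"
    proof (rule galois_ext[OF s(1,2)])
      fix r assume "r \<in> roots_ac p"
      then show "\<sigma> r = \<tau> r" using fun_cong[OF s(3), of r] by simp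
    qed
  qed
  show "(\<lambda>\<sigma>. restrict \<sigma> (roots_ac p)) ` ?G \<subseteq> roots_ac p \<rightarrow>\<^sub>E roots_ac p"
    using galois_root[OF _ roots_le_splitting] by auto
  show "finite (roots_ac p \<rightarrow>\<^sub>E roots_ac p)"
    using finite_roots_ac[OF assms] by (intro finite_PiE)
qed

text \<open>Separability is asked of each root, not absence of repeated factors. It therefore passes
  to the product of the two quartics even when these share roots or coincide.\<close>

definition separable_poly :: "'a::field poly \<Rightarrow> bool" where
  "separable_poly p \<longleftrightarrow> p \<noteq> 0 \<and> (\<forall>r\<in>roots_ac p. separable_over base_field r)"

lemma separable_poly_mult: "separable_poly p \<Longrightarrow> separable_poly q \<Longrightarrow> separable_poly (p * q)"
  by (auto simp: separable_poly_def roots_ac_mult)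

lemma splitting_field_mult: "fgen (splitting_field p \<union> roots_ac q) = splitting_field (p * q)"
  by (simp add: splitting_field_fgen fgen_Un_fgen roots_ac_mult Un_assoc)

lemma splitting_mono_mult: "splitting_field p \<subseteq> splitting_field (p * q)"
  "splitting_field q \<subseteq> splitting_field (p * q)"
  unfolding splitting_field_fgen roots_ac_mult by (intro fgen_mono; blast)+

text \<open>The direction of the Galois correspondence on which the rest relies. With p = 1 it makes
  the base field the fixed field of the whole group; with p one of the quartics it recovers that
  quartic's splitting field inside the compositum.\<close>

lemma galois_fixed_by:
  assumes p: "p \<noteq> 0" and q: "separable_poly q" and x: "x \<in> splitting_field (p * q)"
    "\<And>\<sigma>. \<sigma> \<in> carrier (galois_group (splitting_field (p * q))) \<Longrightarrow>
      (\<And>r. r \<in> roots_ac p \<Longrightarrow> \<sigma> r = r) \<Longrightarrow> \<sigma> x = x"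
  shows "x \<in> splitting_field p"
proof (rule fixed_by_embeddings[OF finite_roots_ac subfld_splitting])
  show "q \<noteq> 0" using q by (simp add: separable_poly_def)
  then have pq: "p * q \<noteq> 0" using p by simp
  show "algebraic_over (splitting_field p)"
    using algebraic_over_mono[OF algebraic_over_base base_le_splitting] .
  show "separable_over (splitting_field p) s" if "s \<in> roots_ac q" for s
    using q that separable_over_mono[OF _ base_le_splitting] by (auto simp: separable_poly_def)
  show "x \<in> fgen (splitting_field p \<union> roots_ac q)" using x(1) by (simp add: splitting_field_mult)
  fix \<tau> assume "emb (fgen (splitting_field p \<union> roots_ac q)) \<tau>" "\<forall>c\<in>splitting_field p. \<tau> c = c"
  then have \<tau>: "emb (splitting_field (p * q)) \<tau>" "\<forall>c\<in>splitting_field p. \<tau> c = c"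
    by (simp_all add: splitting_field_mult)
  then have "fixes_base \<tau>" using base_le_splitting[of p] by (auto simp: fixes_base_def)
  note r = restrict_galois[OF pq \<tau>(1) this]
  have "restrict \<tau> (splitting_field (p * q)) x = x"
    using \<tau>(2) roots_le_splitting[of p] splitting_mono_mult(1)[of p q] by (intro x(2)[OF r]) auto
  then show "\<tau> x = x" using x(1) by simp
qed

lemma splitting_field_1: "splitting_field (1 :: 'a::field poly) = base_field"
proof -
  have "roots_ac (1 :: 'a poly) = {}" by (simp add: roots_ac_def map_poly_1)
  then show ?thesis unfolding splitting_field_fgen by (simp add: fgen_eq[OF subfld_base])
qed

lemma aut_group_splitting:
  assumes q: "separable_poly q" and inf: "infinite (UNIV :: 'a::field set)"
  shows "aut_group (splitting_field q) base_field (galois_group (splitting_field (q :: 'a poly)))"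
proof (rule aut_group.intro)
  let ?K = "splitting_field q" and ?G = "galois_group (splitting_field q)"
  show "subfld ?K" "base_field \<subseteq> ?K" by (rule subfld_splitting base_le_splitting)+
  then show "group ?G" by (rule group_galois)
  show "subfld (base_field :: 'a alg_closure set)" by (rule subfld_base)
  show "infinite (base_field :: 'a alg_closure set)" using inf inj_to_ac finite_imageD by blast
  show "finite (carrier ?G)" using q by (intro finite_galois) (simp add: separable_poly_def)
next
  let ?K = "splitting_field q" and ?G = "galois_group (splitting_field q)"
  fix \<sigma> assume s: "\<sigma> \<in> carrier ?G"
  show "emb ?K \<sigma>" by (rule galois_emb[OF s])
  show "\<sigma> c = c" if "c \<in> base_field" for c using s that by (auto simp: galois_carrier fixes_base_def)
next
  let ?K = "splitting_field q" and ?G = "galois_group (splitting_field q)"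
  fix \<sigma> x assume "\<sigma> \<in> carrier ?G" "x \<in> ?K"
  then show "\<sigma> x \<in> ?K" using bij_betwE by (fastforce simp: galois_carrier)
next
  let ?K = "splitting_field q" and ?G = "galois_group (splitting_field q)"
  fix \<sigma> \<tau> x assume "\<sigma> \<in> carrier ?G" "\<tau> \<in> carrier ?G" "x \<in> ?K"
  then show "(\<sigma> \<otimes>\<^bsub>?G\<^esub> \<tau>) x = \<sigma> (\<tau> x)" by (simp add: galois_mult compose_def)
next
  let ?K = "splitting_field q" and ?G = "galois_group (splitting_field q)"
  fix \<sigma> \<tau> assume "\<sigma> \<in> carrier ?G" "\<tau> \<in> carrier ?G" "\<And>x. x \<in> ?K \<Longrightarrow> \<sigma> x = \<tau> x"
  then show "\<sigma> = \<tau>" using roots_le_splitting[of q] by (intro galois_ext) auto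
next
  fix x assume "x \<in> splitting_field q"
    "\<And>\<sigma>. \<sigma> \<in> carrier (galois_group (splitting_field q)) \<Longrightarrow> \<sigma> x = x"
  then show "x \<in> base_field" using galois_fixed_by[of 1 q x] q by (simp add: splitting_field_1)
qed

lemma galois_restrict:
  assumes "p \<noteq> 0" "K = splitting_field q" "splitting_field p \<subseteq> K" "\<sigma> \<in> carrier (galois_group K)"
  shows "restrict \<sigma> (splitting_field p) \<in> carrier (galois_group (splitting_field p))"
  using assms galois_emb[OF assms(4)] emb_mono[of K \<sigma> "splitting_field p"]
  by (intro restrict_galois) (auto simp: galois_carrier)

text \<open>Since K lies between the base and the splitting field of q, adjoining the roots of q to
  K gives that whole splitting field. Normality then turns the extended embedding into an
  automorphism.\<close>

lemma galois_extend_emb: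
  fixes K :: "'a::field alg_closure set"
  assumes q: "q \<noteq> 0" and K: "subfld K" "base_field \<subseteq> K" "K \<subseteq> splitting_field q"
    and \<tau>: "emb K \<tau>" "fixes_base \<tau>"
  obtains \<sigma> where "\<sigma> \<in> carrier (galois_group (splitting_field q))" "\<And>x. x \<in> K \<Longrightarrow> \<sigma> x = \<tau> x"
proof -
  have eq: "fgen (K \<union> roots_ac q) = splitting_field q"
  proof
    show "fgen (K \<union> roots_ac q) \<subseteq> splitting_field q"
      using K(3) roots_le_splitting[of q] by (intro fgen_least subfld_splitting) auto
    show "splitting_field q \<subseteq> fgen (K \<union> roots_ac q)"
      using K(2) unfolding splitting_field_fgen by (intro fgen_mono) blast
  qed
  obtain \<tau>' where \<tau>': "emb (splitting_field q) \<tau>'" "\<forall>c\<in>K. \<tau>' c = \<tau> c"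
    using emb_extend_finite[OF finite_roots_ac[OF q] K(1) algebraic_over_mono[OF algebraic_over_base K(2)] \<tau>(1)]
    unfolding eq by blast
  have "fixes_base \<tau>'" using \<tau>' \<tau> K(2) by (auto simp: fixes_base_def subset_iff)
  from restrict_galois[OF q \<tau>'(1) this] show ?thesis
    using \<tau>'(2) K(3) by (intro that[of "restrict \<tau>' (splitting_field q)"]) auto
qed

section \<open>Irreducible polynomials: simple roots and transitivity\<close>

lemma min_poly_irreducible:
  assumes p: "Factorial_Ring.irreducible p" and \<alpha>: "\<alpha> \<in> roots_ac p"
  shows "min_poly base_field \<alpha> (map_poly to_ac p)"
proof -
  obtain m where m: "min_poly base_field \<alpha> m" using min_poly_exists[OF algebraic_over_base] by blast
  have pa: "poly (map_poly to_ac p) \<alpha> = 0" using \<alpha> by (simp add: roots_ac_def)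
  obtain r where r: "r \<in> polys_over base_field" "map_poly to_ac p = m * r"
    using min_poly_dvd[OF subfld_base m map_to_ac_over pa] .
  obtain m0 where m0: "m = map_poly to_ac m0" using m polys_over_baseE by (auto simp: min_poly_def)
  obtain r0 where r0: "r = map_poly to_ac r0" using r polys_over_baseE by blast
  \<comment> \<open>The factorization descends to the coefficient field because m and r have
    coefficients in the image of \<open>to_ac\<close>; irreducibility then leaves only a constant
    cofactor.\<close>
  have "p = m0 * r0" using r(2) unfolding m0 r0 map_to_ac_mult[symmetric] map_to_ac_inj .
  then have "is_unit m0 \<or> is_unit r0" using p Factorial_Ring.irreducibleD by blast
  moreover have "\<not> is_unit m0"
    using min_poly_root[OF m] is_unit_iff_degree[of m0] degree_map_to_ac[of m0] by (cases "m0 = 0") (auto simp: m0)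
  ultimately have "Polynomial.degree r0 = 0" using is_unit_iff_degree[of r0] by fastforce
  moreover have "p \<noteq> 0" using p by auto
  ultimately have "Polynomial.degree p = Polynomial.degree m"
    using \<open>p = m0 * r0\<close> degree_mult_eq[of m0 r0] degree_map_to_ac[of m0] by (auto simp: m0)
  then show ?thesis
    using m pa map_to_ac_over[of p] \<open>p \<noteq> 0\<close> degree_map_to_ac[of p] map_to_ac_eq_0[of p] by (auto simp: min_poly_def)
qed

text \<open>Splitting off X - a gives p'(b) = q(b) + (b - a) q'(b). At b = a this keeps a out of the
  roots of q, and at a root of q it shows that simplicity is inherited.\<close>

lemma card_simple_roots:
  fixes p :: "'a::alg_closed_field poly"
  assumes "p \<noteq> 0" "\<And>a. poly p a = 0 \<Longrightarrow> poly (pderiv p) a \<noteq> 0"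
  shows "card {a. poly p a = 0} = Polynomial.degree p"
  using assms
proof (induction "Polynomial.degree p" arbitrary: p)
  case 0
  then obtain c where "p = [:c:]" by (metis degree_eq_zeroE)
  then show ?case using 0 by auto
next
  case (Suc n)
  then obtain a where a: "poly p a = 0" using alg_closed_imp_poly_has_root[of p] by auto
  then obtain q where q: "p = [:- a, 1:] * q" by (metis poly_eq_0_iff_dvd dvdE)
  then have q0: "q \<noteq> 0" using Suc by auto
  then have dq: "Polynomial.degree q = n" using Suc(2) q by (simp add: degree_mult_eq del: mult_pCons_left)
  have d: "poly (pderiv p) b = poly q b + (b - a) * poly (pderiv q) b" for b
    by (simp add: q pderiv_mult pderiv_pCons del: mult_pCons_left)
  have qa: "poly q a \<noteq> 0" using Suc.prems(2)[OF a] d by auto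
  have "poly (pderiv q) b \<noteq> 0" if "poly q b = 0" for b
    using Suc.prems(2)[of b] that d[of b] by (auto simp: q)
  then have "card {a. poly q a = 0} = n" using Suc(1) dq q0 by blast
  moreover have "{b. poly p b = 0} = insert a {b. poly q b = 0}" by (auto simp: q)
  ultimately show ?case using qa poly_roots_finite[OF q0] dq Suc(2) by simp
qed

text \<open>A multiple root would also be a root of the nonzero derivative, whose degree is below
  that of p, the minimal polynomial of this root.\<close>

lemma card_roots_irreducible:
  assumes p: "Factorial_Ring.irreducible p" "pderiv p \<noteq> 0"
  shows "card (roots_ac p) = Polynomial.degree p"
proof -
  have p0: "p \<noteq> 0" using p by auto
  have "poly (pderiv (map_poly to_ac p)) a \<noteq> 0" if a: "poly (map_poly to_ac p) a = 0" for a
  proof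
    assume "poly (pderiv (map_poly to_ac p)) a = 0"
    then have "poly (map_poly to_ac (pderiv p)) a = 0" by (simp add: map_to_ac_pderiv)
    moreover have "min_poly base_field a (map_poly to_ac p)"
      using min_poly_irreducible[OF p(1)] a by (simp add: roots_ac_def)
    ultimately have "Polynomial.degree p \<le> Polynomial.degree (pderiv p)"
      using map_to_ac_over[of "pderiv p"] map_to_ac_eq_0[of "pderiv p"] p(2)
      by (auto simp: min_poly_def degree_map_to_ac)
    moreover have "Polynomial.degree p > 0" 
      using p(2) by (metis degree_eq_zeroE gr0I pderiv_singleton)
    moreover have "Polynomial.degree (pderiv p) \<le> Polynomial.degree p - 1"
      by (rule degree_le) (auto simp: coeff_pderiv intro!: coeff_eq_0)
    ultimately show False by linarith
  qed
  then show ?thesis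
    using card_simple_roots[of "map_poly to_ac p"] p0 map_to_ac_eq_0[of p]
    by (simp add: roots_ac_def degree_map_to_ac)
qed

lemma separable_poly_irreducible:
  assumes p: "Factorial_Ring.irreducible p" "pderiv p \<noteq> 0" shows "separable_poly p"
  unfolding separable_poly_def separable_over_def
proof (intro conjI ballI bexI)
  show "p \<noteq> 0" using p by auto
  then show "map_poly to_ac p \<noteq> 0" by (simp add: map_to_ac_eq_0)
  show "card {z. poly (map_poly to_ac p) z = 0} = Polynomial.degree (map_poly to_ac p)"
    using card_roots_irreducible[OF p] by (simp add: degree_map_to_ac roots_ac_def)
qed (auto simp: roots_ac_def map_to_ac_over)

text \<open>Both roots have p as minimal polynomial, so an embedding of M(\<alpha>) sends \<alpha>
  to \<beta>; it extends to an automorphism of any splitting field that contains the roots.\<close>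

lemma galois_transitive:
  assumes p: "Factorial_Ring.irreducible p" and q: "q \<noteq> 0" "roots_ac p \<subseteq> splitting_field q"
    and ab: "\<alpha> \<in> roots_ac p" "\<beta> \<in> roots_ac p"
  obtains \<sigma> where "\<sigma> \<in> carrier (galois_group (splitting_field q))" "\<sigma> \<alpha> = \<beta>"
proof -
  have id: "emb base_field id" by (simp add: emb_def)
  have "poly (map_poly id (map_poly to_ac p)) \<beta> = 0" using ab by (simp add: roots_ac_def map_poly_id)
  then obtain \<tau> where \<tau>: "emb (adj base_field \<alpha>) \<tau>" "\<And>c. c \<in> base_field \<Longrightarrow> \<tau> c = id c"
    "\<And>q. q \<in> polys_over base_field \<Longrightarrow> \<tau> (poly q \<alpha>) = poly (map_poly id q) \<beta>"
    using emb_extend_adj[OF subfld_base id min_poly_irreducible[OF p ab(1)]] by blast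
  have "[:0, 1:] \<in> polys_over base_field"
    using subfldD[OF subfld_base] by (auto simp: polys_over_closed[OF subfld_base])
  then have "\<tau> \<alpha> = \<beta>" using \<tau>(3)[of "[:0,1:]"] by (simp add: map_poly_id)
  have adj: "adj base_field \<alpha> = fgen (insert \<alpha> base_field)"
    by (rule adj_eq_fgen[OF subfld_base algebraic_over_base])
  have "subfld (adj base_field \<alpha>)" by (simp add: adj subfld_fgen)
  moreover have "base_field \<subseteq> adj base_field \<alpha>" by (rule adj_ring(1)[OF subfld_base])
  moreover have "adj base_field \<alpha> \<subseteq> splitting_field q"
    unfolding adj using q ab base_le_splitting[of q] by (intro fgen_least subfld_splitting) auto
  moreover have "fixes_base \<tau>" using \<tau>(2) by (simp add: fixes_base_def)
  ultimately obtain \<sigma> where "\<sigma> \<in> carrier (galois_group (splitting_field q))"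
    "\<And>x. x \<in> adj base_field \<alpha> \<Longrightarrow> \<sigma> x = \<tau> x"
    using galois_extend_emb[OF q(1) _ _ _ \<tau>(1)] by metis
  then show ?thesis using that \<open>\<tau> \<alpha> = \<beta>\<close> adj_ring(2)[OF subfld_base] by metis
qed

lemma quartic_simps:
  "Polynomial.degree (quartic u) = 4" "quartic u \<noteq> 0"
  by (auto simp: quartic_def split: prod.splits)

text \<open>The hypothesis on the characteristic concerns k, while the quartics live over M. A
  homomorphism of fields reflects 0 and carries multiples of 1 to the same multiples of 1.\<close>

lemma CHAR_ring_hom:
  fixes \<iota> :: "'k::field \<Rightarrow> 'm::field"
  assumes "\<iota> \<in> Ring.ring_hom ring_of_type_algebra ring_of_type_algebra"
  shows "CHAR('k) = CHAR('m)"
proof -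
  have h: "\<iota> (x + y) = \<iota> x + \<iota> y" "\<iota> (x * y) = \<iota> x * \<iota> y" "\<iota> 1 = 1" for x y
    using assms Ring.ring_hom_add[OF assms, of x y] Ring.ring_hom_mult[OF assms, of x y]
      Ring.ring_hom_one[OF assms] by simp_all
  have "\<iota> 0 + \<iota> 0 = \<iota> 0" using h(1)[of 0 0] by simp
  then have h0: "\<iota> 0 = 0" by (metis add_cancel_right_right)
  have n: "\<iota> (of_nat n) = of_nat n" for n by (induction n) (auto simp: h h0)
  have z: "\<iota> x = 0 \<longleftrightarrow> x = 0" for x using h(2)[of x "inverse x"] h(3) h0 by (cases "x = 0") auto
  show ?thesis
    by (rule CHAR_eqI[symmetric]) (metis n z of_nat_CHAR of_nat_eq_0_iff_char_dvd)+
qed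

lemma pderiv_quartic:
  assumes "CHAR('m::field) \<noteq> 2" shows "pderiv (quartic (u :: 'm \<times> 'm)) \<noteq> 0"
proof -
  obtain a b where u: "u = (a, b)" by (cases u)
  have "Polynomial.coeff (pderiv (quartic u)) 3 = 4"
    by (simp add: u quartic_def coeff_pderiv eval_nat_numeral)
  moreover have "(4 :: 'm) \<noteq> 0"
  proof
    assume "(4 :: 'm) = 0"
    then have "(2::'m) * 2 = 0" by simp
    then have "(2::'m) = 0" by (metis mult_eq_0_iff)
    then have "of_nat 2 = (0::'m)" by simp
    then have "CHAR('m) dvd 2" by (simp only: of_nat_eq_0_iff_char_dvd)
    then have "CHAR('m) = 1 \<or> CHAR('m) = 2" by (metis two_is_prime_nat prime_nat_iff)
    then show False using assms by simp
  qed
  ultimately show ?thesis by auto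
qed

section \<open>Permutations of four points\<close>

text \<open>Quadruples make statements about permutations of four points decidable by rewriting.\<close>

datatype pt = P1 | P2 | P3 | P4
datatype quad = Q pt pt pt pt

fun app :: "quad \<Rightarrow> pt \<Rightarrow> pt" where
  "app (Q a b c d) P1 = a" | "app (Q a b c d) P2 = b"
| "app (Q a b c d) P3 = c" | "app (Q a b c d) P4 = d"

fun mul :: "quad \<Rightarrow> quad \<Rightarrow> quad" where
  "mul p (Q a b c d) = Q (app p a) (app p b) (app p c) (app p d)"

text \<open>Membership as a chain of conditionals, which rewriting collapses to a truth value on
  literal lists.\<close>

fun memb :: "quad \<Rightarrow> quad list \<Rightarrow> bool" where
  "memb x [] \<longleftrightarrow> False"
| "memb x (y # ys) \<longleftrightarrow> (if x = y then True else memb x ys)"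

abbreviation qone :: quad where "qone \<equiv> Q P1 P2 P3 P4"

text \<open>Position of x among the four images; the last branch carries no test, since for a
  permutation only P4 remains.\<close>

definition idx :: "quad \<Rightarrow> pt \<Rightarrow> pt" where
  "idx p x = (if app p P1 = x then P1 else if app p P2 = x then P2 else if app p P3 = x then P3 else P4)"

definition qinv :: "quad \<Rightarrow> quad" where
  "qinv p = Q (idx p P1) (idx p P2) (idx p P3) (idx p P4)"

definition perms :: "quad list" where
  "perms =
    [Q P1 P2 P3 P4, Q P1 P2 P4 P3, Q P1 P3 P2 P4, Q P1 P3 P4 P2, Q P1 P4 P2 P3, Q P1 P4 P3 P2,
     Q P2 P1 P3 P4, Q P2 P1 P4 P3, Q P2 P3 P1 P4, Q P2 P3 P4 P1, Q P2 P4 P1 P3, Q P2 P4 P3 P1,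
     Q P3 P1 P2 P4, Q P3 P1 P4 P2, Q P3 P2 P1 P4, Q P3 P2 P4 P1, Q P3 P4 P1 P2, Q P3 P4 P2 P1,
     Q P4 P1 P2 P3, Q P4 P1 P3 P2, Q P4 P2 P1 P3, Q P4 P2 P3 P1, Q P4 P3 P1 P2, Q P4 P3 P2 P1]"

definition alts :: "quad list" where
  "alts =
    [Q P1 P2 P3 P4, Q P1 P3 P4 P2, Q P1 P4 P2 P3, Q P2 P1 P4 P3, Q P2 P3 P1 P4, Q P2 P4 P3 P1,
     Q P3 P1 P2 P4, Q P3 P2 P4 P1, Q P3 P4 P1 P2, Q P4 P1 P3 P2, Q P4 P2 P1 P3, Q P4 P3 P2 P1]"

definition qeven :: "quad \<Rightarrow> bool" where "qeven p \<longleftrightarrow> p \<in> set alts"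

definition klein :: "quad list" where
  "klein = [Q P1 P2 P3 P4, Q P2 P1 P4 P3, Q P3 P4 P1 P2, Q P4 P3 P2 P1]"

lemma memb_iff: "memb x ys \<longleftrightarrow> x \<in> set ys"
  by (induction ys) auto

lemma pt_UNIV: "UNIV = {P1, P2, P3, P4}"
  using pt.exhaust by auto

lemma pt_all: "(\<forall>x. P x) \<longleftrightarrow> P P1 \<and> P P2 \<and> P P3 \<and> P P4"
  by (metis pt.exhaust)

lemma quad_eqI: "(\<And>x. app p x = app q x) \<Longrightarrow> p = q"
proof -
  assume "\<And>x. app p x = app q x"
  from this[of P1] this[of P2] this[of P3] this[of P4] show ?thesis by (cases p; cases q) simp
qed

lemma app_mul: "app (mul p q) x = app p (app q x)"
  by (cases q; cases x) simp_all

lemma app_one: "app qone x = x"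
  by (cases x) simp_all

lemma mul_assoc: "mul (mul p q) r = mul p (mul q r)"
  by (rule quad_eqI) (simp add: app_mul)

lemma mul_one: "mul p qone = p" "mul qone p = p"
proof -
  show "mul p qone = p" by (rule quad_eqI) (simp only: app_mul app_one)
  show "mul qone p = p" by (rule quad_eqI) (simp only: app_mul app_one)
qed

lemma perms_iff: "p \<in> set perms \<longleftrightarrow> inj (app p)"
proof -
  obtain a b c d where p: "p = Q a b c d" by (cases p)
  have "distinct [a, b, c, d] \<Longrightarrow> Q a b c d \<in> set perms"
    by (cases a; cases b; simp; cases c; simp; cases d; simp add: perms_def)
  moreover have "\<forall>p\<in>set perms. case p of Q a b c d \<Rightarrow> distinct [a, b, c, d]"
    unfolding perms_def by simp
  ultimately have "p \<in> set perms \<longleftrightarrow> distinct [a, b, c, d]" by (auto simp: p)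
  also have "\<dots> \<longleftrightarrow> inj (app p)"
    by (auto simp: inj_def pt_all p)
  finally show ?thesis .
qed

lemma perms_mul: "p \<in> set perms \<Longrightarrow> q \<in> set perms \<Longrightarrow> mul p q \<in> set perms"
proof -
  have "app (mul p q) = app p \<circ> app q" by (rule ext) (simp only: app_mul o_apply)
  then show "p \<in> set perms \<Longrightarrow> q \<in> set perms \<Longrightarrow> mul p q \<in> set perms"
    unfolding perms_iff by (simp only: inj_compose)
qed

lemma perms_one: "qone \<in> set perms"
  by (simp add: perms_def)

lemma perms_inv:
  "p \<in> set perms \<Longrightarrow> qinv p \<in> set perms \<and> mul p (qinv p) = qone \<and> mul (qinv p) p = qone"
proof -
  have "\<forall>p\<in>set perms. qinv p \<in> set perms \<and> mul p (qinv p) = qone \<and> mul (qinv p) p = qone"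
    by code_simp
  then show "p \<in> set perms \<Longrightarrow> ?thesis" by blast
qed

lemma mul_cancel:
  assumes "p \<in> set perms"
  shows "mul p (mul (qinv p) q) = q" "mul (qinv p) (mul p q) = q"
    "mul p q = mul p r \<longleftrightarrow> q = r" "mul (mul q p) (qinv p) = q" "mul (mul q (qinv p)) p = q"
    "mul q p = mul r p \<longleftrightarrow> q = r"
proof -
  note i = perms_inv[OF assms]
  show 1: "\<And>q. mul p (mul (qinv p) q) = q" "\<And>q. mul (qinv p) (mul p q) = q"
    using i by (simp_all only: mul_assoc[symmetric] mul_one)
  show 2: "\<And>q. mul (mul q p) (qinv p) = q" "\<And>q. mul (mul q (qinv p)) p = q"
    using i by (simp_all only: mul_assoc mul_one)
  show "mul p q = mul p r \<longleftrightarrow> q = r" using 1(2) by metis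
  show "mul q p = mul r p \<longleftrightarrow> q = r" using 2(1) by metis
qed

text \<open>Parity is membership in the list of A4, so multiplicativity is checked on all 576
  products.\<close>

lemma qeven_mul: "p \<in> set perms \<Longrightarrow> q \<in> set perms \<Longrightarrow> qeven (mul p q) \<longleftrightarrow> (qeven p \<longleftrightarrow> qeven q)"
proof -
  have "\<forall>p\<in>set perms. \<forall>q\<in>set perms. qeven (mul p q) \<longleftrightarrow> (qeven p \<longleftrightarrow> qeven q)"
    by code_simp
  then show "p \<in> set perms \<Longrightarrow> q \<in> set perms \<Longrightarrow> ?thesis" by blast
qed

section \<open>Subgroups of S4 by propositional reasoning\<close>

definition qsubgroup :: "quad set \<Rightarrow> bool" where
  "qsubgroup G \<longleftrightarrow> G \<subseteq> set perms \<and> qone \<in> G \<and> (\<forall>p\<in>G. \<forall>q\<in>G. mul p q \<in> G) \<and> (\<forall>p\<in>G. qinv p \<in> G)"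

lemma qsubgroup_mul_table:
  assumes "qsubgroup G"
  shows "list_all (\<lambda>p. list_all (\<lambda>q. p \<in> G \<longrightarrow> q \<in> G \<longrightarrow> mul p q \<in> G) perms) perms"
  using assms by (auto simp: qsubgroup_def list_all_iff)

text \<open>The dihedral group that contains the transpositions \<open>(1 2)\<close> and \<open>(3 4)\<close>, and its cyclic subgroup
  generated by \<open>(1 3 2 4)\<close>.\<close>

definition dih1 :: "quad list" where "dih1 = klein @ [Q P2 P1 P3 P4, Q P1 P2 P4 P3, Q P3 P4 P2 P1, Q P4 P3 P1 P2]"
definition cyc1 :: "quad list" where "cyc1 = [Q P1 P2 P3 P4, Q P3 P4 P2 P1, Q P2 P1 P4 P3, Q P4 P3 P1 P2]"

text \<open>For G inside S4 this is equality with \<open>set H\<close>, written as 24 separate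
  equivalences so that a propositional solver sees only atoms of the form x \<in> G.\<close>

definition pattern :: "quad set \<Rightarrow> quad list \<Rightarrow> bool" where
  "pattern G H \<longleftrightarrow> list_all (\<lambda>x. x \<in> G \<longleftrightarrow> memb x H) perms"

definition qconj :: "quad \<Rightarrow> quad \<Rightarrow> quad" where "qconj c p = mul (mul c p) (qinv c)"

lemma pattern_eq: "G \<subseteq> set perms \<Longrightarrow> set H \<subseteq> set perms \<Longrightarrow> pattern G H \<longleftrightarrow> G = set H"
  by (auto simp: pattern_def list_all_iff memb_iff)

lemmas quad_eval = list_all_Nil_iff list_all_Cons_iff list_ex_Nil_iff list_ex_Cons_iff mul.simps
  app.simps memb.simps pt.distinct quad.inject simp_thms if_True if_False

text \<open>Membership in \<open>G\<close> gives \<open>24\<close> propositional atoms. The multiplication table turns closure of \<open>G\<close> into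
  clauses over them, and the classification becomes a propositional tautology.\<close>

lemma transitive_patterns:
  assumes "qsubgroup G" "\<And>x. \<exists>p\<in>G. app p P1 = x"
  shows "list_ex (pattern G) [perms, alts, klein,
    dih1, map (qconj (Q P1 P3 P2 P4)) dih1, map (qconj (Q P1 P4 P3 P2)) dih1,
    cyc1, map (qconj (Q P1 P3 P2 P4)) cyc1, map (qconj (Q P1 P4 P3 P2)) cyc1]"
proof -
  have tr: "list_ex (\<lambda>p. p \<in> G \<and> app p P1 = x) perms" for x
    using assms by (force simp: list_ex_iff qsubgroup_def)
  have one: "qone \<in> G" using assms by (simp add: qsubgroup_def)
  note t = qsubgroup_mul_table[OF assms(1)] tr[of P2] tr[of P3] tr[of P4]
  note t' = t[unfolded perms_def, simplified]
  show ?thesis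
    unfolding list_ex_Nil_iff list_ex_Cons_iff pattern_def alts_def klein_def dih1_def cyc1_def perms_def qconj_def qinv_def idx_def list.map append.simps
    using t' one
    by (simp (no_asm_use) only: quad_eval) sat
qed

text \<open>Invariance under A4 alone already forces normality in S4, so one statement serves both
  possible first projections.\<close>

lemma normal_patterns:
  assumes "qsubgroup G" "\<And>c p. c \<in> set alts \<Longrightarrow> p \<in> G \<Longrightarrow> qconj c p \<in> G"
  shows "list_ex (pattern G) [[qone], klein, alts, perms]"
proof -
  have "list_all (\<lambda>c. list_all (\<lambda>p. p \<in> G \<longrightarrow> qconj c p \<in> G) perms) alts"
    using assms(2) by (auto simp: list_all_iff)
  note t = qsubgroup_mul_table[OF assms(1)] this
  note t' = t[unfolded perms_def alts_def qconj_def qinv_def idx_def, simplified]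
  have one: "qone \<in> G" using assms by (simp add: qsubgroup_def)
  show ?thesis
    unfolding list_ex_Nil_iff list_ex_Cons_iff pattern_def alts_def klein_def perms_def
    using t' one
    by (simp (no_asm_use) only: quad_eval) sat
qed

text \<open>The generators are (1 2 3) and (1 2)(3 4) for A4, these together with (1 2) for S4, and
  (1 2 3 4) with (1 2) for S4. G will be the set of s with (s, s) \<in> \<Gamma>, so that a few
  diagonal pairs produce the whole diagonal.\<close>

lemma generating_patterns:
  assumes "qsubgroup G"
  shows "Q P2 P3 P1 P4 \<in> G \<Longrightarrow> Q P2 P1 P4 P3 \<in> G \<Longrightarrow> set alts \<subseteq> G"
    and "Q P2 P3 P1 P4 \<in> G \<Longrightarrow> Q P2 P1 P4 P3 \<in> G \<Longrightarrow> Q P2 P1 P3 P4 \<in> G \<Longrightarrow> set perms \<subseteq> G"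
    and "Q P2 P3 P4 P1 \<in> G \<Longrightarrow> Q P2 P1 P3 P4 \<in> G \<Longrightarrow> set perms \<subseteq> G"
proof -
  note t = qsubgroup_mul_table[OF assms(1), unfolded perms_def, simplified]
  have "Q P2 P3 P1 P4 \<in> G \<Longrightarrow> Q P2 P1 P4 P3 \<in> G \<Longrightarrow> list_all (\<lambda>x. x \<in> G) alts"
    unfolding alts_def using t by (simp (no_asm_use) only: quad_eval) sat
  then show "Q P2 P3 P1 P4 \<in> G \<Longrightarrow> Q P2 P1 P4 P3 \<in> G \<Longrightarrow> set alts \<subseteq> G"
    by (auto simp: list_all_iff)
  have "Q P2 P3 P1 P4 \<in> G \<Longrightarrow> Q P2 P1 P4 P3 \<in> G \<Longrightarrow> Q P2 P1 P3 P4 \<in> G \<Longrightarrow>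
      list_all (\<lambda>x. x \<in> G) perms"
    unfolding perms_def using t by (simp (no_asm_use) only: quad_eval) sat
  then show "Q P2 P3 P1 P4 \<in> G \<Longrightarrow> Q P2 P1 P4 P3 \<in> G \<Longrightarrow> Q P2 P1 P3 P4 \<in> G \<Longrightarrow> set perms \<subseteq> G"
    by (auto simp: list_all_iff)
  have "Q P2 P3 P4 P1 \<in> G \<Longrightarrow> Q P2 P1 P3 P4 \<in> G \<Longrightarrow> list_all (\<lambda>x. x \<in> G) perms"
    unfolding perms_def using t by (simp (no_asm_use) only: quad_eval) sat
  then show "Q P2 P3 P4 P1 \<in> G \<Longrightarrow> Q P2 P1 P3 P4 \<in> G \<Longrightarrow> set perms \<subseteq> G"
    by (auto simp: list_all_iff)
qed

text \<open>E plays the kernel of a surjection from L onto C2: lying in E is the trivial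
  value.\<close>

definition index_two :: "quad set \<Rightarrow> quad list \<Rightarrow> bool" where
  "index_two E L \<longleftrightarrow> list_all (\<lambda>p. list_all (\<lambda>q. mul p q \<in> E \<longleftrightarrow> (p \<in> E \<longleftrightarrow> q \<in> E)) L) L \<and>
     list_ex (\<lambda>p. p \<notin> E) L"

definition pattern_in :: "quad list \<Rightarrow> quad set \<Rightarrow> quad list \<Rightarrow> bool" where
  "pattern_in L E H \<longleftrightarrow> list_all (\<lambda>x. x \<in> E \<longleftrightarrow> memb x H) L"

text \<open>The intransitive four-group generated by (1 2) and (3 4).\<close>

definition klein2 :: "quad list" where
  "klein2 = [Q P1 P2 P3 P4, Q P2 P1 P4 P3, Q P2 P1 P3 P4, Q P1 P2 P4 P3]"

definition two1 :: "quad list" where "two1 = [Q P1 P2 P3 P4, Q P2 P1 P4 P3]"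

text \<open>A map to C2 kills squares, and every 3-cycle is a square; hence E contains A4 in the
  first two cases. For the 2-groups the lists contain all maximal subgroups.\<close>

lemma index_two_patterns:
  "index_two E perms \<Longrightarrow> pattern_in perms E alts"
  "\<not> index_two E alts"
  "index_two E dih1 \<Longrightarrow> list_ex (pattern_in dih1 E) [cyc1, klein, klein2]"
  "index_two E cyc1 \<Longrightarrow> pattern_in cyc1 E two1"
  "index_two E klein \<Longrightarrow> list_ex (pattern_in klein E)
     [two1, map (qconj (Q P1 P3 P2 P4)) two1, map (qconj (Q P1 P4 P3 P2)) two1]"
proof -
  assume "index_two E perms"
  note t = this[unfolded index_two_def perms_def list_ex_Nil_iff list_ex_Cons_iff, simplified]
  show "pattern_in perms E alts"
    unfolding pattern_in_def perms_def alts_def using t by (simp (no_asm_use) only: quad_eval) sat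
next
  have "index_two E alts \<Longrightarrow> False"
    unfolding index_two_def alts_def by (simp (no_asm_use) only: quad_eval) sat
  then show "\<not> index_two E alts" by blast
next
  show "index_two E dih1 \<Longrightarrow> list_ex (pattern_in dih1 E) [cyc1, klein, klein2]"
    unfolding index_two_def pattern_in_def dih1_def klein_def klein2_def cyc1_def append.simps
    by (simp (no_asm_use) only: quad_eval) sat
  show "index_two E cyc1 \<Longrightarrow> pattern_in cyc1 E two1"
    unfolding index_two_def pattern_in_def cyc1_def two1_def by (simp (no_asm_use) only: quad_eval) sat
  show "index_two E klein \<Longrightarrow> list_ex (pattern_in klein E)
     [two1, map (qconj (Q P1 P3 P2 P4)) two1, map (qconj (Q P1 P4 P3 P2)) two1]"
    unfolding index_two_def pattern_in_def klein_def two1_def qconj_def qinv_def idx_def list.map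
    by (simp (no_asm_use) only: quad_eval) sat
qed

section \<open>Subdirect products in the square of the symmetric group\<close>

text \<open>From here products are handled by the group laws; componentwise evaluation is requested
  explicitly where the factors are literal.\<close>

declare mul.simps [simp del]

definition pgroup :: "(quad \<times> quad) set \<Rightarrow> bool" where
  "pgroup \<Gamma> \<longleftrightarrow> \<Gamma> \<subseteq> set perms \<times> set perms \<and> (qone, qone) \<in> \<Gamma> \<and>
     (\<forall>s t s' t'. (s, t) \<in> \<Gamma> \<longrightarrow> (s', t') \<in> \<Gamma> \<longrightarrow> (mul s s', mul t t') \<in> \<Gamma>) \<and>
     (\<forall>s t. (s, t) \<in> \<Gamma> \<longrightarrow> (qinv s, qinv t) \<in> \<Gamma>)"

definition left_kernel :: "(quad \<times> quad) set \<Rightarrow> quad set" where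
  "left_kernel \<Gamma> = {s. (s, qone) \<in> \<Gamma>}"

definition right_kernel :: "(quad \<times> quad) set \<Rightarrow> quad set" where
  "right_kernel \<Gamma> = {t. (qone, t) \<in> \<Gamma>}"

text \<open>The effect of renumbering the roots of the second quartic by c.\<close>

definition cj :: "quad \<Rightarrow> (quad \<times> quad) set \<Rightarrow> (quad \<times> quad) set" where
  "cj c \<Gamma> = (\<lambda>(s, t). (s, qconj c t)) ` \<Gamma>"

text \<open>Fibre product of S4 and P over C2, the maps being the sign on S4 and the quotient by E
  on P.\<close>

definition fib :: "quad set \<Rightarrow> quad set \<Rightarrow> (quad \<times> quad) set" where
  "fib P E = {(s, t). s \<in> set perms \<and> t \<in> P \<and> (qeven s \<longleftrightarrow> t \<in> E)}"

text \<open>For N normal in P, the fibre product of P with itself over P / N.\<close>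

definition cong :: "quad set \<Rightarrow> quad set \<Rightarrow> (quad \<times> quad) set" where
  "cong P N = {(s, t). s \<in> P \<and> t \<in> set perms \<and> mul (qinv s) t \<in> N}"

text \<open>Up to relabelling the second factor, these are the images of the Galois groups of the table: direct
  products, the fibre products over a quotient of order two (I-2, I-7, I-8, I-9, I-11, I-13), and the
  fibre products over \<open>S\<^sub>3\<close>, \<open>C\<^sub>3\<close>, \<open>S\<^sub>4\<close> and \<open>A\<^sub>4\<close> (I-3, I-15, I-4, I-16). The
  exclusion in the first case comes from the assumption on the orders.\<close>

definition standard :: "(quad \<times> quad) set \<Rightarrow> bool" where
  "standard \<Gamma> \<longleftrightarrow>
     (\<exists>A\<in>{perms, alts}. \<exists>B\<in>{perms, alts, klein, dih1, cyc1}. \<not> (A = alts \<and> B = perms) \<and>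
        \<Gamma> = set A \<times> set B) \<or>
     (\<exists>(B, E)\<in>{(perms, alts), (dih1, cyc1), (dih1, klein), (dih1, klein2), (cyc1, two1), (klein, two1)}.
        \<Gamma> = fib (set B) (set E)) \<or>
     (\<exists>A\<in>{perms, alts}. \<exists>N\<in>{klein, [qone]}. \<Gamma> = cong (set A) (set N))"

lemma standard_times:
  "A \<in> {perms, alts} \<Longrightarrow> B \<in> {perms, alts, klein, dih1, cyc1} \<Longrightarrow> \<not> (A = alts \<and> B = perms) \<Longrightarrow>
    standard (set A \<times> set B)"
  unfolding standard_def by blast

lemma standard_fib:
  "(B, E) \<in> {(perms, alts), (dih1, cyc1), (dih1, klein), (dih1, klein2), (cyc1, two1), (klein, two1)} \<Longrightarrow>
    standard (fib (set B) (set E))"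
  unfolding standard_def by blast

section \<open>Groups of pairs: kernels, fibres and orders\<close>

lemma pgroupD:
  assumes "pgroup \<Gamma>"
  shows "(s, t) \<in> \<Gamma> \<Longrightarrow> s \<in> set perms" "(s, t) \<in> \<Gamma> \<Longrightarrow> t \<in> set perms" "(qone, qone) \<in> \<Gamma>"
    "(s, t) \<in> \<Gamma> \<Longrightarrow> (s', t') \<in> \<Gamma> \<Longrightarrow> (mul s s', mul t t') \<in> \<Gamma>"
    "(s, t) \<in> \<Gamma> \<Longrightarrow> (qinv s, qinv t) \<in> \<Gamma>"
  using assms by (auto simp: pgroup_def)

lemma qinv_unique: "p \<in> set perms \<Longrightarrow> mul p q = qone \<Longrightarrow> qinv p = q"
  using mul_cancel(2)[of p q] by (simp add: mul_one)

lemma qinv_one: "qinv qone = qone"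
  by (rule qinv_unique) (simp_all add: perms_one mul_one)

lemma qinv_mul:
  assumes "p \<in> set perms" "q \<in> set perms" shows "qinv (mul p q) = mul (qinv q) (qinv p)"
proof (rule qinv_unique)
  show "mul p q \<in> set perms" using assms by (rule perms_mul)
  show "mul (mul p q) (mul (qinv q) (qinv p)) = qone"
    using assms perms_inv by (simp only: mul_assoc mul_cancel)
qed

lemma qconj_mul:
  assumes "c \<in> set perms" shows "qconj c (mul p q) = mul (qconj c p) (qconj c q)"
  using assms by (simp only: qconj_def mul_assoc mul_cancel)

lemma qconj_one: "c \<in> set perms \<Longrightarrow> qconj c qone = qone"
  using perms_inv by (simp only: qconj_def mul_one)

lemma qconj_by_one: "qconj qone p = p"
  by (simp only: qconj_def mul_one qinv_one)

lemma qconj_perms: "c \<in> set perms \<Longrightarrow> p \<in> set perms \<Longrightarrow> qconj c p \<in> set perms"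
  using perms_inv by (simp add: qconj_def perms_mul)

lemma qconj_inv: "c \<in> set perms \<Longrightarrow> p \<in> set perms \<Longrightarrow> qinv (qconj c p) = qconj c (qinv p)"
  using qconj_mul[of c p "qinv p"] perms_inv[of p]
  by (intro qinv_unique qconj_perms) (simp_all only: qconj_one)

lemma qconj_qconj:
  "c \<in> set perms \<Longrightarrow> d \<in> set perms \<Longrightarrow> qconj c (qconj d p) = qconj (mul c d) p"
  by (simp only: qconj_def qinv_mul mul_assoc)

lemma qconj_inj: "c \<in> set perms \<Longrightarrow> qconj c p = qconj c q \<longleftrightarrow> p = q"
  using perms_inv[of c] by (simp only: qconj_def mul_cancel)

lemma cj_cj: "c \<in> set perms \<Longrightarrow> d \<in> set perms \<Longrightarrow> cj c (cj d \<Gamma>) = cj (mul c d) \<Gamma>"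
  unfolding cj_def image_image by (intro image_cong refl) (auto simp only: qconj_qconj split: prod.splits)

lemma cj_one: "cj qone \<Gamma> = \<Gamma>"
  by (simp only: cj_def qconj_by_one) auto

lemma cj_mem: "(s, t) \<in> \<Gamma> \<Longrightarrow> (s, qconj c t) \<in> cj c \<Gamma>"
  by (force simp: cj_def)

lemma pgroup_cj:
  assumes \<Gamma>: "pgroup \<Gamma>" and c: "c \<in> set perms" shows "pgroup (cj c \<Gamma>)"
  unfolding pgroup_def
proof (intro conjI allI impI)
  note g = pgroupD[OF \<Gamma>]
  show "cj c \<Gamma> \<subseteq> set perms \<times> set perms" using g(1,2) qconj_perms[OF c] by (auto simp: cj_def)
  show "(qone, qone) \<in> cj c \<Gamma>" using cj_mem[OF g(3), of c] qconj_one[OF c] by simp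
  fix s t assume "(s, t) \<in> cj c \<Gamma>"
  then obtain u where u: "(s, u) \<in> \<Gamma>" "t = qconj c u" by (auto simp: cj_def)
  show "(qinv s, qinv t) \<in> cj c \<Gamma>"
    using cj_mem[OF g(5)[OF u(1)], of c] qconj_inv[OF c g(2)[OF u(1)]] u(2) by simp
  fix s' t' assume "(s', t') \<in> cj c \<Gamma>"
  then obtain u' where u': "(s', u') \<in> \<Gamma>" "t' = qconj c u'" by (auto simp: cj_def)
  show "(mul s s', mul t t') \<in> cj c \<Gamma>"
    using cj_mem[OF g(4)[OF u(1) u'(1)], of c] qconj_mul[OF c] u(2) u'(2) by simp
qed

lemma fst_cj: "fst ` cj c \<Gamma> = fst ` \<Gamma>"
  by (force simp: cj_def)

lemma snd_cj: "snd ` cj c \<Gamma> = qconj c ` snd ` \<Gamma>"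
  by (force simp: cj_def)

lemma left_kernel_cj: "c \<in> set perms \<Longrightarrow> left_kernel (cj c \<Gamma>) = left_kernel \<Gamma>"
proof -
  assume c: "c \<in> set perms"
  have "(s, qone) \<in> cj c \<Gamma> \<longleftrightarrow> (\<exists>t. (s, t) \<in> \<Gamma> \<and> qconj c t = qconj c qone)" for s
    unfolding qconj_one[OF c] cj_def by (auto simp: image_iff) (metis (no_types, lifting) case_prod_conv)
  then show ?thesis unfolding left_kernel_def qconj_inj[OF c] by auto
qed

lemma right_kernel_cj: "right_kernel (cj c \<Gamma>) = qconj c ` right_kernel \<Gamma>"
  by (force simp: right_kernel_def cj_def)

lemma qsubgroup_fst:
  assumes \<Gamma>: "pgroup \<Gamma>" shows "qsubgroup (fst ` \<Gamma>)"
  unfolding qsubgroup_def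
proof (intro conjI ballI subsetI)
  note g = pgroupD[OF \<Gamma>]
  show "qone \<in> fst ` \<Gamma>" using g(3) by force
  fix p assume "p \<in> fst ` \<Gamma>"
  then obtain r where p: "(p, r) \<in> \<Gamma>" by auto
  show "p \<in> set perms" "qinv p \<in> fst ` \<Gamma>" using g(1)[OF p] g(5)[OF p] by force+
  fix q assume "q \<in> fst ` \<Gamma>"
  then obtain r' where q: "(q, r') \<in> \<Gamma>" by auto
  show "mul p q \<in> fst ` \<Gamma>" using g(4)[OF p q] by force
qed

lemma qsubgroup_snd:
  assumes \<Gamma>: "pgroup \<Gamma>" shows "qsubgroup (snd ` \<Gamma>)"
  unfolding qsubgroup_def
proof (intro conjI ballI subsetI)
  note g = pgroupD[OF \<Gamma>]
  show "qone \<in> snd ` \<Gamma>" using g(3) by force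
  fix p assume "p \<in> snd ` \<Gamma>"
  then obtain r where p: "(r, p) \<in> \<Gamma>" by auto
  show "p \<in> set perms" "qinv p \<in> snd ` \<Gamma>" using g(2)[OF p] g(5)[OF p] by force+
  fix q assume "q \<in> snd ` \<Gamma>"
  then obtain r' where q: "(r', q) \<in> \<Gamma>" by auto
  show "mul p q \<in> snd ` \<Gamma>" using g(4)[OF p q] by force
qed

lemma qsubgroup_left_kernel:
  assumes \<Gamma>: "pgroup \<Gamma>" shows "qsubgroup (left_kernel \<Gamma>)"
  unfolding qsubgroup_def
proof (intro conjI ballI subsetI)
  note g = pgroupD[OF \<Gamma>]
  show "qone \<in> left_kernel \<Gamma>" using g(3) by (simp add: left_kernel_def)
  fix p assume "p \<in> left_kernel \<Gamma>"
  then have p: "(p, qone) \<in> \<Gamma>" by (simp add: left_kernel_def)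
  show "p \<in> set perms" "qinv p \<in> left_kernel \<Gamma>"
    using g(1)[OF p] g(5)[OF p] by (simp_all add: left_kernel_def qinv_one)
  fix q assume "q \<in> left_kernel \<Gamma>"
  then have q: "(q, qone) \<in> \<Gamma>" by (simp add: left_kernel_def)
  show "mul p q \<in> left_kernel \<Gamma>" using g(4)[OF p q] by (simp add: left_kernel_def mul_one)
qed

lemma qsubgroup_right_kernel:
  assumes \<Gamma>: "pgroup \<Gamma>" shows "qsubgroup (right_kernel \<Gamma>)"
  unfolding qsubgroup_def
proof (intro conjI ballI subsetI)
  note g = pgroupD[OF \<Gamma>]
  show "qone \<in> right_kernel \<Gamma>" using g(3) by (simp add: right_kernel_def)
  fix p assume "p \<in> right_kernel \<Gamma>"
  then have p: "(qone, p) \<in> \<Gamma>" by (simp add: right_kernel_def)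
  show "p \<in> set perms" "qinv p \<in> right_kernel \<Gamma>"
    using g(2)[OF p] g(5)[OF p] by (simp_all add: right_kernel_def qinv_one)
  fix q assume "q \<in> right_kernel \<Gamma>"
  then have q: "(qone, q) \<in> \<Gamma>" by (simp add: right_kernel_def)
  show "mul p q \<in> right_kernel \<Gamma>" using g(4)[OF p q] by (simp add: right_kernel_def mul_one)
qed

lemma normal_left_kernel:
  assumes \<Gamma>: "pgroup \<Gamma>" and "s \<in> fst ` \<Gamma>" "n \<in> left_kernel \<Gamma>"
  shows "qconj s n \<in> left_kernel \<Gamma>"
proof -
  note g = pgroupD[OF \<Gamma>]
  obtain t where t: "(s, t) \<in> \<Gamma>" using assms by auto
  then have "(mul (mul s n) (qinv s), mul (mul t qone) (qinv t)) \<in> \<Gamma>"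
    using assms(3) g by (auto simp: left_kernel_def)
  then show ?thesis
    using perms_inv[OF g(2)[OF t]] by (simp add: left_kernel_def qconj_def mul_one)
qed

lemma normal_right_kernel:
  assumes \<Gamma>: "pgroup \<Gamma>" and "t \<in> snd ` \<Gamma>" "n \<in> right_kernel \<Gamma>"
  shows "qconj t n \<in> right_kernel \<Gamma>"
proof -
  note g = pgroupD[OF \<Gamma>]
  obtain s where t: "(s, t) \<in> \<Gamma>" using assms by auto
  then have "(mul (mul s qone) (qinv s), mul (mul t n) (qinv t)) \<in> \<Gamma>"
    using assms(3) g by (auto simp: right_kernel_def)
  then show ?thesis
    using perms_inv[OF g(1)[OF t]] by (simp add: right_kernel_def qconj_def mul_one)
qed

text \<open>Over a fixed t the admissible first components form one coset of the left
  kernel.\<close>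

lemma fiber_left:
  assumes \<Gamma>: "pgroup \<Gamma>" and st: "(s, t) \<in> \<Gamma>"
  shows "(s', t) \<in> \<Gamma> \<longleftrightarrow> s' \<in> set perms \<and> mul (qinv s) s' \<in> left_kernel \<Gamma>"
proof -
  note g = pgroupD[OF \<Gamma>]
  note c = mul_cancel[OF g(1)[OF st]]
  show ?thesis
    using g(4)[OF g(5)[OF st], of s' t] g(4)[OF st, of "mul (qinv s) s'" qone] g(1)[of s' t]
      perms_inv[OF g(2)[OF st]] by (auto simp: left_kernel_def c mul_one)
qed

lemma fiber_right:
  assumes \<Gamma>: "pgroup \<Gamma>" and st: "(s, t) \<in> \<Gamma>"
  shows "(s, t') \<in> \<Gamma> \<longleftrightarrow> t' \<in> set perms \<and> mul (qinv t) t' \<in> right_kernel \<Gamma>"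
proof -
  note g = pgroupD[OF \<Gamma>]
  note c = mul_cancel[OF g(2)[OF st]]
  show ?thesis
    using g(4)[OF g(5)[OF st], of s t'] g(4)[OF st, of qone "mul (qinv t) t'"] g(2)[of s t']
      perms_inv[OF g(1)[OF st]] by (auto simp: right_kernel_def c mul_one)
qed

lemma finite_pgroup: "pgroup \<Gamma> \<Longrightarrow> finite \<Gamma>"
  unfolding pgroup_def using finite_subset[of \<Gamma> "set perms \<times> set perms"] by auto

lemma card_coset:
  assumes "s \<in> set perms" "N \<subseteq> set perms"
  shows "card {s'. s' \<in> set perms \<and> mul (qinv s) s' \<in> N} = card N"
proof -
  have "{s'. s' \<in> set perms \<and> mul (qinv s) s' \<in> N} = mul s ` N"
  proof safe
    fix s' assume "mul (qinv s) s' \<in> N"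
    then show "s' \<in> mul s ` N" using mul_cancel(1)[OF assms(1), of s'] by (metis imageI)
  qed (use assms perms_mul mul_cancel in auto)
  moreover have "inj_on (mul s) N" using mul_cancel(3)[OF assms(1)] by (auto intro: inj_onI)
  ultimately show ?thesis by (simp add: card_image)
qed

text \<open>Counting by the fibres of the second projection. Combined with the count over the first
  projection it relates the orders of the two kernels, which pins down the right kernel once the
  left one is known.\<close>

lemma card_pgroup_left:
  assumes \<Gamma>: "pgroup \<Gamma>" shows "card \<Gamma> = card (left_kernel \<Gamma>) * card (snd ` \<Gamma>)"
proof -
  note g = pgroupD[OF \<Gamma>]
  have N: "left_kernel \<Gamma> \<subseteq> set perms" using g by (auto simp: left_kernel_def)
  have "card {x \<in> \<Gamma>. snd x = t} = card (left_kernel \<Gamma>)" if t: "t \<in> snd ` \<Gamma>" for t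
  proof -
    obtain s where s: "(s, t) \<in> \<Gamma>" using t by auto
    have "{x \<in> \<Gamma>. snd x = t} = (\<lambda>s'. (s', t)) ` {s'. (s', t) \<in> \<Gamma>}" by force
    then have "card {x \<in> \<Gamma>. snd x = t} = card {s'. (s', t) \<in> \<Gamma>}"
      by (simp add: card_image inj_on_def)
    also have "\<dots> = card (left_kernel \<Gamma>)"
      using fiber_left[OF \<Gamma> s] card_coset[OF g(1)[OF s] N] by simp
    finally show ?thesis .
  qed
  then show ?thesis
    using sum.image_gen[OF finite_pgroup[OF \<Gamma>], of "\<lambda>_. 1::nat" snd] by simp
qed

lemma card_pgroup_right:
  assumes \<Gamma>: "pgroup \<Gamma>" shows "card \<Gamma> = card (right_kernel \<Gamma>) * card (fst ` \<Gamma>)"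
proof -
  note g = pgroupD[OF \<Gamma>]
  have N: "right_kernel \<Gamma> \<subseteq> set perms" using g by (auto simp: right_kernel_def)
  have "card {x \<in> \<Gamma>. fst x = s} = card (right_kernel \<Gamma>)" if s: "s \<in> fst ` \<Gamma>" for s
  proof -
    obtain t where t: "(s, t) \<in> \<Gamma>" using s by auto
    have "{x \<in> \<Gamma>. fst x = s} = Pair s ` {t'. (s, t') \<in> \<Gamma>}" by force
    then have "card {x \<in> \<Gamma>. fst x = s} = card {t'. (s, t') \<in> \<Gamma>}"
      by (simp add: card_image inj_on_def)
    also have "\<dots> = card (right_kernel \<Gamma>)"
      using fiber_right[OF \<Gamma> t] card_coset[OF g(2)[OF t] N] by simp
    finally show ?thesis .
  qed
  then show ?thesis
    using sum.image_gen[OF finite_pgroup[OF \<Gamma>], of "\<lambda>_. 1::nat" fst] by simp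
qed

lemma group_cards: "card (set perms) = 24" "card (set alts) = 12" "card (set klein) = 4"
    "card (set dih1) = 8" "card (set cyc1) = 4" "card (set [qone]) = 1"
  by (simp_all add: perms_def alts_def klein_def dih1_def cyc1_def)

lemma list_subsets: "set alts \<subseteq> set perms" "set klein \<subseteq> set alts" "set dih1 \<subseteq> set perms"
    "set cyc1 \<subseteq> set dih1" "set klein2 \<subseteq> set dih1" "set klein \<subseteq> set dih1" "set two1 \<subseteq> set klein"
    "set two1 \<subseteq> set cyc1"
  by (simp_all add: perms_def alts_def klein_def dih1_def cyc1_def klein2_def two1_def)

lemma full_left_kernel:
  assumes \<Gamma>: "pgroup \<Gamma>" and "left_kernel \<Gamma> = fst ` \<Gamma>" shows "\<Gamma> = fst ` \<Gamma> \<times> snd ` \<Gamma>"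
proof safe
  fix s t s' t' assume "(s, t') \<in> \<Gamma>" "(s', t) \<in> \<Gamma>"
  moreover have "mul (qinv s') s \<in> left_kernel \<Gamma>"
    using calculation qsubgroup_fst[OF \<Gamma>] unfolding assms(2) qsubgroup_def by (metis fst_conv imageI)
  ultimately show "(fst (s, t'), snd (s', t)) \<in> \<Gamma>"
    using fiber_left[OF \<Gamma>, of s' t s] pgroupD(1)[OF \<Gamma>, of s t'] by simp
qed force+

text \<open>For (s, t) \<in> \<Gamma>, s is even iff (s, 1) \<in> \<Gamma> iff (1, t) \<in>
  \<Gamma>. So the parity of s is decided by whether t lies in the right kernel.\<close>

lemma alternating_left_kernel:
  assumes \<Gamma>: "pgroup \<Gamma>" and "left_kernel \<Gamma> = set alts" "fst ` \<Gamma> = set perms"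
  shows "\<Gamma> = fib (snd ` \<Gamma>) (right_kernel \<Gamma>)"
proof -
  note g = pgroupD[OF \<Gamma>]
  have *: "qeven s \<longleftrightarrow> t \<in> right_kernel \<Gamma>" if st: "(s, t) \<in> \<Gamma>" for s t
  proof -
    have "qeven s \<longleftrightarrow> s \<in> left_kernel \<Gamma>" using assms by (simp add: qeven_def)
    also have "\<dots> \<longleftrightarrow> t \<in> right_kernel \<Gamma>"
      using fiber_right[OF \<Gamma> st, of qone] g(5)[of qone "mul (qinv t) qone"] g(5)[of qone t]
        perms_inv[of "qinv t"] perms_inv[OF g(2)[OF st]] perms_one qinv_unique[of "qinv t" t] qinv_one
      by (auto simp: left_kernel_def right_kernel_def mul_one)
    finally show ?thesis .
  qed
  show ?thesis
  proof (intro subset_antisym subrelI)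
    fix s t assume st: "(s, t) \<in> \<Gamma>"
    then show "(s, t) \<in> fib (snd ` \<Gamma>) (right_kernel \<Gamma>)"
      using *[OF st] g(1)[OF st] image_eqI[of t snd, OF _ st] by (simp add: fib_def)
  next
    fix s t assume st: "(s, t) \<in> fib (snd ` \<Gamma>) (right_kernel \<Gamma>)"
    then obtain s' where s': "(s', t) \<in> \<Gamma>" by (auto simp: fib_def)
    have p: "s \<in> set perms" "s' \<in> set perms" "qinv s' \<in> set perms"
      using st g(1)[OF s'] perms_inv by (auto simp: fib_def)
    have "qeven s \<longleftrightarrow> qeven s'" using st *[OF s'] by (auto simp: fib_def)
    moreover have "qeven (qinv s') \<longleftrightarrow> qeven s'"
      using qeven_mul[OF p(2,3)] perms_inv[OF p(2)] by (auto simp: qeven_def alts_def)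
    ultimately have "mul (qinv s') s \<in> left_kernel \<Gamma>"
      using qeven_mul[OF p(3,1)] assms by (simp add: qeven_def)
    then show "(s, t) \<in> \<Gamma>" using fiber_left[OF \<Gamma> s'] p by simp
  qed
qed

text \<open>Once the diagonal is present, the fibre over s is the coset of the right kernel through
  s itself.\<close>

lemma diagonal_cong:
  assumes \<Gamma>: "pgroup \<Gamma>" and "\<And>s. s \<in> fst ` \<Gamma> \<Longrightarrow> (s, s) \<in> \<Gamma>"
  shows "\<Gamma> = cong (fst ` \<Gamma>) (right_kernel \<Gamma>)"
proof (intro subset_antisym subrelI)
  fix s t assume st: "(s, t) \<in> \<Gamma>"
  then have "s \<in> fst ` \<Gamma>" by force
  then show "(s, t) \<in> cong (fst ` \<Gamma>) (right_kernel \<Gamma>)"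
    using fiber_right[OF \<Gamma> assms(2), of s t] st by (simp add: cong_def)
next
  fix s t assume st: "(s, t) \<in> cong (fst ` \<Gamma>) (right_kernel \<Gamma>)"
  then show "(s, t) \<in> \<Gamma>" using fiber_right[OF \<Gamma> assms(2), of s t] by (auto simp: cong_def)
qed

lemma qsubgroup_diagonal: "pgroup \<Gamma> \<Longrightarrow> qsubgroup {s. (s, s) \<in> \<Gamma>}"
  unfolding qsubgroup_def using pgroupD[of \<Gamma>] by (auto)

section \<open>Reduction to standard form by relabelling\<close>

lemma transitive_cases:
  assumes \<Gamma>: "pgroup \<Gamma>" and "\<And>x. \<exists>p\<in>snd ` \<Gamma>. app p P1 = x"
  obtains c B where "c \<in> set perms" "B \<in> {perms, alts, klein, dih1, cyc1}" "snd ` cj c \<Gamma> = set B"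
proof -
  let ?a = "Q P1 P3 P2 P4" and ?b = "Q P1 P4 P3 P2"
  have p: "qone \<in> set perms" "?a \<in> set perms" "?b \<in> set perms" by (simp_all add: perms_def)
  have G: "qsubgroup (snd ` \<Gamma>)" using qsubgroup_snd[OF \<Gamma>] .
  have sub: "snd ` \<Gamma> \<subseteq> set perms" using G by (simp add: qsubgroup_def)
  have pat: "pattern (snd ` \<Gamma>) H \<longleftrightarrow> snd ` \<Gamma> = set H" if "set H \<subseteq> set perms" for H
    using pattern_eq[OF sub that] .
  \<comment> \<open>The relabellings (2 3) and (2 4) are involutions, so a second conjugation takes
    a conjugated list back to the standard one.\<close>
  have inv: "qconj ?a (qconj ?a x) = x" "qconj ?b (qconj ?b x) = x" for x
    using qconj_qconj[OF p(2,2), of x] qconj_qconj[OF p(3,3), of x] by (simp_all add: qconj_by_one mul.simps)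
  have a: "snd ` cj ?a \<Gamma> = set H" if "pattern (snd ` \<Gamma>) (map (qconj ?a) H)" "set H \<subseteq> set perms" for H
  proof -
    have "set (map (qconj ?a) H) \<subseteq> set perms" using that qconj_perms[OF p(2)] by auto
    then have "snd ` \<Gamma> = qconj ?a ` set H" using pat that by auto
    then show ?thesis unfolding snd_cj by (simp add: image_image inv)
  qed
  have b: "snd ` cj ?b \<Gamma> = set H" if "pattern (snd ` \<Gamma>) (map (qconj ?b) H)" "set H \<subseteq> set perms" for H
  proof -
    have "set (map (qconj ?b) H) \<subseteq> set perms" using that qconj_perms[OF p(3)] by auto
    then have "snd ` \<Gamma> = qconj ?b ` set H" using pat that by auto
    then show ?thesis unfolding snd_cj by (simp add: image_image inv)
  qed
  have o: "snd ` cj qone \<Gamma> = set H" if "pattern (snd ` \<Gamma>) H" "set H \<subseteq> set perms" for H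
    using that pat[of H] by (simp add: cj_one)
  have s: "set alts \<subseteq> set perms" "set klein \<subseteq> set perms" "set dih1 \<subseteq> set perms" "set cyc1 \<subseteq> set perms"
    using list_subsets by auto
  show ?thesis
    using transitive_patterns[OF G assms(2)] unfolding list_ex_Nil_iff list_ex_Cons_iff
    using that[OF p(1) _ o] that[OF p(2) _ a] that[OF p(3) _ b] s by blast
qed

fun conj_to :: "quad \<Rightarrow> quad \<Rightarrow> quad \<Rightarrow> quad \<Rightarrow> quad list \<Rightarrow> bool" where
  "conj_to a b a' b' [] \<longleftrightarrow> False"
| "conj_to a b a' b' (c # cs) \<longleftrightarrow>
     (if qconj c a = a' then if qconj c b = b' then True else conj_to a b a' b' cs else conj_to a b a' b' cs)"

lemma conj_to_iff: "conj_to a b a' b' cs \<longleftrightarrow> (\<exists>c\<in>set cs. qconj c a = a' \<and> qconj c b = b')"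
  by (induction cs) auto

text \<open>Nontrivial t, u in A4 with t^3 = u^2 = 1 are conjugate under S4 to (1 2 3) and (1 2)(3
  4). Matching on components keeps the equation from unfolding before its arguments are
  evaluated.\<close>

fun alts_gen_ok :: "quad \<Rightarrow> quad \<Rightarrow> bool" where
  "alts_gen_ok (Q a b c d) (Q a' b' c' d') \<longleftrightarrow> (let t = Q a b c d; u = Q a' b' c' d' in
     t \<noteq> qone \<longrightarrow> mul t (mul t t) = qone \<longrightarrow> u \<noteq> qone \<longrightarrow> mul u u = qone \<longrightarrow>
       conj_to t u (Q P2 P3 P1 P4) (Q P2 P1 P4 P3) perms)"

text \<open>The relations t^4 = u^2 = (t u)^3 = 1 of (1 2 3 4) and (1 2). As t u is even and t is a
  4-cycle, u is odd, hence a transposition; the last relation makes its two points neighbours on the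
  cycle.\<close>

fun perms_gen_ok :: "quad \<Rightarrow> quad \<Rightarrow> bool" where
  "perms_gen_ok (Q a b c d) (Q a' b' c' d') \<longleftrightarrow> (let t = Q a b c d; u = Q a' b' c' d' in
     mul t t \<noteq> qone \<longrightarrow> mul (mul t t) (mul t t) = qone \<longrightarrow> u \<noteq> qone \<longrightarrow> mul u u = qone \<longrightarrow>
     mul (mul t u) (mul (mul t u) (mul t u)) = qone \<longrightarrow>
       conj_to t u (Q P2 P3 P4 P1) (Q P2 P1 P3 P4) perms)"

lemma alts_generators:
  assumes "t \<in> set alts" "u \<in> set alts" "t \<noteq> qone" "mul t (mul t t) = qone" "u \<noteq> qone" "mul u u = qone"
  obtains c where "c \<in> set perms" "qconj c t = Q P2 P3 P1 P4" "qconj c u = Q P2 P1 P4 P3"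
proof -
  have "list_all (\<lambda>t. list_all (alts_gen_ok t) alts) alts" by code_simp
  then have "alts_gen_ok t u" using assms by (simp only: list_all_iff)
  then show ?thesis using assms that by (cases t; cases u) (auto simp: conj_to_iff)
qed

lemma perms_generators:
  assumes "t \<in> set perms" "u \<in> set perms" "mul t t \<noteq> qone" "mul (mul t t) (mul t t) = qone"
    "u \<noteq> qone" "mul u u = qone" "mul (mul t u) (mul (mul t u) (mul t u)) = qone"
  obtains c where "c \<in> set perms" "qconj c t = Q P2 P3 P4 P1" "qconj c u = Q P2 P1 P3 P4"
proof -
  have "list_all (\<lambda>t. list_all (perms_gen_ok t) perms) perms" by code_simp
  then have "perms_gen_ok t u" using assms by (simp only: list_all_iff)
  then show ?thesis using assms that by (cases t; cases u) (auto simp: conj_to_iff)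
qed

text \<open>The stabilizer of P4 is a complement to the four-group, so the order of its elements can
  be read off modulo the four-group: 3-cycles in the first case, transpositions in the
  second.\<close>

lemma fix4_cases:
  assumes "t \<in> set perms" "app t P4 = P4" "t \<noteq> qone"
  shows "mul t (mul t t) \<in> set klein \<Longrightarrow> t \<in> {Q P2 P3 P1 P4, Q P3 P1 P2 P4}"
    "mul t t \<in> set klein \<Longrightarrow> t \<in> {Q P2 P1 P3 P4, Q P3 P2 P1 P4, Q P1 P3 P2 P4}"
proof -
  have "\<forall>t\<in>set perms. app t P4 = P4 \<longrightarrow> t \<noteq> qone \<longrightarrow>
    (mul t (mul t t) \<in> set klein \<longrightarrow> t \<in> {Q P2 P3 P1 P4, Q P3 P1 P2 P4}) \<and>
    (mul t t \<in> set klein \<longrightarrow> t \<in> {Q P2 P1 P3 P4, Q P3 P2 P1 P4, Q P1 P3 P2 P4})"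
    by (simp add: perms_def klein_def mul.simps)
  with assms show "mul t (mul t t) \<in> set klein \<Longrightarrow> t \<in> {Q P2 P3 P1 P4, Q P3 P1 P2 P4}"
    "mul t t \<in> set klein \<Longrightarrow> t \<in> {Q P2 P1 P3 P4, Q P3 P2 P1 P4, Q P1 P3 P2 P4}"
    by blast+
qed

lemma fix4_generators:
  assumes "t \<in> {Q P2 P3 P1 P4, Q P3 P1 P2 P4}" "u \<in> {Q P2 P1 P3 P4, Q P3 P2 P1 P4, Q P1 P3 P2 P4}"
  obtains c where "c \<in> set perms" "qconj c t = Q P2 P3 P1 P4" "qconj c u = Q P2 P1 P3 P4"
proof -
  have "list_all (\<lambda>t. list_all (\<lambda>u. conj_to t u (Q P2 P3 P1 P4) (Q P2 P1 P3 P4) perms)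
      [Q P2 P1 P3 P4, Q P3 P2 P1 P4, Q P1 P3 P2 P4]) [Q P2 P3 P1 P4, Q P3 P1 P2 P4]"
    by (simp add: perms_def qconj_def qinv_def idx_def mul.simps)
  then have "conj_to t u (Q P2 P3 P1 P4) (Q P2 P1 P3 P4) perms"
    using assms by (auto simp only: list_all_iff set_simps)
  then show ?thesis using that by (auto simp: conj_to_iff)
qed

text \<open>The four-group acts transitively on the points, so each of its cosets contains an
  element that fixes P4.\<close>

lemma klein_lift:
  assumes "t \<in> set perms" obtains v where "v \<in> set klein" "app (mul t v) P4 = P4"
proof -
  have "\<forall>t\<in>set perms. \<exists>v\<in>set klein. app (mul t v) P4 = P4"
    by (simp add: perms_def klein_def mul.simps)
  then show ?thesis using assms that by blast
qed

lemma klein_conj: "c \<in> set perms \<Longrightarrow> qconj c ` set klein = set klein"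
proof -
  have "\<forall>c\<in>set perms. qconj c ` set klein = set klein"
    by (simp add: perms_def klein_def qconj_def qinv_def idx_def mul.simps insert_commute)
  then show "c \<in> set perms \<Longrightarrow> ?thesis" by blast
qed

text \<open>Here the two projections have a common quotient of order three or six. This forces the second group to be
  \<open>A\<^sub>4\<close> or \<open>S\<^sub>4\<close>; modulo \<open>V\<^sub>4\<close>, elements can be lifted to the stabilizer of \<open>P4\<close>, where generators are
  conjugate to the standard ones.\<close>

lemma klein_left_kernel:
  assumes \<Gamma>: "pgroup \<Gamma>" and A: "A \<in> {perms, alts}" "fst ` \<Gamma> = set A"
    and B: "B \<in> {perms, alts, klein, dih1, cyc1}" "snd ` \<Gamma> = set B"
    and N: "left_kernel \<Gamma> = set klein"
  shows "\<exists>c\<in>set perms. cj c \<Gamma> = cong (set A) (set klein)"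
proof -
  note g = pgroupD[OF \<Gamma>]
  let ?r = "Q P2 P3 P1 P4" and ?s = "Q P2 P1 P3 P4"
  have r: "?r \<in> set alts" "?r \<notin> set klein" "?s \<notin> set klein"
    by (simp_all add: alts_def klein_def)
  then have "?r \<in> fst ` \<Gamma>" using A list_subsets(1) by auto
  then obtain t where t: "(?r, t) \<in> \<Gamma>" by auto
  \<comment> \<open>If t^4 were trivial, then (r^4, 1) would lie in \<Gamma>; but r = (1 2 3)
    satisfies r^4 = r, which is outside the four-group. The 2-groups in the list have exponent 4 or
    2 and are thereby excluded.\<close>
  have "mul (mul t t) (mul t t) \<noteq> qone"
  proof
    assume "mul (mul t t) (mul t t) = qone"
    then have "(mul (mul ?r ?r) (mul ?r ?r), qone) \<in> \<Gamma>"
      using g(4)[OF g(4)[OF t t] g(4)[OF t t]] by simp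
    then have "?r \<in> left_kernel \<Gamma>" by (simp add: left_kernel_def mul.simps)
    then show False using r N by simp
  qed
  moreover have "t \<in> set B" using t B by force
  moreover have "\<forall>t\<in>set klein \<union> set dih1 \<union> set cyc1. mul (mul t t) (mul t t) = qone"
    by (simp add: klein_def dih1_def cyc1_def mul.simps)
  ultimately have B': "B \<in> {perms, alts}" using B(1) by auto
  have "qconj c p \<in> right_kernel \<Gamma>" if "c \<in> set alts" "p \<in> right_kernel \<Gamma>" for c p
    using that B B' list_subsets(1) by (intro normal_right_kernel[OF \<Gamma>]) auto
  from normal_patterns[OF qsubgroup_right_kernel[OF \<Gamma>] this]
  have "right_kernel \<Gamma> \<in> {set [qone], set klein, set alts, set perms}"
    using pattern_eq[of "right_kernel \<Gamma>"] qsubgroup_right_kernel[OF \<Gamma>] list_subsets(1,2) perms_one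
    unfolding qsubgroup_def list_ex_Cons_iff list_ex_Nil_iff by auto
  moreover have "card (right_kernel \<Gamma>) * card (set A) = 4 * card (set B)"
    using card_pgroup_left[OF \<Gamma>] card_pgroup_right[OF \<Gamma>] A B N by (simp add: group_cards)
  \<comment> \<open>The candidates have orders 1, 4, 12 and 24, and A and B have order 12 or 24; the
    count leaves only order 4.\<close>
  ultimately have R: "right_kernel \<Gamma> = set klein"
    using A B' group_cards by auto
  have lift: "\<exists>t\<in>set perms. (s, t) \<in> \<Gamma> \<and> app t P4 = P4 \<and> t \<noteq> qone"
    if s: "s \<in> fst ` \<Gamma>" "s \<notin> set klein" for s
  proof -
    obtain t where t: "(s, t) \<in> \<Gamma>" using s by auto
    obtain v where v: "v \<in> set klein" "app (mul t v) P4 = P4" using klein_lift[OF g(2)[OF t]] .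
    then have "(qone, v) \<in> \<Gamma>" using R by (auto simp: right_kernel_def)
    from g(4)[OF t this] have *: "(s, mul t v) \<in> \<Gamma>" by (simp only: mul_one)
    have "mul t v \<noteq> qone"
    proof
      assume "mul t v = qone"
      then have "s \<in> left_kernel \<Gamma>" using * by (simp only: left_kernel_def mem_Collect_eq)
      then show False using s(2) N by blast
    qed
    then show ?thesis using v(2) * g(2)[OF *] by blast
  qed
  obtain u where u: "u \<in> set perms" "(?r, u) \<in> \<Gamma>" "app u P4 = P4" "u \<noteq> qone"
    using lift[of ?r] r A list_subsets(1) by auto
  have "(qone, mul u (mul u u)) \<in> \<Gamma>"
    using g(4)[OF u(2) g(4)[OF u(2) u(2)]] by (simp add: mul.simps)
  then have "mul u (mul u u) \<in> set klein" using R by (auto simp: right_kernel_def)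
  then have u': "u \<in> {Q P2 P3 P1 P4, Q P3 P1 P2 P4}" using fix4_cases(1) u by blast
  have main: "cj c \<Gamma> = cong (set A) (set klein)"
    if c: "c \<in> set perms" "qconj c u = ?r" and x: "A = perms \<Longrightarrow> (?s, ?s) \<in> cj c \<Gamma>" for c
  proof -
    let ?D = "{s. (s, s) \<in> cj c \<Gamma>}"
    have \<Gamma>': "pgroup (cj c \<Gamma>)" by (rule pgroup_cj[OF \<Gamma> c(1)])
    have D: "qsubgroup ?D" by (rule qsubgroup_diagonal[OF \<Gamma>'])
    have k: "left_kernel (cj c \<Gamma>) = set klein" "right_kernel (cj c \<Gamma>) = set klein"
      using left_kernel_cj[OF c(1)] right_kernel_cj klein_conj[OF c(1)] N R by auto
    have "v \<in> ?D" if "v \<in> set klein" for v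
    proof -
      have "(v, qone) \<in> cj c \<Gamma>" "(qone, v) \<in> cj c \<Gamma>"
        using k that by (auto simp: left_kernel_def right_kernel_def)
      from pgroupD(4)[OF \<Gamma>' this] show ?thesis by (simp add: mul_one)
    qed
    then have d: "Q P2 P1 P4 P3 \<in> ?D" by (simp add: klein_def)
    have "?r \<in> ?D" using cj_mem[OF u(2), of c] c by simp
    then have "set A \<subseteq> ?D" using generating_patterns[OF D] d x A by auto
    then show ?thesis using diagonal_cong[OF \<Gamma>'] k A unfolding fst_cj by auto
  qed
  show ?thesis
  proof (cases "A = perms")
    case True
    have "?s \<in> fst ` \<Gamma>" using A True by (simp add: perms_def)
    then obtain w where w: "w \<in> set perms" "(?s, w) \<in> \<Gamma>" "app w P4 = P4" "w \<noteq> qone"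
      using lift[of ?s] r by auto
    have "mul ?s ?s = qone" by (simp add: mul.simps)
    then have "(qone, mul w w) \<in> \<Gamma>" using g(4)[OF w(2) w(2)] by simp
    then have "mul w w \<in> set klein" using R by (auto simp: right_kernel_def)
    then have "w \<in> {Q P2 P1 P3 P4, Q P3 P2 P1 P4, Q P1 P3 P2 P4}" using fix4_cases(2) w by blast
    then obtain c where c: "c \<in> set perms" "qconj c u = ?r" "qconj c w = ?s"
      using fix4_generators[OF u'] by blast
    then show ?thesis using main[OF c(1,2)] cj_mem[OF w(2), of c] by auto
  next
    case False
    \<comment> \<open>For A4 only the 3-cycle u has to be moved; the transposition \<open>?s\<close>
      merely completes the pair expected by \<open>fix4_generators\<close>.\<close>
    obtain c where c: "c \<in> set perms" "qconj c u = ?r"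
      using fix4_generators[OF u', of ?s] by auto
    then show ?thesis using main[OF c] False by auto
  qed
qed

text \<open>By the bound on the orders \<open>\<Gamma>\<close> is the graph of an automorphism of \<open>S\<^sub>4\<close> or \<open>A\<^sub>4\<close>, and every such
  automorphism is conjugation by an element of \<open>S\<^sub>4\<close>.\<close>

lemma trivial_left_kernel:
  assumes \<Gamma>: "pgroup \<Gamma>" and A: "A \<in> {perms, alts}" "fst ` \<Gamma> = set A"
    and B: "B \<in> {perms, alts, klein, dih1, cyc1}" "snd ` \<Gamma> = set B"
    and N: "left_kernel \<Gamma> = set [qone]" and le: "card (set B) \<le> card (set A)"
  shows "\<exists>c\<in>set perms. cj c \<Gamma> = cong (set A) (set [qone])"
proof -
  note g = pgroupD[OF \<Gamma>]
  have o: "qone \<in> right_kernel \<Gamma>" using g(3) by (simp add: right_kernel_def)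
  have fin: "finite (right_kernel \<Gamma>)"
    using qsubgroup_right_kernel[OF \<Gamma>] finite_subset by (auto simp: qsubgroup_def)
  have e: "card (right_kernel \<Gamma>) * card (set A) = card (set B)"
    using card_pgroup_left[OF \<Gamma>] card_pgroup_right[OF \<Gamma>] A B N by simp
  have "card (right_kernel \<Gamma>) > 0" using o fin card_gt_0_iff by blast
  moreover have cA: "card (set A) > 0" using A group_cards by auto
  \<comment> \<open>The right kernel has order |B| / |A|, which the bound on the orders makes at
    most 1.\<close>
  ultimately have c1: "card (right_kernel \<Gamma>) = 1"
    using e le by (metis One_nat_def Suc_leI le_antisym mult.commute mult_le_cancel1 nat_mult_1_right)
  then have R: "right_kernel \<Gamma> = set [qone]" using o by (auto simp: card_1_singleton_iff)
  have "B = A" using e c1 A(1) B(1) group_cards by auto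
  then have tA: "t \<in> set A" if "(s, t) \<in> \<Gamma>" for s t using that B(2) by force
  have n1: "s = qone" if "(s, qone) \<in> \<Gamma>" for s using N that by (auto simp: left_kernel_def)
  have n2: "t = qone" if "(qone, t) \<in> \<Gamma>" for t using R that by (auto simp: right_kernel_def)
  have ex: "\<exists>t. (s, t) \<in> \<Gamma>" if "s \<in> set A" for s using A(2) that by (metis imageE prod.collapse)
  have main: "cj c \<Gamma> = cong (set A) (set [qone])"
    if c: "c \<in> set perms" and x: "set A \<subseteq> {s. (s, s) \<in> cj c \<Gamma>}" for c
  proof -
    have "right_kernel (cj c \<Gamma>) = set [qone]" using R qconj_one[OF c] by (simp add: right_kernel_cj)
    then show ?thesis using diagonal_cong[OF pgroup_cj[OF \<Gamma> c]] x A unfolding fst_cj by auto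
  qed
  show ?thesis
  proof (cases "A = perms")
    case True
    let ?s = "Q P2 P3 P4 P1" and ?s' = "Q P2 P1 P3 P4"
    have "?s \<in> set A" "?s' \<in> set A" by (simp_all add: True perms_def)
    then obtain t t' where t: "(?s, t) \<in> \<Gamma>" and t': "(?s', t') \<in> \<Gamma>" using ex by blast
    note m = g(4)[OF t t] and m' = g(4)[OF t t']
    \<comment> \<open>The images t, t' satisfy the relations of the standard generators because the
      right kernel is trivial; the trivial left kernel keeps t t and t' from collapsing to the
      identity.\<close>
    have "mul t t \<noteq> qone" using m n1[of "mul ?s ?s"] by (auto simp: mul.simps)
    moreover have "mul (mul t t) (mul t t) = qone"
      using g(4)[OF m m] n2[of "mul (mul t t) (mul t t)"] by (simp add: mul.simps)
    moreover have "t' \<noteq> qone" using t' n1[of ?s'] by auto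
    moreover have "mul t' t' = qone"
      using g(4)[OF t' t'] n2[of "mul t' t'"] by (simp add: mul.simps)
    moreover have "mul (mul t t') (mul (mul t t') (mul t t')) = qone"
      using g(4)[OF m' g(4)[OF m' m']] n2[of "mul (mul t t') (mul (mul t t') (mul t t'))"]
      by (simp add: mul.simps)
    ultimately obtain c where c: "c \<in> set perms" "qconj c t = ?s" "qconj c t' = ?s'"
      using perms_generators[of t t'] g(2)[OF t] g(2)[OF t'] by blast
    have "set A \<subseteq> {s. (s, s) \<in> cj c \<Gamma>}"
      using generating_patterns(3)[OF qsubgroup_diagonal[OF pgroup_cj[OF \<Gamma> c(1)]]]
        cj_mem[OF t, of c] cj_mem[OF t', of c] c True by auto
    then show ?thesis using main[OF c(1)] c(1) by blast
  next
    case False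
    then have A': "A = alts" using A by simp
    let ?s = "Q P2 P3 P1 P4" and ?s' = "Q P2 P1 P4 P3"
    have "?s \<in> set A" "?s' \<in> set A" by (simp_all add: A' alts_def)
    then obtain t t' where t: "(?s, t) \<in> \<Gamma>" and t': "(?s', t') \<in> \<Gamma>" using ex by blast
    have "t \<noteq> qone" using t n1[of ?s] by auto
    moreover have "mul t (mul t t) = qone"
      using g(4)[OF t g(4)[OF t t]] n2[of "mul t (mul t t)"]
      by (simp add: mul.simps)
    moreover have "t' \<noteq> qone" using t' n1[of ?s'] by auto
    moreover have "mul t' t' = qone"
      using g(4)[OF t' t'] n2[of "mul t' t'"] by (simp add: mul.simps)
    ultimately obtain c where c: "c \<in> set perms" "qconj c t = ?s" "qconj c t' = ?s'"
      using alts_generators[of t t'] tA[OF t] tA[OF t'] A' by blast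
    have "set A \<subseteq> {s. (s, s) \<in> cj c \<Gamma>}"
      using generating_patterns(1)[OF qsubgroup_diagonal[OF pgroup_cj[OF \<Gamma> c(1)]]]
        cj_mem[OF t, of c] cj_mem[OF t', of c] c A' by auto
    then show ?thesis using main[OF c(1)] c(1) by blast
  qed
qed

text \<open>Each t has a partner s of the parity prescribed by E, and multiplying such pairs makes E
  multiplicative. An odd first component keeps E from being all of B.\<close>

lemma fib_index_two:
  assumes \<Gamma>: "pgroup \<Gamma>" and eq: "\<Gamma> = fib (set B) E" and "fst ` \<Gamma> = set perms"
  shows "index_two E B"
proof -
  have "list_all (\<lambda>p. list_all (\<lambda>q. mul p q \<in> E \<longleftrightarrow> (p \<in> E \<longleftrightarrow> q \<in> E)) B) B"
    unfolding list_all_iff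
  proof (intro ballI)
    fix t t' assume t: "t \<in> set B" "t' \<in> set B"
    have "\<exists>s\<in>set perms. qeven s \<longleftrightarrow> x" for x by (cases x) (simp_all add: qeven_def perms_def alts_def)
    then obtain s s' where s: "s \<in> set perms" "qeven s \<longleftrightarrow> t \<in> E" "s' \<in> set perms" "qeven s' \<longleftrightarrow> t' \<in> E"
      by metis
    then have "(s, t) \<in> \<Gamma>" "(s', t') \<in> \<Gamma>" using t eq by (auto simp: fib_def)
    from pgroupD(4)[OF \<Gamma> this] have "qeven (mul s s') \<longleftrightarrow> mul t t' \<in> E" using eq by (auto simp: fib_def)
    then show "mul t t' \<in> E \<longleftrightarrow> (t \<in> E \<longleftrightarrow> t' \<in> E)" using qeven_mul s by auto
  qed
  moreover have "list_ex (\<lambda>p. p \<notin> E) B"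
  proof -
    have "Q P2 P1 P3 P4 \<in> fst ` \<Gamma>" using assms(3) by (simp add: perms_def)
    moreover have "\<not> qeven (Q P2 P1 P3 P4)" by (simp add: qeven_def alts_def)
    ultimately show ?thesis unfolding eq by (auto simp: fib_def list_ex_iff)
  qed
  ultimately show ?thesis by (simp add: index_two_def)
qed

lemma cj_fib: "c \<in> set perms \<Longrightarrow> cj c (fib P E) = fib (qconj c ` P) (qconj c ` E)"
  using qconj_inj[of c] by (force simp: cj_def fib_def image_iff)

text \<open>Only for the four-group is a further relabelling needed: its three subgroups of order
  two are conjugate under S4, which normalizes the four-group.\<close>

lemma alternating_standard:
  assumes \<Gamma>: "pgroup \<Gamma>" and A: "fst ` \<Gamma> = set perms"
    and B: "B \<in> {perms, alts, klein, dih1, cyc1}" "snd ` \<Gamma> = set B"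
    and N: "left_kernel \<Gamma> = set alts"
  shows "\<exists>c\<in>set perms. standard (cj c \<Gamma>)"
proof -
  define E where "E = right_kernel \<Gamma>"
  have eq: "\<Gamma> = fib (set B) E" using alternating_left_kernel[OF \<Gamma> N A] B by (simp add: E_def)
  have i: "index_two E B" using fib_index_two[OF \<Gamma> eq A] .
  have EB: "E \<subseteq> set B" using B by (force simp: E_def right_kernel_def)
  have pat: "E = set H" if "pattern_in B E H" "set H \<subseteq> set B" for H
    using that EB by (auto simp: pattern_in_def list_all_iff memb_iff)
  have sub: "set cyc1 \<subseteq> set dih1" "set klein \<subseteq> set dih1" "set klein2 \<subseteq> set dih1"
    "set alts \<subseteq> set perms" "set two1 \<subseteq> set cyc1" "set two1 \<subseteq> set klein"
    using list_subsets by auto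
  have std: "\<exists>c\<in>set perms. standard (cj c \<Gamma>)" if "\<Gamma> = fib (set B) (set H)"
    "(B, H) \<in> {(perms, alts), (dih1, cyc1), (dih1, klein), (dih1, klein2), (cyc1, two1), (klein, two1)}" for H
    using standard_fib[OF that(2)] that(1) perms_one by (intro bexI[of _ qone]) (simp_all only: cj_one)
  consider "B = perms" | "B = dih1" | "B = cyc1" | "B = klein" using B i index_two_patterns(2) by auto
  then show ?thesis
  proof cases
    case 1
    then show ?thesis using pat index_two_patterns(1) i sub eq by (intro std[of alts]) auto
  next
    case 2
    then have "E = set cyc1 \<or> E = set klein \<or> E = set klein2"
      using pat index_two_patterns(3) i sub unfolding list_ex_Cons_iff list_ex_Nil_iff by blast
    then show ?thesis using std[of cyc1] std[of klein] std[of klein2] eq 2 by auto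
  next
    case 3
    then show ?thesis using pat index_two_patterns(4) i sub eq by (intro std[of two1]) auto
  next
    case 4
    let ?a = "Q P1 P3 P2 P4" and ?b = "Q P1 P4 P3 P2"
    have p: "?a \<in> set perms" "?b \<in> set perms" by (simp_all add: perms_def)
    have two: "qconj ?a ` set two1 \<subseteq> set klein" "qconj ?b ` set two1 \<subseteq> set klein"
      using sub klein_conj[OF p(1)] klein_conj[OF p(2)] by blast+
    have inv: "qconj c ` qconj c ` Y = Y" if "c \<in> {?a, ?b}" for c Y
    proof -
      have "mul c c = qone" "c \<in> set perms" using that p by (auto simp: mul.simps)
      then show ?thesis by (simp add: image_image qconj_qconj qconj_by_one)
    qed
    have "E = set two1 \<or> E = qconj ?a ` set two1 \<or> E = qconj ?b ` set two1"
      using pat[of two1] pat[of "map (qconj ?a) two1"] pat[of "map (qconj ?b) two1"]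
        index_two_patterns(5)[of E] i sub two 4 by auto
    moreover have ?thesis if "E = qconj c ` set two1" "c \<in> {?a, ?b}" for c
    proof -
      have c: "c \<in> set perms" using that p by auto
      have "cj c \<Gamma> = fib (set klein) (set two1)"
        unfolding eq cj_fib[OF c] 4 that(1) inv[OF that(2)] klein_conj[OF c] ..
      then show ?thesis using c standard_fib[of klein two1] by (intro bexI[of _ c]) simp_all
    qed
    ultimately show ?thesis using std[of two1] eq 4 by auto
  qed
qed

theorem standard_form:
  assumes \<Gamma>: "pgroup \<Gamma>" and A: "A \<in> {perms, alts}" "fst ` \<Gamma> = set A"
    and tr: "\<And>x. \<exists>p\<in>snd ` \<Gamma>. app p P1 = x" and le: "card (snd ` \<Gamma>) \<le> card (fst ` \<Gamma>)"
  shows "\<exists>c\<in>set perms. standard (cj c \<Gamma>)"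
proof -
  obtain d B where d: "d \<in> set perms" and B: "B \<in> {perms, alts, klein, dih1, cyc1}" "snd ` cj d \<Gamma> = set B"
    using transitive_cases[OF \<Gamma> tr] .
  define \<Delta> where "\<Delta> = cj d \<Gamma>"
  have \<Delta>: "pgroup \<Delta>" "fst ` \<Delta> = set A" "snd ` \<Delta> = set B"
    using pgroup_cj[OF \<Gamma> d] A B by (simp_all add: \<Delta>_def fst_cj)
  have "card (snd ` \<Delta>) = card (snd ` \<Gamma>)"
    using qconj_inj[OF d] unfolding \<Delta>_def snd_cj by (intro card_image inj_onI) auto
  then have le': "card (set B) \<le> card (set A)" using le A \<Delta> by simp
  have N: "qsubgroup (left_kernel \<Delta>)" using qsubgroup_left_kernel[OF \<Delta>(1)] .
  have "qconj c p \<in> left_kernel \<Delta>" if "c \<in> set alts" "p \<in> left_kernel \<Delta>" for c p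
    using that A \<Delta> list_subsets(1) by (intro normal_left_kernel[OF \<Delta>(1)]) auto
  from normal_patterns[OF N this]
  have "left_kernel \<Delta> \<in> {set [qone], set klein, set alts, set perms}"
    using pattern_eq[of "left_kernel \<Delta>"] N list_subsets(1,2) perms_one
    unfolding qsubgroup_def list_ex_Cons_iff list_ex_Nil_iff by auto
  moreover have "left_kernel \<Delta> \<subseteq> set A" using \<Delta>(2) by (force simp: left_kernel_def)
  moreover have "\<not> set perms \<subseteq> set alts" by (simp add: perms_def alts_def)
  \<comment> \<open>A kernel equal to A4 is the full first projection when A is A4, so it forms a
    case of its own only for S4.\<close>
  ultimately consider "left_kernel \<Delta> = set A" | "A = perms" "left_kernel \<Delta> = set alts"
    | "left_kernel \<Delta> = set klein" | "left_kernel \<Delta> = set [qone]"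
    using A(1) by auto
  then have "\<exists>c\<in>set perms. standard (cj c \<Delta>)"
  proof cases
    case 1
    then have "\<Delta> = set A \<times> set B" using full_left_kernel[OF \<Delta>(1)] \<Delta> by simp
    \<comment> \<open>The bound on the orders rules out A4 x S4.\<close>
    moreover have "\<not> (A = alts \<and> B = perms)" using le' group_cards by auto
    ultimately have "standard \<Delta>" using standard_times[OF A(1) B(1)] by blast
    then show ?thesis using perms_one by (intro bexI[of _ qone]) (simp_all only: cj_one)
  next
    case 2
    then show ?thesis using alternating_standard[OF \<Delta>(1) _ B(1) \<Delta>(3)] \<Delta>(2) by simp
  next
    case 3
    then show ?thesis using klein_left_kernel[OF \<Delta>(1) A(1) \<Delta>(2) B(1) \<Delta>(3)] A(1)
      unfolding standard_def by blast
  next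
    case 4
    then show ?thesis using trivial_left_kernel[OF \<Delta>(1) A(1) \<Delta>(2) B(1) \<Delta>(3) 4 le'] A(1)
      unfolding standard_def by blast
  qed
  then obtain c where "c \<in> set perms" "standard (cj (mul c d) \<Gamma>)"
    using cj_cj[OF _ d] by (auto simp: \<Delta>_def)
  then show ?thesis using perms_mul[OF _ d] by blast
qed

section \<open>Orbits on bijections\<close>

definition orb :: "(quad \<times> quad) set \<Rightarrow> quad \<Rightarrow> quad set" where
  "orb \<Gamma> \<phi> = (\<lambda>(s, t). mul (mul t \<phi>) (qinv s)) ` \<Gamma>"

definition dtype :: "(quad \<times> quad) set \<Rightarrow> nat multiset" where
  "dtype \<Gamma> = image_mset card (mset_set (orb \<Gamma> ` set perms))"

lemma orb_perms: "pgroup \<Gamma> \<Longrightarrow> \<phi> \<in> set perms \<Longrightarrow> orb \<Gamma> \<phi> \<subseteq> set perms"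
  using pgroupD(1,2)[of \<Gamma>] perms_inv by (auto simp: orb_def intro!: perms_mul)

lemma orb_trans:
  assumes \<Gamma>: "pgroup \<Gamma>" and "\<psi> \<in> orb \<Gamma> \<phi>" shows "orb \<Gamma> \<psi> \<subseteq> orb \<Gamma> \<phi>"
proof
  note g = pgroupD[OF \<Gamma>]
  obtain s t where st: "(s, t) \<in> \<Gamma>" "\<psi> = mul (mul t \<phi>) (qinv s)" using assms(2) by (auto simp: orb_def)
  fix \<chi> assume "\<chi> \<in> orb \<Gamma> \<psi>"
  then obtain s' t' where st': "(s', t') \<in> \<Gamma>" "\<chi> = mul (mul t' \<psi>) (qinv s')" by (auto simp: orb_def)
  have "\<chi> = mul (mul (mul t' t) \<phi>) (qinv (mul s' s))"
    unfolding st'(2) st(2) qinv_mul[OF g(1)[OF st'(1)] g(1)[OF st(1)]] by (simp only: mul_assoc)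
  then show "\<chi> \<in> orb \<Gamma> \<phi>"
    using g(4)[OF st'(1) st(1)] unfolding orb_def by force
qed

lemma orb_sym:
  assumes \<Gamma>: "pgroup \<Gamma>" and "\<psi> \<in> orb \<Gamma> \<phi>" shows "\<phi> \<in> orb \<Gamma> \<psi>"
proof -
  note g = pgroupD[OF \<Gamma>]
  obtain s t where st: "(s, t) \<in> \<Gamma>" "\<psi> = mul (mul t \<phi>) (qinv s)" using assms(2) by (auto simp: orb_def)
  have "qinv (qinv s) = s"
    using perms_inv[OF g(1)[OF st(1)]] by (intro qinv_unique) auto
  then have "\<phi> = mul (mul (qinv t) \<psi>) (qinv (qinv s))"
    using g(1,2)[OF st(1)] mul_cancel perms_inv[OF g(1)[OF st(1)]] unfolding st(2)
    by (simp add: mul_assoc mul_one)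
  then show ?thesis using g(5)[OF st(1)] unfolding orb_def by force
qed

lemma orb_eq: "pgroup \<Gamma> \<Longrightarrow> \<psi> \<in> orb \<Gamma> \<phi> \<Longrightarrow> orb \<Gamma> \<psi> = orb \<Gamma> \<phi>"
  using orb_trans orb_sym by blast

text \<open>A certificate for the decomposition type: lists that partition S4, each being the orbit
  of its first entry. Checking the first entries suffices, since all members of an orbit have the
  same orbit.\<close>

lemma dtype_partition:
  assumes \<Gamma>: "pgroup \<Gamma>" and B: "\<And>B. B \<in> set Os \<Longrightarrow> B \<noteq> [] \<and> orb \<Gamma> (hd B) = set B"
    and d: "distinct (concat Os)" "set (concat Os) = set perms"
  shows "dtype \<Gamma> = mset (map length Os)"
proof -
  have orb: "orb \<Gamma> \<phi> = set B" if "B \<in> set Os" "\<phi> \<in> set B" for B \<phi>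
    using B[OF that(1)] orb_eq[OF \<Gamma>, of \<phi> "hd B"] that by simp
  have "orb \<Gamma> ` set perms = set (map set Os)"
  proof safe
    fix \<phi> assume "\<phi> \<in> set perms"
    then obtain B where "B \<in> set Os" "\<phi> \<in> set B" using d(2) by auto
    then show "orb \<Gamma> \<phi> \<in> set (map set Os)" using orb by auto
  next
    fix Y assume "Y \<in> set (map set Os)"
    then obtain B where B1: "B \<in> set Os" "Y = set B" by auto
    then have "hd B \<in> set B" using B by auto
    moreover then have "hd B \<in> set perms" using d(2) B1 by auto
    ultimately show "Y \<in> orb \<Gamma> ` set perms" using orb B1 by blast
  qed
  moreover have "distinct (map set Os)"
    using d(1) B by (induction Os) (auto simp: disjoint_iff, metis list.set_sel(1))
  ultimately have "mset_set (orb \<Gamma> ` set perms) = mset (map set Os)"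
    by (simp only: mset_set_set)
  moreover have "map card (map set Os) = map length Os"
    using d(1) by (induction Os) (auto simp: distinct_card)
  ultimately show ?thesis unfolding dtype_def by (metis mset_map)
qed

section \<open>Orbits when the group contains A4 x 1\<close>

definition odds :: "quad list" where "odds = filter (\<lambda>p. \<not> memb p alts) perms"

lemma set_odds: "set odds = {p \<in> set perms. \<not> qeven p}"
  by (auto simp: odds_def memb_iff qeven_def)

lemma qeven_inv: "p \<in> set perms \<Longrightarrow> qeven (qinv p) \<longleftrightarrow> qeven p"
  using qeven_mul[of p "qinv p"] perms_inv[of p] by (auto simp: qeven_def alts_def)

lemma dtype_alternating:
  assumes \<Gamma>: "pgroup \<Gamma>" and a: "\<And>a. a \<in> set alts \<Longrightarrow> (a, qone) \<in> \<Gamma>"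
  shows "(\<exists>(s, t)\<in>\<Gamma>. qeven s \<noteq> qeven t) \<Longrightarrow> dtype \<Gamma> = {#24#}"
    and "(\<forall>(s, t)\<in>\<Gamma>. qeven s = qeven t) \<Longrightarrow> dtype \<Gamma> = {#12, 12#}"
proof -
  note g = pgroupD[OF \<Gamma>]
  have same: "\<psi> \<in> orb \<Gamma> \<phi>" if p: "\<phi> \<in> set perms" "\<psi> \<in> set perms" "qeven \<psi> = qeven \<phi>" for \<phi> \<psi>
  proof -
    note i = perms_inv[OF p(1)] perms_inv[OF p(2)]
    \<comment> \<open>The pair (\<psi>^-1 \<phi>, 1) carries \<phi> to \<psi>; it lies in \<Gamma>
      because its first component is even.\<close>
    have "qeven (mul (qinv \<psi>) \<phi>)" using qeven_mul[of "qinv \<psi>" \<phi>] i p qeven_inv by simp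
    then have "(mul (qinv \<psi>) \<phi>, qone) \<in> \<Gamma>" using a by (simp add: qeven_def)
    moreover have "qinv (mul (qinv \<psi>) \<phi>) = mul (qinv \<phi>) \<psi>"
      using i p by (intro qinv_unique perms_mul) (simp_all add: mul_assoc mul_cancel)
    moreover have "mul (mul qone \<phi>) (mul (qinv \<phi>) \<psi>) = \<psi>" using p by (simp add: mul_one mul_cancel)
    ultimately show ?thesis unfolding orb_def by (metis (mono_tags, lifting) case_prod_conv image_eqI)
  qed
  have parity: "qeven (mul (mul t \<phi>) (qinv s)) \<longleftrightarrow> (qeven \<phi> \<longleftrightarrow> (qeven s \<longleftrightarrow> qeven t))"
    if "(s, t) \<in> \<Gamma>" "\<phi> \<in> set perms" for s t \<phi>
    using g(1,2)[OF that(1)] that(2) perms_inv[of s] qeven_inv[of s]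
    by (auto simp: qeven_mul perms_mul)
  have len: "length perms = 24" "length alts = 12" "length odds = 12" "distinct perms"
    "distinct (concat [alts, odds])"
    by (simp_all add: perms_def alts_def odds_def)
  { assume "\<exists>(s, t)\<in>\<Gamma>. qeven s \<noteq> qeven t"
    then obtain s t where st: "(s, t) \<in> \<Gamma>" "qeven s \<noteq> qeven t" by auto
    have "set perms \<subseteq> orb \<Gamma> (hd perms)"
    proof
      fix \<psi> assume \<psi>: "\<psi> \<in> set perms"
      have h: "hd perms \<in> set perms" using len by (intro hd_in_set) auto
      let ?\<chi> = "mul (mul t (hd perms)) (qinv s)"
      have \<chi>: "?\<chi> \<in> orb \<Gamma> (hd perms)" using st unfolding orb_def by force
      then have \<chi>': "?\<chi> \<in> set perms" using orb_perms[OF \<Gamma> h] by auto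
      show "\<psi> \<in> orb \<Gamma> (hd perms)"
      proof (cases "qeven \<psi> = qeven (hd perms)")
        case True
        then show ?thesis using same h \<psi> by simp
      next
        case False
        then have "\<psi> \<in> orb \<Gamma> ?\<chi>" using same[OF \<chi>' \<psi>] parity[OF st(1) h] st(2) by auto
        then show ?thesis using orb_eq[OF \<Gamma> \<chi>] by simp
      qed
    qed
    moreover have "hd perms \<in> set perms" by (simp add: perms_def)
    ultimately have "orb \<Gamma> (hd perms) = set perms" using orb_perms[OF \<Gamma>, of "hd perms"] by blast
    moreover have "perms \<noteq> []" by (simp add: perms_def)
    ultimately show "dtype \<Gamma> = {#24#}" using dtype_partition[OF \<Gamma>, of "[perms]"] len by auto }
  { assume e: "\<forall>(s, t)\<in>\<Gamma>. qeven s = qeven t"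
    have o: "orb \<Gamma> \<phi> = {\<psi> \<in> set perms. qeven \<psi> = qeven \<phi>}" if "\<phi> \<in> set perms" for \<phi>
      using same[OF that] orb_perms[OF \<Gamma> that] parity[OF _ that] e by (auto simp: orb_def)
    have h: "hd alts \<in> set perms" "qeven (hd alts)" "hd odds \<in> set perms" "\<not> qeven (hd odds)"
      by (simp_all add: alts_def odds_def perms_def qeven_def)
    have "{\<psi> \<in> set perms. qeven \<psi>} = set alts" using list_subsets(1) by (auto simp: qeven_def)
    then have "orb \<Gamma> (hd alts) = set alts" "orb \<Gamma> (hd odds) = set odds" using o h set_odds by auto
    moreover have "alts \<noteq> []" "odds \<noteq> []" using len by auto
    ultimately have "B \<noteq> [] \<and> orb \<Gamma> (hd B) = set B" if "B \<in> set [alts, odds]" for B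
      using that by (cases "B = alts") simp_all
    moreover have "set (concat [alts, odds]) = set perms"
      using list_subsets(1) set_odds by (auto simp: qeven_def)
    ultimately show "dtype \<Gamma> = {#12, 12#}"
      using dtype_partition[OF \<Gamma>, of "[alts, odds]"] len by simp }
qed

text \<open>Modulo V4 the action becomes conjugation on S3, so these are the preimages of its
  classes of transpositions, of 3-cycles and of the identity, each enlarged by the factor 4.\<close>

definition orbits_perms_klein :: "quad list list" where
  "orbits_perms_klein =
    [[Q P1 P2 P4 P3, Q P1 P3 P2 P4, Q P1 P4 P3 P2, Q P2 P1 P3 P4, Q P2 P3 P4 P1, Q P2 P4 P1 P3,
      Q P3 P1 P4 P2, Q P3 P2 P1 P4, Q P3 P4 P2 P1, Q P4 P1 P2 P3, Q P4 P2 P3 P1, Q P4 P3 P1 P2],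
     [Q P1 P3 P4 P2, Q P1 P4 P2 P3, Q P2 P3 P1 P4, Q P2 P4 P3 P1, Q P3 P1 P2 P4, Q P3 P2 P4 P1,
      Q P4 P1 P3 P2, Q P4 P2 P1 P3],
     [Q P1 P2 P3 P4, Q P2 P1 P4 P3, Q P3 P4 P1 P2, Q P4 P3 P2 P1]]"

text \<open>Modulo V4, C3 acts by conjugation on S3: the transpositions still form one orbit, while
  the identity and the two 3-cycles are fixed points.\<close>

definition orbits_alts_klein :: "quad list list" where
  "orbits_alts_klein =
    [[Q P1 P2 P4 P3, Q P1 P3 P2 P4, Q P1 P4 P3 P2, Q P2 P1 P3 P4, Q P2 P3 P4 P1, Q P2 P4 P1 P3,
      Q P3 P1 P4 P2, Q P3 P2 P1 P4, Q P3 P4 P2 P1, Q P4 P1 P2 P3, Q P4 P2 P3 P1, Q P4 P3 P1 P2],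
     [Q P1 P2 P3 P4, Q P2 P1 P4 P3, Q P3 P4 P1 P2, Q P4 P3 P2 P1],
     [Q P1 P3 P4 P2, Q P2 P4 P3 P1, Q P3 P1 P2 P4, Q P4 P2 P1 P3],
     [Q P1 P4 P2 P3, Q P2 P3 P1 P4, Q P3 P2 P4 P1, Q P4 P1 P3 P2]]"

text \<open>The diagonal acts by conjugation, so these are the conjugacy classes of S4: 3-cycles,
  transpositions, 4-cycles, double transpositions, identity.\<close>

definition orbits_perms_one :: "quad list list" where
  "orbits_perms_one =
    [[Q P1 P3 P4 P2, Q P1 P4 P2 P3, Q P2 P3 P1 P4, Q P2 P4 P3 P1, Q P3 P1 P2 P4, Q P3 P2 P4 P1,
      Q P4 P1 P3 P2, Q P4 P2 P1 P3],
     [Q P1 P2 P4 P3, Q P1 P3 P2 P4, Q P1 P4 P3 P2, Q P2 P1 P3 P4, Q P3 P2 P1 P4, Q P4 P2 P3 P1],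
     [Q P2 P3 P4 P1, Q P2 P4 P1 P3, Q P3 P1 P4 P2, Q P3 P4 P2 P1, Q P4 P1 P2 P3, Q P4 P3 P1 P2],
     [Q P2 P1 P4 P3, Q P3 P4 P1 P2, Q P4 P3 P2 P1],
     [Q P1 P2 P3 P4]]"

text \<open>The same classes under conjugation by A4. The 3-cycles split in two, because their
  centralizers contain only even permutations; the other classes remain whole.\<close>

definition orbits_alts_one :: "quad list list" where
  "orbits_alts_one =
    [[Q P1 P2 P4 P3, Q P1 P3 P2 P4, Q P1 P4 P3 P2, Q P2 P1 P3 P4, Q P3 P2 P1 P4, Q P4 P2 P3 P1],
     [Q P2 P3 P4 P1, Q P2 P4 P1 P3, Q P3 P1 P4 P2, Q P3 P4 P2 P1, Q P4 P1 P2 P3, Q P4 P3 P1 P2],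
     [Q P1 P3 P4 P2, Q P2 P4 P3 P1, Q P3 P1 P2 P4, Q P4 P2 P1 P3],
     [Q P1 P4 P2 P3, Q P2 P3 P1 P4, Q P3 P2 P4 P1, Q P4 P1 P3 P2],
     [Q P2 P1 P4 P3, Q P3 P4 P1 P2, Q P4 P3 P2 P1],
     [Q P1 P2 P3 P4]]"

text \<open>Lists the elements s v \<phi> s^-1 for a fixed s, which is matched on its components so
  that only literal quads are expanded.\<close>

fun twist :: "quad \<Rightarrow> quad \<Rightarrow> quad list \<Rightarrow> quad list" where
  "twist (Q a b c d) \<phi> [] = []"
| "twist (Q a b c d) \<phi> (v # vs) =
     mul (mul (mul (Q a b c d) v) \<phi>) (qinv (Q a b c d)) # twist (Q a b c d) \<phi> vs"

fun twists :: "quad list \<Rightarrow> quad \<Rightarrow> quad list \<Rightarrow> quad list" where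
  "twists [] \<phi> vs = []"
| "twists (s # ss) \<phi> vs = twist s \<phi> vs @ twists ss \<phi> vs"

fun contained :: "quad list \<Rightarrow> quad list \<Rightarrow> bool" where
  "contained [] ys \<longleftrightarrow> True"
| "contained (x # xs) ys \<longleftrightarrow> (if memb x ys then contained xs ys else False)"

fun orbit_ok :: "quad list \<Rightarrow> quad list \<Rightarrow> quad list \<Rightarrow> bool" where
  "orbit_ok A N [] \<longleftrightarrow> False"
| "orbit_ok A N (x # xs) \<longleftrightarrow>
     contained (twists A x N) (x # xs) \<and> contained (x # xs) (twists A x N)"

lemma contained_iff: "contained xs ys \<longleftrightarrow> set xs \<subseteq> set ys"
  by (induction xs) (auto simp: memb_iff)

lemma set_twists: "set (twists A \<phi> N) = {mul (mul (mul s v) \<phi>) (qinv s) | s v. s \<in> set A \<and> v \<in> set N}"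
proof -
  have "set (twist s \<phi> vs) = {mul (mul (mul s v) \<phi>) (qinv s) | v. v \<in> set vs}" for s vs
    by (induction s \<phi> vs rule: twist.induct) auto
  then show ?thesis by (induction A) auto
qed

lemma cong_eq:
  assumes "set A \<subseteq> set perms" "set N \<subseteq> set perms"
  shows "cong (set A) (set N) = {(s, mul s v) | s v. s \<in> set A \<and> v \<in> set N}"
proof -
  have "t \<in> set perms \<and> mul (qinv s) t \<in> set N \<longleftrightarrow> (\<exists>v\<in>set N. t = mul s v)" if "s \<in> set A" for s t
    using that assms mul_cancel[of s] perms_mul[of s] by (metis subsetD)
  then show ?thesis by (intro subset_antisym subrelI) (simp add: cong_def; blast)+
qed

lemma dtype_cong:
  assumes "pgroup (cong (set A) (set N))" "set A \<subseteq> set perms" "set N \<subseteq> set perms"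
    "list_all (orbit_ok A N) Os" "distinct (concat Os)" "set (concat Os) = set perms"
  shows "dtype (cong (set A) (set N)) = mset (map length Os)"
proof (rule dtype_partition[OF assms(1) _ assms(5,6)])
  fix B assume "B \<in> set Os"
  then have "orbit_ok A N B" using assms(4) by (simp add: list_all_iff)
  then have "B \<noteq> []" "set (twists A (hd B) N) = set B" by (cases B; simp add: contained_iff; blast)+
  moreover have "orb (cong (set A) (set N)) (hd B) = set (twists A (hd B) N)"
    unfolding cong_eq[OF assms(2,3)] set_twists orb_def by force
  ultimately show "B \<noteq> [] \<and> orb (cong (set A) (set N)) (hd B) = set B" by simp
qed

lemma dtype_standard_cong:
  "pgroup (cong (set perms) (set klein)) \<Longrightarrow> dtype (cong (set perms) (set klein)) = {#12, 8, 4#}"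
  "pgroup (cong (set alts) (set klein)) \<Longrightarrow> dtype (cong (set alts) (set klein)) = {#12, 4, 4, 4#}"
  "pgroup (cong (set perms) (set [qone])) \<Longrightarrow> dtype (cong (set perms) (set [qone])) = {#8, 6, 6, 3, 1#}"
  "pgroup (cong (set alts) (set [qone])) \<Longrightarrow> dtype (cong (set alts) (set [qone])) = {#6, 6, 4, 4, 3, 1#}"
proof -
  have sub: "set alts \<subseteq> set perms" "set klein \<subseteq> set perms" "set [qone] \<subseteq> set perms" "set perms \<subseteq> set perms"
    using list_subsets perms_one by auto
  have perms_klein: "list_all (orbit_ok perms klein) orbits_perms_klein" by code_simp
  have alts_klein: "list_all (orbit_ok alts klein) orbits_alts_klein" by code_simp
  have perms_one: "list_all (orbit_ok perms [qone]) orbits_perms_one" by code_simp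
  have alts_one: "list_all (orbit_ok alts [qone]) orbits_alts_one" by code_simp
  have "distinct (concat orbits_perms_klein)" "set (concat orbits_perms_klein) = set perms"
    "mset (map length orbits_perms_klein) = {#12, 8, 4#}"
    by (simp_all add: orbits_perms_klein_def perms_def insert_commute numeral_eq_Suc)
  then show "pgroup (cong (set perms) (set klein)) \<Longrightarrow> dtype (cong (set perms) (set klein)) = {#12, 8, 4#}"
    using dtype_cong[OF _ sub(4,2) perms_klein] by simp
  have "distinct (concat orbits_alts_klein)" "set (concat orbits_alts_klein) = set perms"
    "mset (map length orbits_alts_klein) = {#12, 4, 4, 4#}"
    by (simp_all add: orbits_alts_klein_def perms_def insert_commute numeral_eq_Suc)
  then show "pgroup (cong (set alts) (set klein)) \<Longrightarrow> dtype (cong (set alts) (set klein)) = {#12, 4, 4, 4#}"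
    using dtype_cong[OF _ sub(1,2) alts_klein] by simp
  have "distinct (concat orbits_perms_one)" "set (concat orbits_perms_one) = set perms"
    "mset (map length orbits_perms_one) = {#8, 6, 6, 3, 1#}"
    by (simp_all add: orbits_perms_one_def perms_def insert_commute numeral_eq_Suc)
  then show "pgroup (cong (set perms) (set [qone])) \<Longrightarrow> dtype (cong (set perms) (set [qone])) = {#8, 6, 6, 3, 1#}"
    using dtype_cong[OF _ sub(4,3) perms_one] by simp
  have "distinct (concat orbits_alts_one)" "set (concat orbits_alts_one) = set perms"
    "mset (map length orbits_alts_one) = {#6, 6, 4, 4, 3, 1#}"
    by (simp_all add: orbits_alts_one_def perms_def insert_commute numeral_eq_Suc)
  then show "pgroup (cong (set alts) (set [qone])) \<Longrightarrow> dtype (cong (set alts) (set [qone])) = {#6, 6, 4, 4, 3, 1#}"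
    using dtype_cong[OF _ sub(1,3) alts_one] by simp
qed

section \<open>Isomorphisms with the groups of the table\<close>

definition qgrp :: "quad set \<Rightarrow> quad monoid" where
  "qgrp H = \<lparr>carrier = H, monoid.mult = mul, one = qone\<rparr>"

definition pgrp :: "(quad \<times> quad) set \<Rightarrow> (quad \<times> quad) monoid" where
  "pgrp \<Gamma> = \<lparr>carrier = \<Gamma>, monoid.mult = (\<lambda>(s, t) (s', t'). (mul s s', mul t t')), one = (qone, qone)\<rparr>"

lemma qgrp_simps [simp]: "carrier (qgrp H) = H" "x \<otimes>\<^bsub>qgrp H\<^esub> y = mul x y" "\<one>\<^bsub>qgrp H\<^esub> = qone"
  by (simp_all add: qgrp_def)

lemma pgrp_simps [simp]: "carrier (pgrp \<Gamma>) = \<Gamma>" "(s, t) \<otimes>\<^bsub>pgrp \<Gamma>\<^esub> (s', t') = (mul s s', mul t t')"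
  "\<one>\<^bsub>pgrp \<Gamma>\<^esub> = (qone, qone)"
  by (simp_all add: pgrp_def)

lemma pgrp_mult: "x \<otimes>\<^bsub>pgrp \<Gamma>\<^esub> y = (mul (fst x) (fst y), mul (snd x) (snd y))"
  by (cases x; cases y) simp

lemma group_qgrp:
  assumes "qsubgroup H" shows "group (qgrp H)"
proof (rule groupI)
  fix x assume "x \<in> carrier (qgrp H)"
  then have "qinv x \<in> H" "mul (qinv x) x = qone" using assms perms_inv[of x] by (auto simp: qsubgroup_def)
  then show "\<exists>y\<in>carrier (qgrp H). y \<otimes>\<^bsub>qgrp H\<^esub> x = \<one>\<^bsub>qgrp H\<^esub>"
    by auto
qed (use assms in \<open>auto simp: qsubgroup_def mul_assoc mul_one\<close>)

lemma group_pgrp: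
  assumes \<Gamma>: "pgroup \<Gamma>" shows "group (pgrp \<Gamma>)"
proof (rule groupI)
  note g = pgroupD[OF \<Gamma>]
  show "x \<otimes>\<^bsub>pgrp \<Gamma>\<^esub> y \<in> carrier (pgrp \<Gamma>)" if "x \<in> carrier (pgrp \<Gamma>)" "y \<in> carrier (pgrp \<Gamma>)" for x y
    using that g(4) by (cases x; cases y) simp
  show "\<one>\<^bsub>pgrp \<Gamma>\<^esub> \<in> carrier (pgrp \<Gamma>)" using g(3) by simp
  show "\<exists>y\<in>carrier (pgrp \<Gamma>). y \<otimes>\<^bsub>pgrp \<Gamma>\<^esub> x = \<one>\<^bsub>pgrp \<Gamma>\<^esub>" if "x \<in> carrier (pgrp \<Gamma>)" for x
    using that g(1,2,5)[of "fst x" "snd x"] perms_inv by (intro bexI[of _ "(qinv (fst x), qinv (snd x))"]) (auto simp: pgrp_mult)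
qed (auto simp: pgrp_mult mul_assoc mul_one)

lemma pgrp_times: "pgrp (P \<times> R) = qgrp P \<times>\<times> qgrp R"
  by (simp add: pgrp_def qgrp_def DirProd_def)

text \<open>From T only closure under multiplication is used, so the lemma applies to
  \<open>semidirect\<close> before that is known to be a group.\<close>

lemma iso_flip:
  assumes f: "f \<in> hom T G" "bij_betw f (carrier T) (carrier G)"
    and cl: "\<And>x y. x \<in> carrier T \<Longrightarrow> y \<in> carrier T \<Longrightarrow> x \<otimes>\<^bsub>T\<^esub> y \<in> carrier T"
  shows "G \<cong> T"
proof -
  let ?g = "inv_into (carrier T) f"
  have bij: "bij_betw ?g (carrier G) (carrier T)" using f(2) by (rule bij_betw_inv_into)
  have "?g \<in> hom G T"
  proof (rule homI)
    show g: "?g x \<in> carrier T" if "x \<in> carrier G" for x using bij that by (auto simp: bij_betw_def)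
    fix x y assume x: "x \<in> carrier G" and y: "y \<in> carrier G"
    have "f (?g x \<otimes>\<^bsub>T\<^esub> ?g y) = x \<otimes>\<^bsub>G\<^esub> y"
      using f x y g bij_betw_inv_into_right[OF f(2)] by (simp add: hom_def)
    then show "?g (x \<otimes>\<^bsub>G\<^esub> y) = ?g x \<otimes>\<^bsub>T\<^esub> ?g y"
      using bij_betw_inv_into_left[OF f(2) cl[OF g[OF x] g[OF y]]] by simp
  qed
  then show ?thesis using bij by (intro is_isoI isoI)
qed

text \<open>Recognition of an internal semidirect product: i and j embed the factors,
  \<open>tw\<close> says that conjugation by j h acts as \<theta> h, \<open>dis\<close> makes the
  images meet trivially, and equality of orders yields surjectivity.\<close>

lemma semidirect_iso:
  assumes N: "group N" and H: "group H" and G: "group G"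
    and i: "i \<in> hom N G" "inj_on i (carrier N)" and j: "j \<in> hom H G" "inj_on j (carrier H)"
    and tw: "\<And>h n. h \<in> carrier H \<Longrightarrow> n \<in> carrier N \<Longrightarrow> \<theta> h n \<in> carrier N \<and> j h \<otimes>\<^bsub>G\<^esub> i n = i (\<theta> h n) \<otimes>\<^bsub>G\<^esub> j h"
    and dis: "\<And>h n. h \<in> carrier H \<Longrightarrow> n \<in> carrier N \<Longrightarrow> i n = j h \<Longrightarrow> h = \<one>\<^bsub>H\<^esub>"
    and fin: "finite (carrier G)" and card: "card (carrier G) = card (carrier N) * card (carrier H)"
  shows "G \<cong> semidirect N H \<theta>"
proof -
  interpret N: group N by (rule N)
  interpret H: group H by (rule H)
  interpret G: group G by (rule G)
  interpret i: group_hom N G i by unfold_locales (rule i(1))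
  interpret j: group_hom H G j by unfold_locales (rule j(1))
  define f where "f = (\<lambda>(n, h). i n \<otimes>\<^bsub>G\<^esub> j h)"
  have car: "carrier (semidirect N H \<theta>) = carrier N \<times> carrier H" by (simp add: semidirect_def)
  have hom: "f \<in> hom (semidirect N H \<theta>) G"
  proof (rule homI)
    fix x assume "x \<in> carrier (semidirect N H \<theta>)"
    then show "f x \<in> carrier G" by (auto simp: car f_def)
  next
    fix x y assume "x \<in> carrier (semidirect N H \<theta>)" "y \<in> carrier (semidirect N H \<theta>)"
    then obtain n h n' h' where x: "x = (n, h)" "n \<in> carrier N" "h \<in> carrier H"
      and y: "y = (n', h')" "n' \<in> carrier N" "h' \<in> carrier H" by (auto simp: car)
    have "f (x \<otimes>\<^bsub>semidirect N H \<theta>\<^esub> y) = i n \<otimes>\<^bsub>G\<^esub> (i (\<theta> h n') \<otimes>\<^bsub>G\<^esub> j h) \<otimes>\<^bsub>G\<^esub> j h'"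
      using x y tw[OF x(3) y(2)] by (simp add: f_def semidirect_def G.m_assoc)
    also have "\<dots> = i n \<otimes>\<^bsub>G\<^esub> (j h \<otimes>\<^bsub>G\<^esub> i n') \<otimes>\<^bsub>G\<^esub> j h'" using tw[OF x(3) y(2)] by simp
    also have "\<dots> = f x \<otimes>\<^bsub>G\<^esub> f y" using x y by (simp add: f_def G.m_assoc)
    finally show "f (x \<otimes>\<^bsub>semidirect N H \<theta>\<^esub> y) = f x \<otimes>\<^bsub>G\<^esub> f y" .
  qed
  have inj: "inj_on f (carrier N \<times> carrier H)"
  proof (rule inj_onI)
    fix x y assume "x \<in> carrier N \<times> carrier H" "y \<in> carrier N \<times> carrier H" and e: "f x = f y"
    then obtain n h n' h' where x: "x = (n, h)" "n \<in> carrier N" "h \<in> carrier H"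
      and y: "y = (n', h')" "n' \<in> carrier N" "h' \<in> carrier H" by auto
    have "i n \<otimes>\<^bsub>G\<^esub> j h = i n' \<otimes>\<^bsub>G\<^esub> j h'" using e x y by (simp add: f_def)
    then have "i (inv\<^bsub>N\<^esub> n' \<otimes>\<^bsub>N\<^esub> n) = j (h' \<otimes>\<^bsub>H\<^esub> inv\<^bsub>H\<^esub> h)"
      using x y by (simp add: G.inv_solve_left G.inv_solve_right' G.m_assoc G.inv_solve_right)
    then have "h' \<otimes>\<^bsub>H\<^esub> inv\<^bsub>H\<^esub> h = \<one>\<^bsub>H\<^esub>"
      using dis[of "h' \<otimes>\<^bsub>H\<^esub> inv\<^bsub>H\<^esub> h" "inv\<^bsub>N\<^esub> n' \<otimes>\<^bsub>N\<^esub> n"] x y by blast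
    then have "h = h'" using x y by (metis H.inv_closed H.inv_equality H.inv_inv)
    then have "i n = i n'" using e x y by (simp add: f_def)
    then show "x = y" using \<open>h = h'\<close> x y i(2) by (auto dest: inj_onD)
  qed
  have "f ` (carrier N \<times> carrier H) \<subseteq> carrier G" using hom by (auto simp: hom_def car)
  then have "f ` (carrier N \<times> carrier H) = carrier G"
    using card_image[OF inj] card fin by (intro card_subset_eq) (simp_all add: card_cartesian_product)
  then show ?thesis
    using hom inj tw by (intro iso_flip[of f]) (auto simp: car bij_betw_def semidirect_def)
qed

text \<open>The complement is generated by g. Condition \<open>dis\<close> does double duty: applied
  to the identity of N it shows that g has order exactly m.\<close>

lemma semidirect_cyclic_iso:
  assumes N: "group N" and G: "group G" and i: "i \<in> hom N G" "inj_on i (carrier N)"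
    and \<phi>: "\<And>n. n \<in> carrier N \<Longrightarrow> \<phi> n \<in> carrier N \<and> g \<otimes>\<^bsub>G\<^esub> i n = i (\<phi> n) \<otimes>\<^bsub>G\<^esub> g"
    and g: "g \<in> carrier G" "g [^]\<^bsub>G\<^esub> m = \<one>\<^bsub>G\<^esub>" and m: "m > 0"
    and dis: "\<And>k n. 0 < k \<Longrightarrow> k < m \<Longrightarrow> n \<in> carrier N \<Longrightarrow> i n \<noteq> g [^]\<^bsub>G\<^esub> k"
    and fin: "finite (carrier G)" and card: "card (carrier G) = card (carrier N) * m"
  shows "G \<cong> semidirect N (Cyc m) (via_involution \<phi>)"
proof (rule semidirect_iso[OF N _ G i])
  interpret G: group G by (rule G)
  interpret i: group_hom N G i using N G i by (intro group_hom.intro group_hom_axioms.intro)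
  have car: "carrier (Cyc m) = {0..<int m}" using m by (simp add: carrier_integer_mod_group)
  show "group (Cyc m)" by simp
  define j where "j x = g [^]\<^bsub>G\<^esub> nat x" for x
  have pow: "g [^]\<^bsub>G\<^esub> (k mod m) = g [^]\<^bsub>G\<^esub> k" for k
  proof -
    have "g [^]\<^bsub>G\<^esub> k = g [^]\<^bsub>G\<^esub> (m * (k div m) + k mod m)" by simp
    also have "\<dots> = (g [^]\<^bsub>G\<^esub> m) [^]\<^bsub>G\<^esub> (k div m) \<otimes>\<^bsub>G\<^esub> g [^]\<^bsub>G\<^esub> (k mod m)"
      using g(1) by (simp only: G.nat_pow_mult G.nat_pow_pow)
    finally show ?thesis using g by simp
  qed
  show "(\<lambda>x. g [^]\<^bsub>G\<^esub> nat x) \<in> hom (Cyc m) G"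
  proof (rule homI)
    fix x y assume "x \<in> carrier (Cyc m)" "y \<in> carrier (Cyc m)"
    then have "nat ((x + y) mod int m) = (nat x + nat y) mod m"
      by (auto simp: car nat_mod_distrib nat_add_distrib)
    then show "g [^]\<^bsub>G\<^esub> nat (x \<otimes>\<^bsub>Cyc m\<^esub> y) = g [^]\<^bsub>G\<^esub> nat x \<otimes>\<^bsub>G\<^esub> g [^]\<^bsub>G\<^esub> nat y"
      using g(1) pow by (simp add: G.nat_pow_mult)
  qed (use g in auto)
  show "inj_on (\<lambda>x. g [^]\<^bsub>G\<^esub> nat x) (carrier (Cyc m))"
  proof (rule linorder_inj_onI)
    fix x y assume xy: "x < y" "x \<in> carrier (Cyc m)" "y \<in> carrier (Cyc m)"
    define d where "d = nat y - nat x"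
    have d: "nat y = nat x + d" "0 < d" "d < m" using xy by (auto simp: d_def car)
    have "i \<one>\<^bsub>N\<^esub> \<noteq> g [^]\<^bsub>G\<^esub> d"
      using d group.is_monoid[OF N] by (intro dis) (auto intro: monoid.one_closed)
    then have "g [^]\<^bsub>G\<^esub> d \<noteq> \<one>\<^bsub>G\<^esub>" using i.hom_one by metis
    moreover have "g [^]\<^bsub>G\<^esub> nat y = g [^]\<^bsub>G\<^esub> nat x \<otimes>\<^bsub>G\<^esub> g [^]\<^bsub>G\<^esub> d"
      using g(1) d(1) by (simp add: G.nat_pow_mult)
    ultimately show "g [^]\<^bsub>G\<^esub> nat x \<noteq> g [^]\<^bsub>G\<^esub> nat y" using g(1) by auto
  qed (auto simp: car)
  have tw: "(\<phi> ^^ k) n \<in> carrier N \<and> g [^]\<^bsub>G\<^esub> k \<otimes>\<^bsub>G\<^esub> i n = i ((\<phi> ^^ k) n) \<otimes>\<^bsub>G\<^esub> g [^]\<^bsub>G\<^esub> k"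
    if n: "n \<in> carrier N" for k n
  proof (induction k)
    case (Suc k)
    have "g [^]\<^bsub>G\<^esub> Suc k \<otimes>\<^bsub>G\<^esub> i n = g \<otimes>\<^bsub>G\<^esub> (g [^]\<^bsub>G\<^esub> k \<otimes>\<^bsub>G\<^esub> i n)"
      using g(1) n by (simp only: G.nat_pow_Suc2 G.m_assoc G.nat_pow_closed i.hom_closed)
    also have "\<dots> = g \<otimes>\<^bsub>G\<^esub> i ((\<phi> ^^ k) n) \<otimes>\<^bsub>G\<^esub> g [^]\<^bsub>G\<^esub> k"
      using Suc g(1) by (simp add: G.m_assoc)
    also have "\<dots> = i (\<phi> ((\<phi> ^^ k) n)) \<otimes>\<^bsub>G\<^esub> (g \<otimes>\<^bsub>G\<^esub> g [^]\<^bsub>G\<^esub> k)"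
      using Suc \<phi>[of "(\<phi> ^^ k) n"] g(1) by (simp add: G.m_assoc)
    finally show ?case using Suc \<phi>[of "(\<phi> ^^ k) n"] g(1) by (simp only: G.nat_pow_Suc2) simp
  qed (use n g in simp)
  then show "via_involution \<phi> h n \<in> carrier N \<and>
      g [^]\<^bsub>G\<^esub> nat h \<otimes>\<^bsub>G\<^esub> i n = i (via_involution \<phi> h n) \<otimes>\<^bsub>G\<^esub> g [^]\<^bsub>G\<^esub> nat h"
    if "n \<in> carrier N" for h n using that by (simp add: via_involution_def)
  show "h = \<one>\<^bsub>Cyc m\<^esub>" if "h \<in> carrier (Cyc m)" "n \<in> carrier N" "i n = g [^]\<^bsub>G\<^esub> nat h" for h n
    using that dis[of "nat h" n] by (cases "h = 0") (auto simp: car nat_less_iff)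
  show "card (carrier G) = card (carrier N) * card (carrier (Cyc m))" using card by (simp add: car)
qed (rule fin)

section \<open>Comparison with permutations of the numbers 1 to 4\<close>

definition num :: "pt \<Rightarrow> nat" where
  "num x = (case x of P1 \<Rightarrow> 1 | P2 \<Rightarrow> 2 | P3 \<Rightarrow> 3 | P4 \<Rightarrow> 4)"

definition pnt :: "nat \<Rightarrow> pt" where
  "pnt n = (if n = 1 then P1 else if n = 2 then P2 else if n = 3 then P3 else P4)"

definition quad_of :: "(nat \<Rightarrow> nat) \<Rightarrow> quad" where
  "quad_of p = Q (pnt (p 1)) (pnt (p 2)) (pnt (p 3)) (pnt (p 4))"

lemma interval4: "{1..4::nat} = {1, 2, 3, 4}" by auto

lemma pnt_num: "pnt (num x) = x"
  by (cases x) (simp_all add: pnt_def num_def)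

lemma num_pnt: "n \<in> {1..4} \<Longrightarrow> num (pnt n) = n"
  unfolding interval4 by (auto simp: pnt_def num_def)

lemma num_range: "num x \<in> {1..4}"
  by (cases x) (simp_all add: num_def)

lemma app_quad_of: "app (quad_of p) x = pnt (p (num x))"
  by (cases x) (simp_all add: quad_of_def num_def)

lemma quad_of_comp: "q permutes {1..4} \<Longrightarrow> quad_of (p \<circ> q) = mul (quad_of p) (quad_of q)"
  using permutes_in_image[of q "{1..4}"] num_range
  by (intro quad_eqI) (simp add: app_mul app_quad_of num_pnt)

lemma quad_of_id: "quad_of id = qone"
  by (simp add: quad_of_def pnt_def)

lemma quad_of_perms: "p permutes {1..4} \<Longrightarrow> quad_of p \<in> set perms"
  unfolding perms_iff
proof (rule injI)
  fix x y assume p: "p permutes {1..4}" and "app (quad_of p) x = app (quad_of p) y"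
  then have "num (pnt (p (num x))) = num (pnt (p (num y)))" by (simp add: app_quad_of)
  then have "p (num x) = p (num y)"
    using permutes_in_image[OF p] num_range[of x] num_range[of y] by (simp add: num_pnt)
  then have "num x = num y" using permutes_inj[OF p] by (simp add: inj_eq)
  then show "x = y" by (metis pnt_num)
qed

lemma inj_quad_of: "inj_on quad_of {p. p permutes {1..4}}"
proof (rule inj_onI, rule ext)
  fix p q n assume a: "p \<in> {p. p permutes {1..4}}" "q \<in> {p. p permutes {1..4}}" "quad_of p = quad_of q"
  show "p n = q n"
  proof (cases "n \<in> {1..4}")
    case True
    then have "pnt (p n) = pnt (q n)" using a(3) app_quad_of[of p "pnt n"] app_quad_of[of q "pnt n"] by (simp add: num_pnt)
    then have "num (pnt (p n)) = num (pnt (q n))" by simp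
    then show ?thesis using a(1,2) permutes_in_image[of _ "{1..4}" n] True by (simp add: num_pnt)
  next
    case False
    then show ?thesis using a(1,2) by (simp add: permutes_not_in)
  qed
qed

text \<open>Both notions of parity flip under multiplication by a transposition, and transpositions
  generate.\<close>

lemma qeven_quad_of:
  assumes "p permutes {1..4}" shows "qeven (quad_of p) \<longleftrightarrow> evenperm p"
  using assms finite_atLeastAtMost[of 1 "4::nat"]
proof (induction p rule: permutes_induct)
  case id
  then show ?case unfolding quad_of_id by (simp add: qeven_def alts_def)
next
  case (swap a b p)
  have t: "Transposition.transpose a b permutes {1..4}" using swap by (intro permutes_swap_id) auto
  have "\<not> qeven (quad_of (Transposition.transpose a b))"
    using swap(1-3) unfolding interval4
    by (auto simp: quad_of_def Transposition.transpose_def pnt_def qeven_def alts_def)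
  moreover have "evenperm (Transposition.transpose a b \<circ> p) \<longleftrightarrow> \<not> evenperm p"
    using swap evenperm_comp[OF permutation_swap_id, of p a b] permutes_imp_permutation[of "{1..4}" p]
    by (simp add: evenperm_swap)
  ultimately show ?case
    using swap t by (simp only: quad_of_comp qeven_mul quad_of_perms simp_thms)
qed

lemma carrier_S4: "carrier S4 = {p. p permutes {1..4}}"
  by (simp add: sym_group_def)

lemma carrier_A4: "carrier A4 = {p. p permutes {1..4} \<and> evenperm p}"
  by (auto simp: alt_group_carrier)

lemma iso_by_hom:
  assumes "f \<in> hom G H" "inj_on f (carrier G)" "finite (carrier H)" "card (carrier G) = card (carrier H)"
  shows "G \<cong> H"
proof -
  have "f ` carrier G \<subseteq> carrier H" using assms(1) by (auto simp: hom_def)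
  then have "f ` carrier G = carrier H" using assms card_image[OF assms(2)] by (intro card_subset_eq) auto
  then show ?thesis using assms by (intro is_isoI[of f] isoI) (auto simp: bij_betw_def)
qed

lemma card_S4: "card (carrier S4) = 24" "card (carrier A4) = 12"
  using sym_group_card_carrier[of 4] alt_group_card_carrier[of 4] by (simp_all add: fact_numeral)

lemma quad_of_A4: "p \<in> carrier A4 \<Longrightarrow> quad_of p \<in> set alts"
  using qeven_quad_of by (auto simp: carrier_A4 qeven_def)

lemma S4_iso: "S4 \<cong> qgrp (set perms)"
proof (rule iso_by_hom[of quad_of])
  show "quad_of \<in> hom S4 (qgrp (set perms))"
    by (rule homI) (auto simp only: qgrp_simps quad_of_perms sym_group_mult carrier_S4 quad_of_comp mem_Collect_eq)
  show "inj_on quad_of (carrier S4)" using inj_quad_of by (simp only: carrier_S4)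
qed (simp_all only: card_S4 group_cards qgrp_simps finite_set)

lemma A4_iso: "A4 \<cong> qgrp (set alts)"
proof (rule iso_by_hom[of quad_of])
  show "quad_of \<in> hom A4 (qgrp (set alts))"
    by (rule homI) (use quad_of_A4 in \<open>auto simp only: qgrp_simps alt_group_mult carrier_A4 quad_of_comp mem_Collect_eq\<close>)
  show "inj_on quad_of (carrier A4)" by (rule inj_on_subset[OF inj_quad_of]) (auto simp: carrier_A4)
qed (simp_all add: card_S4 group_cards)

lemma qsubgroup_lists: "qsubgroup (set perms)" "qsubgroup (set alts)" "qsubgroup (set klein)"
  "qsubgroup (set dih1)" "qsubgroup (set cyc1)"
proof -
  show "qsubgroup (set perms)" using perms_mul perms_one perms_inv by (auto simp: qsubgroup_def)
  show "qsubgroup (set alts)"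
    using qeven_mul qeven_inv perms_inv list_subsets(1) perms_mul
    by (auto simp: qsubgroup_def subset_iff simp flip: qeven_def) (simp add: qeven_def alts_def)
  show "qsubgroup (set klein)" "qsubgroup (set dih1)" "qsubgroup (set cyc1)"
    by (simp_all add: qsubgroup_def klein_def dih1_def cyc1_def perms_def mul.simps qinv_def idx_def)
qed

lemma conj_by_permutes:
  assumes s: "s permutes {1..4}" and p: "p permutes {1..4}"
  shows "conj_by s p permutes {1..4}" "evenperm (conj_by s p) = evenperm p"
    "mul (quad_of s) (quad_of p) = mul (quad_of (conj_by s p)) (quad_of s)"
    "quad_of (conj_by s p) = qconj (quad_of s) (quad_of p)"
proof -
  show c: "conj_by s p permutes {1..4}"
    unfolding conj_by_def using s p by (intro permutes_compose permutes_inv)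
  have "conj_by s p \<circ> s = s \<circ> p"
    unfolding conj_by_def using permutes_inv_o(2)[OF s] by (simp add: o_assoc[symmetric])
  then have "quad_of (conj_by s p \<circ> s) = quad_of (s \<circ> p)" by simp
  then show m: "mul (quad_of s) (quad_of p) = mul (quad_of (conj_by s p)) (quad_of s)"
    using quad_of_comp[OF s] quad_of_comp[OF p] by simp
  then show q: "quad_of (conj_by s p) = qconj (quad_of s) (quad_of p)"
    unfolding qconj_def by (simp add: mul_cancel[OF quad_of_perms[OF s]])
  have "qeven (mul (quad_of s) (quad_of p)) = qeven (mul (quad_of (conj_by s p)) (quad_of s))"
    using m by simp
  then show "evenperm (conj_by s p) = evenperm p"
    using s p c by (simp add: qeven_mul quad_of_perms qeven_quad_of) blast
qed

lemma transpose12: "Transposition.transpose 1 2 permutes {1..4::nat}"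
  "quad_of (Transposition.transpose 1 2) = Q P2 P1 P3 P4"
  by (auto intro!: permutes_swap_id simp: quad_of_def pnt_def Transposition.transpose_def)

lemma conj12_A4:
  assumes "p \<in> carrier A4"
  shows "conj12 p \<in> carrier A4"
    "mul (Q P2 P1 P3 P4) (quad_of p) = mul (quad_of (conj12 p)) (Q P2 P1 P3 P4)"
  using conj_by_permutes[OF transpose12(1)] assms unfolding transpose12(2) by (auto simp: carrier_A4)

lemma carrier_V4: "carrier V4 = {p. p permutes {1..4} \<and> quad_of p \<in> set klein}"
proof -
  let ?t = "Transposition.transpose :: nat \<Rightarrow> _"
  have p: "id permutes {1..4::nat}" "?t 1 2 \<circ> ?t 3 4 permutes {1..4}" "?t 1 3 \<circ> ?t 2 4 permutes {1..4}"
    "?t 1 4 \<circ> ?t 2 3 permutes {1..4}"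
    by (auto intro!: permutes_compose permutes_swap_id permutes_id)
  have q: "quad_of id = Q P1 P2 P3 P4" "quad_of (?t 1 2 \<circ> ?t 3 4) = Q P2 P1 P4 P3"
    "quad_of (?t 1 3 \<circ> ?t 2 4) = Q P3 P4 P1 P2" "quad_of (?t 1 4 \<circ> ?t 2 3) = Q P4 P3 P2 P1"
    by (simp_all add: quad_of_def pnt_def Transposition.transpose_def)
  have "p \<in> {id, ?t 1 2 \<circ> ?t 3 4, ?t 1 3 \<circ> ?t 2 4, ?t 1 4 \<circ> ?t 2 3}"
    if "p permutes {1..4}" "quad_of p \<in> set klein" for p
  proof -
    have "quad_of p \<in> quad_of ` {id, ?t 1 2 \<circ> ?t 3 4, ?t 1 3 \<circ> ?t 2 4, ?t 1 4 \<circ> ?t 2 3}"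
      using that(2) q by (simp add: klein_def)
    then obtain p' where "p' \<in> {id, ?t 1 2 \<circ> ?t 3 4, ?t 1 3 \<circ> ?t 2 4, ?t 1 4 \<circ> ?t 2 3}"
      "quad_of p = quad_of p'" by (rule imageE)
    moreover then have "p' permutes {1..4}" using p by (elim insertE emptyE) (simp_all only:)
    ultimately show ?thesis using inj_onD[OF inj_quad_of, of p p'] that(1) by simp
  qed
  moreover have "p permutes {1..4} \<and> quad_of p \<in> set klein"
    if "p \<in> {id, ?t 1 2 \<circ> ?t 3 4, ?t 1 3 \<circ> ?t 2 4, ?t 1 4 \<circ> ?t 2 3}" for p
    using that p q by (elim insertE emptyE) (simp_all only: klein_def list.set insert_iff simp_thms)
  ultimately show ?thesis unfolding V4_def by auto
qed

lemma V4_mult: "p \<otimes>\<^bsub>V4\<^esub> q = p \<circ> q" "\<one>\<^bsub>V4\<^esub> = id"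
  by (simp_all add: V4_def sym_group_def)

lemma conj_by_V4:
  assumes "s permutes {1..4}" "p \<in> carrier V4"
  shows "conj_by s p \<in> carrier V4"
    "mul (quad_of s) (quad_of p) = mul (quad_of (conj_by s p)) (quad_of s)"
proof -
  have p: "p permutes {1..4}" "quad_of p \<in> set klein" using assms(2) by (auto simp: carrier_V4)
  note c = conj_by_permutes[OF assms(1) p(1)]
  have "qconj (quad_of s) (quad_of p) \<in> set klein"
    using klein_conj[OF quad_of_perms[OF assms(1)]] p(2) by blast
  then show "conj_by s p \<in> carrier V4" using c by (simp only: carrier_V4 mem_Collect_eq simp_thms)
  show "mul (quad_of s) (quad_of p) = mul (quad_of (conj_by s p)) (quad_of s)" by (rule c)
qed

lemma inj_quad_of_V4: "inj_on quad_of (carrier V4)" "inj_on quad_of (carrier A4)" "inj_on quad_of (carrier S4)"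
  by (rule inj_on_subset[OF inj_quad_of]; auto simp: carrier_V4 carrier_A4 carrier_S4)+

lemma quad_of_image_V4: "quad_of ` carrier V4 = set klein"
proof -
  let ?t = "Transposition.transpose :: nat \<Rightarrow> _"
  have "carrier V4 = {id, ?t 1 2 \<circ> ?t 3 4, ?t 1 3 \<circ> ?t 2 4, ?t 1 4 \<circ> ?t 2 3}"
    by (simp add: V4_def)
  then show ?thesis
    by (simp add: quad_of_def pnt_def Transposition.transpose_def klein_def)
qed

lemma card_V4: "card (carrier V4) = 4"
  using card_image[OF inj_quad_of_V4(1)] group_cards by (simp add: quad_of_image_V4)

lemma group_V4: "group V4"
proof -
  interpret S: group S4 by (rule sym_group_is_group)
  have "subgroup (carrier V4) S4"
  proof (rule S.subgroupI)
    show "carrier V4 \<subseteq> carrier S4" by (auto simp: carrier_V4 carrier_S4)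
    show "carrier V4 \<noteq> {}" by (simp add: V4_def)
    fix p assume p: "p \<in> carrier V4"
    then have pp: "p permutes {1..4}" "quad_of p \<in> set klein" by (auto simp: carrier_V4)
    have i: "Hilbert_Choice.inv p permutes {1..4}" using permutes_inv[OF pp(1)] .
    have "mul (quad_of p) (quad_of (Hilbert_Choice.inv p)) = qone"
      using quad_of_comp[OF i, of p] permutes_inv_o(1)[OF pp(1)] quad_of_id by simp
    then have "quad_of (Hilbert_Choice.inv p) = qinv (quad_of p)"
      using qinv_unique[OF quad_of_perms[OF pp(1)]] by simp
    then show "inv\<^bsub>S4\<^esub> p \<in> carrier V4"
      using pp i qsubgroup_lists(3) sym_group_inv_equality[of p 4]
      by (simp only: carrier_S4 carrier_V4 mem_Collect_eq qsubgroup_def)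
    fix q assume q: "q \<in> carrier V4"
    then show "p \<otimes>\<^bsub>S4\<^esub> q \<in> carrier V4"
      using p qsubgroup_lists(3) quad_of_comp[of q p] permutes_compose[of q "{1..4}" p]
      by (simp only: carrier_V4 mem_Collect_eq qsubgroup_def sym_group_mult)
  qed
  from subgroup.subgroup_is_group[OF this S.is_group]
  show ?thesis by (simp add: V4_def)
qed

lemma V4_iso: "V4 \<cong> qgrp (set klein)"
proof (rule iso_by_hom[of quad_of])
  show "quad_of \<in> hom V4 (qgrp (set klein))"
    by (rule homI) (auto simp only: carrier_V4 V4_mult qgrp_simps quad_of_comp mem_Collect_eq)
qed (simp_all add: inj_quad_of_V4 card_V4 group_cards)

text \<open>Powers of (1 3 2 4), the generator of \<open>cyc1\<close>, indexed by residues modulo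
  4.\<close>

definition cpow :: "int \<Rightarrow> quad" where
  "cpow x = (if x = 0 then Q P1 P2 P3 P4 else if x = 1 then Q P3 P4 P2 P1
     else if x = 2 then Q P2 P1 P4 P3 else Q P4 P3 P1 P2)"

lemma carrier_Cyc4: "carrier (Cyc 4) = {0, 1, 2, 3}"
  by (auto simp: carrier_integer_mod_group)

lemma cpow_Cyc4:
  shows "x \<in> carrier (Cyc 4) \<Longrightarrow> cpow x \<in> set cyc1" "inj_on cpow (carrier (Cyc 4))"
    "x \<in> carrier (Cyc 4) \<Longrightarrow> y \<in> carrier (Cyc 4) \<Longrightarrow> cpow ((x + y) mod 4) = mul (cpow x) (cpow y)"
    "x \<in> carrier (Cyc 4) \<Longrightarrow>
      mul (Q P2 P1 P3 P4) (cpow x) = mul (cpow (inv\<^bsub>Cyc 4\<^esub> x)) (Q P2 P1 P3 P4)"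
    "x \<in> carrier (Cyc 4) \<Longrightarrow> inv\<^bsub>Cyc 4\<^esub> x \<in> carrier (Cyc 4)"
    "card (carrier (Cyc 4)) = 4"
proof -
  show "inv\<^bsub>Cyc 4\<^esub> x \<in> carrier (Cyc 4)" if "x \<in> carrier (Cyc 4)"
    using that by (intro group.inv_closed) simp_all
  show "mul (Q P2 P1 P3 P4) (cpow x) = mul (cpow (inv\<^bsub>Cyc 4\<^esub> x)) (Q P2 P1 P3 P4)"
    if "x \<in> carrier (Cyc 4)"
    using that unfolding inv_integer_mod_group[OF that]
    by (auto simp: carrier_Cyc4 cpow_def mul.simps)
  show "cpow x \<in> set cyc1" by (simp add: cpow_def cyc1_def)
  show "inj_on cpow (carrier (Cyc 4))" by (simp add: carrier_Cyc4 cpow_def)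
  show "card (carrier (Cyc 4)) = 4" by (simp add: carrier_Cyc4)
  assume "x \<in> carrier (Cyc 4)" "y \<in> carrier (Cyc 4)"
  then have "x \<in> {0, 1, 2, 3}" "y \<in> {0, 1, 2, 3}" by (simp_all only: carrier_Cyc4)
  then show "cpow ((x + y) mod 4) = mul (cpow x) (cpow y)"
    by (elim insertE emptyE; simp add: cpow_def mul.simps)
qed

lemma Cyc4_iso: "Cyc 4 \<cong> qgrp (set cyc1)"
  by (rule iso_by_hom[of cpow]) (auto simp: cpow_Cyc4 group_cards intro!: homI)

text \<open>The reflection is (1 2), which conjugates (1 3 2 4) to its inverse.\<close>

lemma Dih4_iso: "qgrp (set dih1) \<cong> Dih 4"
  unfolding Dih_def
proof (rule semidirect_cyclic_iso[where i=cpow and g="Q P2 P1 P3 P4"])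
  let ?G = "qgrp (set dih1)"
  interpret G: group ?G by (rule group_qgrp[OF qsubgroup_lists(4)])
  show "group ?G" by (rule G.is_group)
  show "cpow \<in> hom (Cyc 4) ?G" using cpow_Cyc4(1,3) list_subsets(4) by (intro homI) auto
  show "Q P2 P1 P3 P4 \<in> carrier ?G" by (simp add: dih1_def)
  show "Q P2 P1 P3 P4 [^]\<^bsub>?G\<^esub> (2::nat) = \<one>\<^bsub>?G\<^esub>"
    by (simp add: numeral_2_eq_2 mul.simps)
  show "cpow n \<noteq> Q P2 P1 P3 P4 [^]\<^bsub>?G\<^esub> k" if "0 < k" "k < 2" "n \<in> carrier (Cyc 4)" for k :: nat and n
  proof -
    have "k = Suc 0" using that by simp
    then show ?thesis using that(3) by (auto simp: carrier_Cyc4 cpow_def mul.simps)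
  qed
qed (use cpow_Cyc4 group_cards in auto)

section \<open>The fibre products as semidirect products\<close>

lemma card_cong:
  assumes "set A \<subseteq> set perms" "set N \<subseteq> set perms"
  shows "card (cong (set A) (set N)) = card (set A) * card (set N)"
proof -
  have "cong (set A) (set N) = (\<lambda>(s, v). (s, mul s v)) ` (set A \<times> set N)"
    unfolding cong_eq[OF assms] by auto
  moreover have "inj_on (\<lambda>(s, v). (s, mul s v)) (set A \<times> set N)"
    using assms(1) mul_cancel(3) by (intro inj_onI) (auto simp: subset_iff)
  ultimately show ?thesis by (simp add: card_image card_cartesian_product)
qed

lemma fib_props:
  assumes "qone \<in> P" "qone \<in> E"
  shows "left_kernel (fib P E) = set alts" "fst ` fib P E \<subseteq> set perms" "snd ` fib P E = P"
proof -
  have p: "qone \<in> set perms" "Q P2 P1 P3 P4 \<in> set perms" "qeven qone" "\<not> qeven (Q P2 P1 P3 P4)"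
    by (simp_all add: perms_def qeven_def alts_def)
  show "left_kernel (fib P E) = set alts"
    using assms list_subsets(1) by (auto simp: left_kernel_def fib_def qeven_def)
  show "fst ` fib P E \<subseteq> set perms" by (auto simp: fib_def)
  have "t \<in> snd ` fib P E" if "t \<in> P" for t
    using that p by (cases "t \<in> E") (force simp: fib_def)+
  then show "snd ` fib P E = P" by (auto simp: fib_def)
qed

lemma card_fib: "pgroup (fib P E) \<Longrightarrow> qone \<in> P \<Longrightarrow> qone \<in> E \<Longrightarrow> card (fib P E) = 12 * card P"
  using card_pgroup_left[of "fib P E"] fib_props[of P E] group_cards by simp

lemma group_A4: "group A4" and group_S4: "group S4"
  by (rule alt_group_is_group sym_group_is_group)+

lemma A4_facts:
  assumes "a \<in> carrier A4"
  shows "quad_of a \<in> set perms" "qeven (quad_of a)" "quad_of a \<noteq> Q P2 P1 P3 P4" "a permutes {1..4}"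
  using quad_of_A4[OF assms] list_subsets(1) assms by (auto simp: qeven_def carrier_A4) (simp add: alts_def)

lemma pow_two: "x [^]\<^bsub>pgrp \<Gamma>\<^esub> (2::nat) = x \<otimes>\<^bsub>pgrp \<Gamma>\<^esub> x" if "pgroup \<Gamma>" "x \<in> \<Gamma>"
proof -
  interpret G: group "pgrp \<Gamma>" by (rule group_pgrp[OF that(1)])
  have "x \<in> carrier (pgrp \<Gamma>)" using that(2) by simp
  then show ?thesis by (simp only: numeral_2_eq_2 G.nat_pow_Suc G.nat_pow_0 G.l_one)
qed

lemma involution_semidirect:
  assumes \<Gamma>: "pgroup \<Gamma>" and N: "group N" and i: "i \<in> hom N (pgrp \<Gamma>)" "inj_on i (carrier N)"
    and \<phi>: "\<And>n. n \<in> carrier N \<Longrightarrow> \<phi> n \<in> carrier N \<and> g \<otimes>\<^bsub>pgrp \<Gamma>\<^esub> i n = i (\<phi> n) \<otimes>\<^bsub>pgrp \<Gamma>\<^esub> g"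
    and g: "g \<in> \<Gamma>" "g \<otimes>\<^bsub>pgrp \<Gamma>\<^esub> g = (qone, qone)" "\<And>n. n \<in> carrier N \<Longrightarrow> i n \<noteq> g"
    and card: "card \<Gamma> = card (carrier N) * 2"
  shows "pgrp \<Gamma> \<cong> semidirect N (Cyc 2) (via_involution \<phi>)"
proof (rule semidirect_cyclic_iso[OF N group_pgrp[OF \<Gamma>] i \<phi>])
  interpret G: group "pgrp \<Gamma>" by (rule group_pgrp[OF \<Gamma>])
  show "i n \<noteq> g [^]\<^bsub>pgrp \<Gamma>\<^esub> k" if "0 < k" "k < 2" "n \<in> carrier N" for k :: nat and n
  proof -
    have k: "k = Suc 0" using that by simp
    have "g \<in> carrier (pgrp \<Gamma>)" using g(1) by simp
    then show ?thesis using g(3)[OF that(3)] unfolding k by (simp only: G.nat_pow_Suc G.nat_pow_0 G.l_one not_False_eq_True)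
  qed
  show "g [^]\<^bsub>pgrp \<Gamma>\<^esub> (2::nat) = \<one>\<^bsub>pgrp \<Gamma>\<^esub>" using pow_two[OF \<Gamma> g(1)] g(2) by simp
qed (use g finite_pgroup[OF \<Gamma>] card in auto)

lemma hom_times_pgrp:
  assumes "f \<in> hom N (qgrp P)" "h \<in> hom H (qgrp R)"
    "\<And>x y. x \<in> carrier N \<Longrightarrow> y \<in> carrier H \<Longrightarrow> (f x, h y) \<in> \<Gamma>"
  shows "map_prod f h \<in> hom (N \<times>\<times> H) (pgrp \<Gamma>)"
  using assms by (intro homI) (auto simp: hom_def)

lemma quad_of_homs: "quad_of \<in> hom S4 (qgrp (set perms))" "quad_of \<in> hom A4 (qgrp (set alts))"
  "quad_of \<in> hom V4 (qgrp (set klein))"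
proof -
  show "quad_of \<in> hom S4 (qgrp (set perms))"
    by (rule homI) (auto simp only: qgrp_simps quad_of_perms sym_group_mult carrier_S4 quad_of_comp mem_Collect_eq)
  show "quad_of \<in> hom A4 (qgrp (set alts))"
    by (rule homI) (use quad_of_A4 in \<open>auto simp only: qgrp_simps alt_group_mult carrier_A4 quad_of_comp mem_Collect_eq\<close>)
  show "quad_of \<in> hom V4 (qgrp (set klein))"
    by (rule homI) (auto simp only: carrier_V4 V4_mult qgrp_simps quad_of_comp mem_Collect_eq)
qed

text \<open>A4 x E has index two in the fibre product. If P contains an involution t outside E, then
  ((1 2), t) is an involution outside that subgroup and acts on it by conjugation in each
  component.\<close>

lemma fib_iso:
  assumes \<Gamma>: "pgroup (fib P E)" and sub: "E \<subseteq> P" "P \<subseteq> set perms" "qone \<in> E" and K: "group K"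
    and h: "h \<in> hom K (qgrp E)" "inj_on h (carrier K)"
    and t: "t \<in> P" "t \<notin> E" "mul t t = qone"
    and \<phi>: "\<And>n. n \<in> carrier K \<Longrightarrow> \<phi> n \<in> carrier K \<and> mul t (h n) = mul (h (\<phi> n)) t"
    and card: "card P = 2 * card (carrier K)"
  shows "pgrp (fib P E) \<cong> semidirect (A4 \<times>\<times> K) (Cyc 2) (via_involution (map_prod conj12 \<phi>))"
proof (rule involution_semidirect[OF \<Gamma>, where i="map_prod quad_of h" and g="(Q P2 P1 P3 P4, t)"])
  show "group (A4 \<times>\<times> K)" by (intro DirProd_group group_A4 K)
  have hE: "h n \<in> E" if "n \<in> carrier K" for n using h(1) that by (auto simp: hom_def)
  show "map_prod quad_of h \<in> hom (A4 \<times>\<times> K) (pgrp (fib P E))"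
    by (rule hom_times_pgrp[OF quad_of_homs(2) h(1)]) (use hE sub in \<open>auto simp: fib_def A4_facts\<close>)
  show "inj_on (map_prod quad_of h) (carrier (A4 \<times>\<times> K))"
    using inj_quad_of_V4(2) h(2) by (simp add: map_prod_inj_on)
  show "(Q P2 P1 P3 P4, t) \<in> fib P E" using t by (simp add: fib_def perms_def qeven_def alts_def)
  show "(Q P2 P1 P3 P4, t) \<otimes>\<^bsub>pgrp (fib P E)\<^esub> (Q P2 P1 P3 P4, t) = (qone, qone)"
    using t by (simp add: mul.simps)
  have q: "qone \<in> P" using sub by auto
  show "card (fib P E) = card (carrier (A4 \<times>\<times> K)) * 2"
    by (simp only: card_fib[OF \<Gamma> q sub(3)] card carrier_DirProd card_cartesian_product card_S4)
  fix n assume n: "n \<in> carrier (A4 \<times>\<times> K)"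
  then obtain a k where ak: "n = (a, k)" "a \<in> carrier A4" "k \<in> carrier K" by auto
  show "map_prod quad_of h n \<noteq> (Q P2 P1 P3 P4, t)" using ak A4_facts(3) by auto
  show "map_prod conj12 \<phi> n \<in> carrier (A4 \<times>\<times> K) \<and> (Q P2 P1 P3 P4, t) \<otimes>\<^bsub>pgrp (fib P E)\<^esub> map_prod quad_of h n =
      map_prod quad_of h (map_prod conj12 \<phi> n) \<otimes>\<^bsub>pgrp (fib P E)\<^esub> (Q P2 P1 P3 P4, t)"
    using conj12_A4[OF ak(2)] \<phi>[OF ak(3)]
    by (simp only: ak(1) map_prod_simp pgrp_simps carrier_DirProd mem_Times_iff fst_conv snd_conv simp_thms)
qed

lemma transpose12_mul:
  "v \<in> carrier V4 \<Longrightarrow> conj12 v \<in> carrier V4 \<and>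
    mul (Q P2 P1 P3 P4) (quad_of v) = mul (quad_of (conj12 v)) (Q P2 P1 P3 P4)"
  using conj_by_V4[OF transpose12(1), of v] unfolding transpose12(2) by blast

lemma transpose_in: "Q P2 P1 P3 P4 \<in> set perms" "Q P2 P1 P3 P4 \<notin> set alts" "Q P2 P1 P3 P4 \<in> set dih1"
  "Q P2 P1 P3 P4 \<notin> set cyc1" "Q P2 P1 P3 P4 \<notin> set klein" "mul (Q P2 P1 P3 P4) (Q P2 P1 P3 P4) = qone"
  "qone \<in> set alts" "qone \<in> set cyc1" "qone \<in> set klein" "qone \<in> set klein2" "qone \<in> set dih1" "qone \<in> set two1"
  by (simp_all add: perms_def alts_def dih1_def cyc1_def klein_def klein2_def two1_def mul.simps)

lemma perms_alts_iso:
  assumes \<Gamma>: "pgroup (fib (set perms) (set alts))"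
  shows "pgrp (fib (set perms) (set alts)) \<cong> G_288_1026"
  unfolding G_288_1026_def
  by (rule fib_iso[OF \<Gamma> _ _ _ group_A4 quad_of_homs(2) inj_quad_of_V4(2) transpose_in(1,2,6)])
    (use list_subsets conj12_A4 transpose_in in \<open>simp_all only: card_S4 group_cards\<close>)

lemma dih1_klein_iso:
  assumes \<Gamma>: "pgroup (fib (set dih1) (set klein))"
  shows "pgrp (fib (set dih1) (set klein)) \<cong> G_96_195"
  unfolding G_96_195_def
  by (rule fib_iso[OF \<Gamma> _ _ _ group_V4 quad_of_homs(3) inj_quad_of_V4(1) transpose_in(3,5,6) transpose12_mul])
    (use list_subsets transpose_in in \<open>simp_all only: card_V4 group_cards\<close>)

lemma dih1_cyc1_iso:
  assumes \<Gamma>: "pgroup (fib (set dih1) (set cyc1))"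
  shows "pgrp (fib (set dih1) (set cyc1)) \<cong> G_96_187"
  unfolding G_96_187_def
proof (rule fib_iso[OF \<Gamma> _ _ _ group_integer_mod_group _ cpow_Cyc4(2) transpose_in(3,4,6)])
  show "cpow \<in> hom (Cyc 4) (qgrp (set cyc1))" using cpow_Cyc4(1,3) by (intro homI) auto
qed (use list_subsets transpose_in cpow_Cyc4 in \<open>simp_all only: group_cards\<close>)

text \<open>An isomorphism from the normal Klein four group to the intransitive one that turns conjugation by \<open>(1 2)\<close>
  into conjugation by \<open>(1 3)(2 4)\<close>.\<close>

definition klein_map :: "quad \<Rightarrow> quad" where
  "klein_map q = (if q = Q P3 P4 P1 P2 then Q P2 P1 P3 P4 else if q = Q P4 P3 P2 P1 then Q P1 P2 P4 P3 else q)"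

lemma klein_map:
  "\<forall>p\<in>set klein. \<forall>q\<in>set klein. klein_map (mul p q) = mul (klein_map p) (klein_map q)"
  "\<forall>p\<in>set klein. klein_map p \<in> set klein2" "inj_on klein_map (set klein)"
  "\<forall>p\<in>set klein. mul (Q P3 P4 P1 P2) (klein_map p) = mul (klein_map (qconj (Q P2 P1 P3 P4) p)) (Q P3 P4 P1 P2)"
  by (simp_all add: klein_def klein_map_def klein2_def mul.simps qconj_def qinv_def idx_def)

text \<open>Here (1 2) lies in E, so (1 3)(2 4) serves as the outer involution. Its action on the
  four-group is abstractly the same as in the transitive case, which is why both fibre products
  share one isomorphism type.\<close>

lemma dih1_klein2_iso:
  assumes \<Gamma>: "pgroup (fib (set dih1) (set klein2))"
  shows "pgrp (fib (set dih1) (set klein2)) \<cong> G_96_195"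
  unfolding G_96_195_def
proof (rule fib_iso[OF \<Gamma> _ _ _ group_V4, where h="klein_map \<circ> quad_of" and t="Q P3 P4 P1 P2"])
  have v: "quad_of v \<in> set klein" if "v \<in> carrier V4" for v using that by (simp only: carrier_V4 mem_Collect_eq)
  show "klein_map \<circ> quad_of \<in> hom V4 (qgrp (set klein2))"
    using quad_of_homs(3) v klein_map(1,2) by (intro homI) (auto simp: hom_def)
  show "inj_on (klein_map \<circ> quad_of) (carrier V4)"
    using inj_quad_of_V4(1) klein_map(3) by (intro comp_inj_on) (simp_all only: quad_of_image_V4)
  show "Q P3 P4 P1 P2 \<in> set dih1" "Q P3 P4 P1 P2 \<notin> set klein2" "mul (Q P3 P4 P1 P2) (Q P3 P4 P1 P2) = qone"
    by (simp_all add: dih1_def klein_def klein2_def mul.simps)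
  fix n assume n: "n \<in> carrier V4"
  then have "n permutes {1..4}" by (simp only: carrier_V4 mem_Collect_eq)
  then have "quad_of (conj12 n) = qconj (Q P2 P1 P3 P4) (quad_of n)"
    using conj_by_permutes(4)[OF transpose12(1)] unfolding transpose12(2) by blast
  then show "conj12 n \<in> carrier V4 \<and> mul (Q P3 P4 P1 P2) ((klein_map \<circ> quad_of) n) =
      mul ((klein_map \<circ> quad_of) (conj12 n)) (Q P3 P4 P1 P2)"
    using transpose12_mul[OF n] klein_map(4) v[OF n] by (simp only: o_apply)
qed (use list_subsets transpose_in in \<open>simp_all only: group_cards card_V4\<close>)

text \<open>C4 has no involution outside its subgroup of order two, so \<open>fib_iso\<close> does
  not apply. Instead A4 x 1 is complemented by the cyclic group of order four generated by (1 2)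
  paired with the generator of C4.\<close>

lemma cyc1_two1_iso:
  assumes \<Gamma>: "pgroup (fib (set cyc1) (set two1))"
  shows "pgrp (fib (set cyc1) (set two1)) \<cong> G_48_30"
  unfolding G_48_30_def
proof (rule semidirect_cyclic_iso[OF group_A4 group_pgrp[OF \<Gamma>],
      where i="\<lambda>a. (quad_of a, qone)" and g="(Q P2 P1 P3 P4, Q P3 P4 P2 P1)"])
  let ?\<Gamma> = "fib (set cyc1) (set two1)" and ?g = "(Q P2 P1 P3 P4, Q P3 P4 P2 P1)"
  interpret G: group "pgrp ?\<Gamma>" by (rule group_pgrp[OF \<Gamma>])
  show "(\<lambda>a. (quad_of a, qone)) \<in> hom A4 (pgrp ?\<Gamma>)"
    using quad_of_homs(2) A4_facts transpose_in by (intro homI) (auto simp: hom_def fib_def mul_one)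
  show "inj_on (\<lambda>a. (quad_of a, qone)) (carrier A4)"
    using inj_quad_of_V4(2) by (auto simp: inj_on_def)
  show g: "?g \<in> carrier (pgrp ?\<Gamma>)"
    by (simp add: fib_def perms_def qeven_def alts_def cyc1_def two1_def)
  have p: "?g [^]\<^bsub>pgrp ?\<Gamma>\<^esub> (Suc 0) = ?g"
    using g by (simp only: G.nat_pow_Suc G.nat_pow_0 G.l_one)
  have p2: "?g [^]\<^bsub>pgrp ?\<Gamma>\<^esub> Suc (Suc 0) = (qone, Q P2 P1 P4 P3)"
    unfolding G.nat_pow_Suc[of ?g "Suc 0"] p by (simp add: mul.simps)
  have p3: "?g [^]\<^bsub>pgrp ?\<Gamma>\<^esub> Suc (Suc (Suc 0)) = (Q P2 P1 P3 P4, Q P4 P3 P1 P2)"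
    unfolding G.nat_pow_Suc[of ?g "Suc (Suc 0)"] p2 by (simp add: mul.simps)
  have "?g [^]\<^bsub>pgrp ?\<Gamma>\<^esub> Suc (Suc (Suc (Suc 0))) = (qone, qone)"
    unfolding G.nat_pow_Suc[of ?g "Suc (Suc (Suc 0))"] p3 by (simp add: mul.simps)
  then show "?g [^]\<^bsub>pgrp ?\<Gamma>\<^esub> (4::nat) = \<one>\<^bsub>pgrp ?\<Gamma>\<^esub>" by (simp add: numeral_eq_Suc)
  show "(quad_of n, qone) \<noteq> ?g [^]\<^bsub>pgrp ?\<Gamma>\<^esub> k" if k: "0 < k" "k < 4" for k :: nat and n
  proof -
    have "k = Suc 0 \<or> k = Suc (Suc 0) \<or> k = Suc (Suc (Suc 0))" using k by auto
    then show ?thesis using p p2 p3 by (elim disjE) (simp_all only: prod.inject quad.inject pt.distinct simp_thms)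
  qed
  show "finite (carrier (pgrp ?\<Gamma>))" using finite_pgroup[OF \<Gamma>] by simp
  show "card (carrier (pgrp ?\<Gamma>)) = card (carrier A4) * 4"
    using card_fib[OF \<Gamma>] transpose_in by (simp add: group_cards card_S4)
  fix n assume "n \<in> carrier A4"
  then show "conj12 n \<in> carrier A4 \<and> ?g \<otimes>\<^bsub>pgrp ?\<Gamma>\<^esub> (quad_of n, qone) = (quad_of (conj12 n), qone) \<otimes>\<^bsub>pgrp ?\<Gamma>\<^esub> ?g"
    using conj12_A4[of n] by (simp only: pgrp_simps mul_one simp_thms)
qed simp

text \<open>S4 embeds by pairing s with 1 or with (1 3)(2 4) according to its sign, and the central
  involution (1, (1 2)(3 4)) generates a complement; the product is therefore direct.\<close>

lemma klein_two1_iso: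
  assumes \<Gamma>: "pgroup (fib (set klein) (set two1))"
  shows "pgrp (fib (set klein) (set two1)) \<cong> S4 \<times>\<times> Cyc 2"
proof -
  let ?\<Gamma> = "fib (set klein) (set two1)" and ?v = "Q P3 P4 P1 P2"
  let ?i = "\<lambda>s. (quad_of s, if qeven (quad_of s) then qone else ?v)"
  have v: "?v \<in> set klein" "?v \<notin> set two1" "mul ?v ?v = qone"
    by (simp_all add: klein_def two1_def mul.simps)
  have w: "mul (Q P2 P1 P4 P3) ?v = mul ?v (Q P2 P1 P4 P3)" by (simp add: mul.simps)
  have S: "quad_of s \<in> set perms" "s permutes {1..4}" if "s \<in> carrier S4" for s
    using that quad_of_perms by (auto simp: carrier_S4)
  have "pgrp ?\<Gamma> \<cong> semidirect S4 (Cyc 2) (via_involution (\<lambda>x. x))"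
  proof (rule involution_semidirect[OF \<Gamma> group_S4, where i="?i" and g="(qone, Q P2 P1 P4 P3)"])
    show "?i \<in> hom S4 (pgrp ?\<Gamma>)"
      using S v transpose_in by (intro homI) (auto simp: fib_def sym_group_mult quad_of_comp qeven_mul mul_one)
    show "inj_on ?i (carrier S4)" using inj_quad_of_V4(3) by (auto simp: inj_on_def)
    show "(qone, Q P2 P1 P4 P3) \<in> ?\<Gamma>"
      by (simp add: fib_def perms_one qeven_def transpose_in) (simp add: klein_def two1_def)
    show "(qone, Q P2 P1 P4 P3) \<otimes>\<^bsub>pgrp ?\<Gamma>\<^esub> (qone, Q P2 P1 P4 P3) = (qone, qone)" by (simp add: mul.simps)
    show "card ?\<Gamma> = card (carrier S4) * 2"
      using card_fib[OF \<Gamma>] transpose_in by (simp add: group_cards card_S4)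
  qed (use w in \<open>auto simp: mul_one qeven_def transpose_in\<close>)
  moreover have "semidirect S4 (Cyc 2) (via_involution (\<lambda>x. x)) = S4 \<times>\<times> Cyc 2"
    by (simp add: semidirect_def DirProd_def via_involution_def id_def[symmetric])
  ultimately show ?thesis by simp
qed

lemma sym3_permutes: "s \<in> carrier (sym_group 3) \<Longrightarrow> s permutes {1..4}"
  by (auto simp: sym_group_def intro: permutes_subset)

text \<open>V4 x V4 is the kernel of reduction modulo V4, and the diagonal copy of the stabilizer of
  the point 4 is a complement. H stands for S3 or A3, so that both rows are treated at once.\<close>

lemma klein_cong_iso:
  assumes A: "A \<in> {perms, alts}" and \<Gamma>: "pgroup (cong (set A) (set klein))"
    and H: "group H" "carrier H \<subseteq> carrier (sym_group 3)" "\<And>x y. x \<otimes>\<^bsub>H\<^esub> y = x \<circ> y" "\<one>\<^bsub>H\<^esub> = id"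
    and HA: "quad_of ` carrier H \<subseteq> set A" and card: "card (set A) = 4 * card (carrier H)"
  shows "pgrp (cong (set A) (set klein)) \<cong> semidirect (V4 \<times>\<times> V4) H (\<lambda>s. map_prod (conj_by s) (conj_by s))"
proof (rule semidirect_iso[OF _ H(1) group_pgrp[OF \<Gamma>], where i="map_prod quad_of quad_of" and j="\<lambda>s. (quad_of s, quad_of s)"])
  let ?\<Gamma> = "cong (set A) (set klein)"
  have sub: "set A \<subseteq> set perms" "set klein \<subseteq> set A" using A list_subsets by auto
  have kp: "set klein \<subseteq> set perms" using list_subsets by auto
  have p: "s permutes {1..4}" if "s \<in> carrier H" for s using that H(2) sym3_permutes by blast
  show "group (V4 \<times>\<times> V4)" by (intro DirProd_group group_V4)
  show "map_prod quad_of quad_of \<in> hom (V4 \<times>\<times> V4) (pgrp ?\<Gamma>)"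
  proof (rule hom_times_pgrp[OF quad_of_homs(3) quad_of_homs(3)])
    fix x y assume "x \<in> carrier V4" "y \<in> carrier V4"
    then have "quad_of x \<in> set klein" "quad_of y \<in> set klein" using quad_of_image_V4 by blast+
    then show "(quad_of x, quad_of y) \<in> ?\<Gamma>"
      using sub kp qsubgroup_lists(3) unfolding cong_def qsubgroup_def by blast
  qed
  show "inj_on (map_prod quad_of quad_of) (carrier (V4 \<times>\<times> V4))"
    using inj_quad_of_V4(1) by (simp add: map_prod_inj_on)
  show "(\<lambda>s. (quad_of s, quad_of s)) \<in> hom H (pgrp ?\<Gamma>)"
  proof (rule homI)
    fix x assume x: "x \<in> carrier H"
    then have "quad_of x \<in> set A" "quad_of x \<in> set perms" using HA sub by auto
    then show "(quad_of x, quad_of x) \<in> carrier (pgrp ?\<Gamma>)"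
      using perms_inv[of "quad_of x"] transpose_in by (simp add: cong_def)
  qed (simp only: H(3) pgrp_simps quad_of_comp[OF p])
  show "inj_on (\<lambda>s. (quad_of s, quad_of s)) (carrier H)"
    using inj_quad_of p by (auto simp: inj_on_def)
  show "finite (carrier (pgrp ?\<Gamma>))" using finite_pgroup[OF \<Gamma>] by simp
  show "card (carrier (pgrp ?\<Gamma>)) = card (carrier (V4 \<times>\<times> V4)) * card (carrier H)"
    using card_cong[OF sub(1) kp] card by (simp add: card_cartesian_product card_V4 group_cards)
  fix h n assume h: "h \<in> carrier H" and n: "n \<in> carrier (V4 \<times>\<times> V4)"
  then obtain v w where vw: "n = (v, w)" "v \<in> carrier V4" "w \<in> carrier V4" by auto
  show "map_prod (conj_by h) (conj_by h) n \<in> carrier (V4 \<times>\<times> V4) \<and>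
      (quad_of h, quad_of h) \<otimes>\<^bsub>pgrp ?\<Gamma>\<^esub> map_prod quad_of quad_of n =
      map_prod quad_of quad_of (map_prod (conj_by h) (conj_by h) n) \<otimes>\<^bsub>pgrp ?\<Gamma>\<^esub> (quad_of h, quad_of h)"
    using conj_by_V4[OF p[OF h] vw(2)] conj_by_V4[OF p[OF h] vw(3)]
    by (simp only: vw(1) map_prod_simp pgrp_simps carrier_DirProd mem_Times_iff fst_conv snd_conv simp_thms)
  assume "map_prod quad_of quad_of n = (quad_of h, quad_of h)"
  then have "quad_of h = quad_of v" using vw by simp
  then have "quad_of h \<in> set klein" using vw(2) quad_of_image_V4 by blast
  \<comment> \<open>A member of the four-group that fixes a point is the identity.\<close>
  moreover have "h 4 = 4"
    using h H(2) permutes_not_in[of h "{1..3}" 4] by (auto simp: sym_group_def)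
  then have "app (quad_of h) P4 = P4" by (simp add: quad_of_def pnt_def)
  ultimately have "quad_of h = quad_of id" unfolding quad_of_id by (auto simp: klein_def)
  then show "h = \<one>\<^bsub>H\<^esub>"
    using inj_onD[OF inj_quad_of, of h id] p[OF h] permutes_id by (simp add: H(4))
qed

lemma card_sym3: "card (carrier (sym_group 3)) = 6" "card (carrier (alt_group 3)) = 3"
  using sym_group_card_carrier[of 3] alt_group_card_carrier[of 3] by (simp_all add: fact_numeral)

lemma perms_klein_iso:
  assumes \<Gamma>: "pgroup (cong (set perms) (set klein))"
  shows "pgrp (cong (set perms) (set klein)) \<cong> G_96_227"
  unfolding G_96_227_def
proof (rule klein_cong_iso[OF _ \<Gamma>])
  show "quad_of ` carrier (sym_group 3) \<subseteq> set perms" using sym3_permutes quad_of_perms by blast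
qed (simp_all add: sym_group_is_group sym_group_mult sym_group_one card_sym3 group_cards)

lemma alts_klein_iso:
  assumes \<Gamma>: "pgroup (cong (set alts) (set klein))"
  shows "pgrp (cong (set alts) (set klein)) \<cong> G_48_50"
  unfolding G_48_50_def
proof (rule klein_cong_iso[OF _ \<Gamma>])
  show sub: "carrier (alt_group 3) \<subseteq> carrier (sym_group 3)"
    by (auto simp: alt_group_carrier sym_group_carrier)
  show "quad_of ` carrier (alt_group 3) \<subseteq> set alts"
    using sub sym3_permutes qeven_quad_of by (fastforce simp: alt_group_carrier qeven_def)
qed (simp_all add: alt_group_is_group alt_group_mult alt_group_one card_sym3 group_cards)

lemma diagonal_iso:
  assumes A: "A \<in> {perms, alts}"
  shows "qgrp (set A) \<cong> pgrp (cong (set A) (set [qone]))"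
proof (rule iso_by_hom[of "\<lambda>s. (s, s)"])
  have sub: "set A \<subseteq> set perms" "set [qone] \<subseteq> set perms" using A list_subsets perms_one by auto
  have *: "cong (set A) (set [qone]) = (\<lambda>s. (s, s)) ` set A"
    unfolding cong_eq[OF sub] by (auto simp: mul_one)
  show "(\<lambda>s. (s, s)) \<in> hom (qgrp (set A)) (pgrp (cong (set A) (set [qone])))"
    unfolding * by (intro homI) auto
  show "card (carrier (qgrp (set A))) = card (carrier (pgrp (cong (set A) (set [qone]))))"
    unfolding * by (simp add: card_image inj_on_def)
  show "finite (carrier (pgrp (cong (set A) (set [qone]))))" unfolding * by simp
qed (simp add: inj_on_def)

section \<open>The Galois group of a pair of quartics as a group of pairs of permutations\<close>

definition lab :: "(pt \<Rightarrow> 'a) \<Rightarrow> ('a \<Rightarrow> 'a) \<Rightarrow> quad" where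
  "lab e \<sigma> = Q (inv_into UNIV e (\<sigma> (e P1))) (inv_into UNIV e (\<sigma> (e P2)))
     (inv_into UNIV e (\<sigma> (e P3))) (inv_into UNIV e (\<sigma> (e P4)))"

lemma app_lab: "app (lab e \<sigma>) x = inv_into UNIV e (\<sigma> (e x))"
  by (cases x) (simp_all add: lab_def)

lemma lab_eq:
  assumes "inj e" "\<And>x. \<sigma> (e x) = e (app p x)" shows "lab e \<sigma> = p"
  using assms by (intro quad_eqI) (simp add: app_lab inv_f_f)

lemma labeling_exists:
  assumes "card A = 4" obtains e :: "pt \<Rightarrow> 'a" where "inj e" "range e = A"
proof -
  have "finite A" using assms by (metis card.infinite zero_neq_numeral)
  moreover have "finite (UNIV :: pt set)" "card (UNIV :: pt set) = 4" by (simp_all add: pt_UNIV)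
  ultimately obtain e :: "pt \<Rightarrow> 'a" where "bij_betw e UNIV A"
    using assms finite_same_card_bij by metis
  then show ?thesis using that by (auto simp: bij_betw_def)
qed

locale labeled =
  fixes e :: "pt \<Rightarrow> 'a" and A :: "'a set"
  assumes inj: "inj e" and range: "range e = A"
begin

lemma e_lab: "\<sigma> ` A \<subseteq> A \<Longrightarrow> e (app (lab e \<sigma>) x) = \<sigma> (e x)"
  unfolding app_lab using range by (intro f_inv_into_f) auto

lemma lab_perms: "\<sigma> ` A \<subseteq> A \<Longrightarrow> inj_on \<sigma> A \<Longrightarrow> lab e \<sigma> \<in> set perms"
  unfolding perms_iff
proof (rule injI)
  fix x y assume s: "\<sigma> ` A \<subseteq> A" "inj_on \<sigma> A" "app (lab e \<sigma>) x = app (lab e \<sigma>) y"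
  then have "\<sigma> (e x) = \<sigma> (e y)" using e_lab by metis
  then show "x = y" using s(2) inj range by (metis inj_onD injD rangeI)
qed

lemma lab_comp:
  assumes "\<sigma> ` A \<subseteq> A" "\<tau> ` A \<subseteq> A" "\<And>a. a \<in> A \<Longrightarrow> \<rho> a = \<sigma> (\<tau> a)"
  shows "lab e \<rho> = mul (lab e \<sigma>) (lab e \<tau>)"
  using assms range by (intro lab_eq[OF inj]) (auto simp: app_mul e_lab)

lemma lab_cong: "\<sigma> ` A \<subseteq> A \<Longrightarrow> \<tau> ` A \<subseteq> A \<Longrightarrow> lab e \<sigma> = lab e \<tau> \<longleftrightarrow> (\<forall>a\<in>A. \<sigma> a = \<tau> a)"
proof
  assume s: "\<sigma> ` A \<subseteq> A" "\<tau> ` A \<subseteq> A" and l: "lab e \<sigma> = lab e \<tau>"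
  show "\<forall>a\<in>A. \<sigma> a = \<tau> a"
  proof
    fix a assume "a \<in> A"
    then obtain x where "a = e x" using range by auto
    then show "\<sigma> a = \<tau> a" using e_lab[OF s(1), of x] e_lab[OF s(2), of x] l by simp
  qed
qed (use range in \<open>auto simp: lab_def\<close>)

lemma lab_one: "\<sigma> ` A \<subseteq> A \<Longrightarrow> lab e \<sigma> = qone \<longleftrightarrow> (\<forall>a\<in>A. \<sigma> a = a)"
proof -
  assume s: "\<sigma> ` A \<subseteq> A"
  have "lab e (\<lambda>a. a) = qone" by (rule lab_eq[OF inj]) (simp add: app_one)
  then show ?thesis using lab_cong[OF s, of "\<lambda>a. a"] by auto
qed

text \<open>Composing the numbering with the inverse of c conjugates the labels by c; this realizes
  \<open>cj\<close> by a choice of numbering.\<close>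

lemma relabel:
  assumes c: "c \<in> set perms"
  shows "labeled (e \<circ> app (qinv c)) A"
    "\<sigma> ` A \<subseteq> A \<Longrightarrow> lab (e \<circ> app (qinv c)) \<sigma> = qconj c (lab e \<sigma>)"
proof -
  have 1: "app c (app (qinv c) x) = x" "app (qinv c) (app c x) = x" for x
    using perms_inv[OF c] by (simp_all add: app_mul[symmetric] app_one)
  then have b: "inj (app (qinv c))" "range (app (qinv c)) = UNIV" by (metis injI, metis surjI)
  show l: "labeled (e \<circ> app (qinv c)) A"
  proof
    show "inj (e \<circ> app (qinv c))" using inj b by (intro inj_compose)
    show "range (e \<circ> app (qinv c)) = A" using range b by (metis image_comp)
  qed
  show "lab (e \<circ> app (qinv c)) \<sigma> = qconj c (lab e \<sigma>)" if "\<sigma> ` A \<subseteq> A"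
    using 1 e_lab[OF that] labeled.inj[OF l] by (intro lab_eq) (simp_all add: qconj_def app_mul)
qed

end

lemma galois_agree:
  assumes "\<sigma> \<in> carrier (galois_group (splitting_field f))" "\<tau> \<in> carrier (galois_group (splitting_field f))"
    and "splitting_field p \<subseteq> splitting_field f" "\<And>r. r \<in> roots_ac p \<Longrightarrow> \<sigma> r = \<tau> r" "x \<in> splitting_field p"
  shows "\<sigma> x = \<tau> x"
proof -
  let ?K = "splitting_field f"
  have "splitting_field p \<subseteq> {x \<in> ?K. \<sigma> x = \<tau> x}"
    using assms base_le_splitting[of f] roots_le_splitting[of p]
    by (intro splitting_least emb_agree_subfld subfld_splitting galois_emb)
      (auto simp: galois_carrier fixes_base_def)
  then show ?thesis using assms(5) by auto
qed

locale quartic_pair =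
  fixes u u' :: "'m::field \<times> 'm"
  assumes irr: "Factorial_Ring.irreducible (quartic u)" "Factorial_Ring.irreducible (quartic u')"
    and char: "CHAR('m) \<noteq> 2" and infinite_M: "infinite (UNIV :: 'm set)"
begin

abbreviation "RA \<equiv> roots_ac (quartic u)"
abbreviation "RB \<equiv> roots_ac (quartic u')"
abbreviation "f \<equiv> quartic u * quartic u'"
abbreviation "KK \<equiv> splitting_field f"

lemma Gal2_eq: "Gal2 u u' = galois_group KK"
  by (simp add: Gal2_def Lf_def compositum_splitting)

lemma card_roots: "card RA = 4" "card RB = 4"
  using card_roots_irreducible[OF _ pderiv_quartic[OF char]] irr by (simp_all add: quartic_simps)

lemma sep: "separable_poly (quartic u)" "separable_poly (quartic u')" "separable_poly f" "f \<noteq> 0"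
  using separable_poly_irreducible[OF _ pderiv_quartic[OF char]] irr
  by (auto simp: separable_poly_mult quartic_simps)

sublocale aut_group KK base_field "galois_group KK"
  using aut_group_splitting[OF sep(3) infinite_M] .

sublocale group "galois_group KK" by (rule grp)

lemma roots_le: "RA \<subseteq> KK" "RB \<subseteq> KK"
  using roots_le_splitting[of f] by (auto simp: roots_ac_mult)

lemma galois_roots:
  assumes "\<sigma> \<in> carrier (galois_group KK)"
  shows "\<sigma> ` RA \<subseteq> RA" "\<sigma> ` RB \<subseteq> RB" "inj_on \<sigma> RA" "inj_on \<sigma> RB"
  using galois_root[OF assms roots_le(1)] galois_root[OF assms roots_le(2)]
    inj_on_subset[OF emb_inj[OF K G_emb[OF assms]]] roots_le by auto

lemma galois_eqI:
  assumes "\<sigma> \<in> carrier (galois_group KK)" "\<tau> \<in> carrier (galois_group KK)"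
    "\<And>a. a \<in> RA \<Longrightarrow> \<sigma> a = \<tau> a" "\<And>a. a \<in> RB \<Longrightarrow> \<sigma> a = \<tau> a"
  shows "\<sigma> = \<tau>"
  using galois_ext[OF assms(1,2)] assms(3,4) by (auto simp: roots_ac_mult)

end

section \<open>The group of pairs attached to two numbered quartics\<close>

locale labeled_pair = quartic_pair u u' + A: labeled e RA + B: labeled e' RB
  for u u' :: "'m::field \<times> 'm" and e e' :: "pt \<Rightarrow> 'm alg_closure"
begin

definition \<Gamma> :: "(quad \<times> quad) set" where
  "\<Gamma> = (\<lambda>\<sigma>. (lab e \<sigma>, lab e' \<sigma>)) ` carrier (galois_group KK)"

lemma \<Gamma>I: "\<sigma> \<in> carrier (galois_group KK) \<Longrightarrow> (lab e \<sigma>, lab e' \<sigma>) \<in> \<Gamma>"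
  by (auto simp: \<Gamma>_def)

lemma lab_mult:
  assumes "\<sigma> \<in> carrier (galois_group KK)" "\<tau> \<in> carrier (galois_group KK)"
  shows "lab e (\<sigma> \<otimes>\<^bsub>galois_group KK\<^esub> \<tau>) = mul (lab e \<sigma>) (lab e \<tau>)"
    "lab e' (\<sigma> \<otimes>\<^bsub>galois_group KK\<^esub> \<tau>) = mul (lab e' \<sigma>) (lab e' \<tau>)"
  using G_mult[OF assms] roots_le
  by (intro A.lab_comp B.lab_comp galois_roots assms; auto)+

lemma lab_in_perms:
  assumes "\<sigma> \<in> carrier (galois_group KK)"
  shows "lab e \<sigma> \<in> set perms" "lab e' \<sigma> \<in> set perms"
  using A.lab_perms B.lab_perms galois_roots[OF assms] by auto

lemma lab_identity: "lab e \<one>\<^bsub>galois_group KK\<^esub> = qone" "lab e' \<one>\<^bsub>galois_group KK\<^esub> = qone"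
  using A.lab_one B.lab_one galois_roots[OF one_closed] G_one roots_le by auto

lemma lab_inv:
  assumes "\<sigma> \<in> carrier (galois_group KK)"
  shows "lab e (inv\<^bsub>galois_group KK\<^esub> \<sigma>) = qinv (lab e \<sigma>)" "lab e' (inv\<^bsub>galois_group KK\<^esub> \<sigma>) = qinv (lab e' \<sigma>)"
  using lab_mult[OF assms inv_closed[OF assms]] lab_in_perms[OF assms] lab_identity assms
    qinv_unique by (metis r_inv)+

lemma pgroup_\<Gamma>: "pgroup \<Gamma>"
  unfolding pgroup_def
proof (intro conjI allI impI)
  show "\<Gamma> \<subseteq> set perms \<times> set perms" using lab_in_perms by (auto simp: \<Gamma>_def)
  show "(qone, qone) \<in> \<Gamma>" using \<Gamma>I[OF one_closed] lab_identity by simp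
  fix s t assume "(s, t) \<in> \<Gamma>"
  then obtain \<sigma> where s: "\<sigma> \<in> carrier (galois_group KK)" "s = lab e \<sigma>" "t = lab e' \<sigma>" by (auto simp: \<Gamma>_def)
  show "(qinv s, qinv t) \<in> \<Gamma>" using \<Gamma>I[OF inv_closed[OF s(1)]] lab_inv[OF s(1)] s by simp
  fix s' t' assume "(s', t') \<in> \<Gamma>"
  then obtain \<tau> where t: "\<tau> \<in> carrier (galois_group KK)" "s' = lab e \<tau>" "t' = lab e' \<tau>" by (auto simp: \<Gamma>_def)
  show "(mul s s', mul t t') \<in> \<Gamma>" using \<Gamma>I[OF m_closed[OF s(1) t(1)]] lab_mult[OF s(1) t(1)] s t by simp
qed

lemma inj_lab: "inj_on (\<lambda>\<sigma>. (lab e \<sigma>, lab e' \<sigma>)) (carrier (galois_group KK))"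
proof (rule inj_onI)
  fix \<sigma> \<tau> assume s: "\<sigma> \<in> carrier (galois_group KK)" "\<tau> \<in> carrier (galois_group KK)"
    "(lab e \<sigma>, lab e' \<sigma>) = (lab e \<tau>, lab e' \<tau>)"
  then show "\<sigma> = \<tau>"
    using A.lab_cong[OF galois_roots(1) galois_roots(1)] B.lab_cong[OF galois_roots(2) galois_roots(2)]
    by (intro galois_eqI) auto
qed

lemma Gal2_iso: "Gal2 u u' \<cong> pgrp \<Gamma>"
  unfolding Gal2_eq
proof (rule is_isoI, rule isoI)
  show "(\<lambda>\<sigma>. (lab e \<sigma>, lab e' \<sigma>)) \<in> hom (galois_group KK) (pgrp \<Gamma>)"
    by (intro homI) (auto simp: \<Gamma>I lab_mult)
  show "bij_betw (\<lambda>\<sigma>. (lab e \<sigma>, lab e' \<sigma>)) (carrier (galois_group KK)) (carrier (pgrp \<Gamma>))"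
    using inj_lab by (simp add: bij_betw_def \<Gamma>_def)
qed

text \<open>Restriction of automorphisms from the compositum to the smaller splitting field is onto,
  because every automorphism of the latter extends. Hence both groups induce the same permutations
  of the roots.\<close>

lemma Gal_iso_aux:
  assumes l: "labeled e1 (roots_ac p)" and p: "p \<noteq> 0" "splitting_field p \<subseteq> KK"
  shows "galois_group (splitting_field p) \<cong> qgrp (lab e1 ` carrier (galois_group KK))"
proof (rule is_isoI, rule isoI)
  interpret labeled e1 "roots_ac p" by (rule l)
  let ?L = "splitting_field p" and ?G = "galois_group (splitting_field p)"
  have im: "\<sigma> ` roots_ac p \<subseteq> roots_ac p" if "\<sigma> \<in> carrier ?G" for \<sigma>
    using galois_root[OF that roots_le_splitting] by auto
  have imK: "\<sigma> ` roots_ac p \<subseteq> roots_ac p" if "\<sigma> \<in> carrier (galois_group KK)" for \<sigma>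
    using galois_root[OF that] roots_le_splitting[of p] p(2) by auto
  have "lab e1 ` carrier ?G = lab e1 ` carrier (galois_group KK)"
  proof (intro equalityI subsetI)
    fix s assume "s \<in> lab e1 ` carrier ?G"
    then obtain \<tau> where t: "\<tau> \<in> carrier ?G" "s = lab e1 \<tau>" by auto
    have "emb ?L \<tau>" "fixes_base \<tau>" using galois_emb[OF t(1)] t(1) by (auto simp: galois_carrier)
    then obtain \<sigma> where \<sigma>: "\<sigma> \<in> carrier (galois_group KK)" "\<And>x. x \<in> ?L \<Longrightarrow> \<sigma> x = \<tau> x"
      using galois_extend_emb[OF sep(4) subfld_splitting base_le_splitting p(2)] by metis
    then have "lab e1 \<sigma> = lab e1 \<tau>"
      using lab_cong[OF imK[OF \<sigma>(1)] im[OF t(1)]] roots_le_splitting by auto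
    then show "s \<in> lab e1 ` carrier (galois_group KK)" using t \<sigma>(1) by (metis imageI)
  next
    fix s assume "s \<in> lab e1 ` carrier (galois_group KK)"
    then obtain \<sigma> where \<sigma>: "\<sigma> \<in> carrier (galois_group KK)" "s = lab e1 \<sigma>" by auto
    note r = galois_restrict[OF p(1) refl p(2) \<sigma>(1)]
    have "lab e1 (restrict \<sigma> ?L) = lab e1 \<sigma>"
      using lab_cong[OF im[OF r] imK[OF \<sigma>(1)]] roots_le_splitting by auto
    then show "s \<in> lab e1 ` carrier ?G" using r \<sigma>(2) by (metis imageI)
  qed
  moreover have "inj_on (lab e1) (carrier ?G)"
    using lab_cong[OF im im] by (intro inj_onI galois_ext) auto
  ultimately show "bij_betw (lab e1) (carrier ?G) (carrier (qgrp (lab e1 ` carrier (galois_group KK))))"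
    by (simp add: bij_betw_def)
  have "lab e1 (\<sigma> \<otimes>\<^bsub>?G\<^esub> \<tau>) = mul (lab e1 \<sigma>) (lab e1 \<tau>)" if "\<sigma> \<in> carrier ?G" "\<tau> \<in> carrier ?G" for \<sigma> \<tau>
    using that roots_le_splitting[of p] by (intro lab_comp im) (auto simp: galois_mult compose_def)
  then show "lab e1 \<in> hom ?G (qgrp (lab e1 ` carrier (galois_group KK)))"
    using \<open>lab e1 ` carrier ?G = _\<close> by (intro homI) auto
qed

lemma Gal_iso: "Gal u \<cong> qgrp (fst ` \<Gamma>)" "Gal u' \<cong> qgrp (snd ` \<Gamma>)"
proof -
  have "fst ` \<Gamma> = lab e ` carrier (galois_group KK)" "snd ` \<Gamma> = lab e' ` carrier (galois_group KK)"
    by (auto simp: \<Gamma>_def image_image)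
  then show "Gal u \<cong> qgrp (fst ` \<Gamma>)" "Gal u' \<cong> qgrp (snd ` \<Gamma>)"
    using Gal_iso_aux[OF A.labeled_axioms quartic_simps(2) splitting_mono_mult(1)]
      Gal_iso_aux[OF B.labeled_axioms quartic_simps(2) splitting_mono_mult(2)]
    by (simp_all add: Gal_def Lf_def)
qed

lemma transitive_\<Gamma>: "\<exists>p\<in>fst ` \<Gamma>. app p P1 = x" "\<exists>p\<in>snd ` \<Gamma>. app p P1 = x"
proof -
  obtain \<sigma> where "\<sigma> \<in> carrier (galois_group KK)" "\<sigma> (e P1) = e x"
    using galois_transitive[OF irr(1) sep(4) roots_le(1)] A.range by (metis rangeI)
  then show "\<exists>p\<in>fst ` \<Gamma>. app p P1 = x"
    using A.inj by (intro bexI[of _ "lab e \<sigma>"]) (auto simp: app_lab \<Gamma>_def image_image)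
  obtain \<tau> where "\<tau> \<in> carrier (galois_group KK)" "\<tau> (e' P1) = e' x"
    using galois_transitive[OF irr(2) sep(4) roots_le(2)] B.range by (metis rangeI)
  then show "\<exists>p\<in>snd ` \<Gamma>. app p P1 = x"
    using B.inj by (intro bexI[of _ "lab e' \<tau>"]) (auto simp: app_lab \<Gamma>_def image_image)
qed

text \<open>The product of the two normal subgroups that fix \<open>L\<close> and \<open>L'\<close>, as those automorphisms that agree on
  \<open>L\<close> with one that is trivial on \<open>L'\<close>.\<close>

definition HH :: "('m alg_closure \<Rightarrow> 'm alg_closure) set" where
  "HH = {\<sigma> \<in> carrier (galois_group KK). lab e \<sigma> \<in> left_kernel \<Gamma>}"

lemma subgroup_HH: "subgroup HH (galois_group KK)"
proof (rule subgroupI)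
  have q: "qsubgroup (left_kernel \<Gamma>)" by (rule qsubgroup_left_kernel[OF pgroup_\<Gamma>])
  show "HH \<subseteq> carrier (galois_group KK)" by (auto simp: HH_def)
  show "HH \<noteq> {}" using q lab_identity one_closed by (auto simp: HH_def qsubgroup_def)
  show "inv\<^bsub>galois_group KK\<^esub> \<sigma> \<in> HH" if "\<sigma> \<in> HH" for \<sigma>
    using q that lab_inv by (auto simp: HH_def qsubgroup_def)
  show "\<sigma> \<otimes>\<^bsub>galois_group KK\<^esub> \<tau> \<in> HH" if "\<sigma> \<in> HH" "\<tau> \<in> HH" for \<sigma> \<tau>
    using q that lab_mult by (auto simp: HH_def qsubgroup_def)
qed

text \<open>In labels, \<open>HH\<close> is the direct product of the two kernels: if (s, 1) \<in>
  \<Gamma>, then (s, t) \<in> \<Gamma> iff (1, t) \<in> \<Gamma>.\<close>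

lemma card_HH: "card HH = card (left_kernel \<Gamma>) * card (right_kernel \<Gamma>)"
proof -
  have "(\<lambda>\<sigma>. (lab e \<sigma>, lab e' \<sigma>)) ` HH = {(s, t) \<in> \<Gamma>. s \<in> left_kernel \<Gamma>}"
    unfolding HH_def \<Gamma>_def by blast
  also have "\<dots> = left_kernel \<Gamma> \<times> right_kernel \<Gamma>"
  proof -
    note g = pgroupD[OF pgroup_\<Gamma>]
    have "(s, t) \<in> \<Gamma> \<longleftrightarrow> t \<in> right_kernel \<Gamma>" if s: "(s, qone) \<in> \<Gamma>" for s t
      using fiber_right[OF pgroup_\<Gamma> s, of t] qsubgroup_right_kernel[OF pgroup_\<Gamma>]
      by (auto simp: qinv_one mul_one qsubgroup_def)
    then show ?thesis by (auto simp: left_kernel_def)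
  qed
  finally have "(\<lambda>\<sigma>. (lab e \<sigma>, lab e' \<sigma>)) ` HH = left_kernel \<Gamma> \<times> right_kernel \<Gamma>" .
  moreover have "card ((\<lambda>\<sigma>. (lab e \<sigma>, lab e' \<sigma>)) ` HH) = card HH"
    by (rule card_image, rule inj_on_subset[OF inj_lab]) (auto simp: HH_def)
  ultimately show ?thesis by (simp add: card_cartesian_product)
qed

section \<open>The intersection of the two splitting fields\<close>

lemma in_Lf_u:
  assumes "x \<in> KK" "\<And>\<sigma>. \<sigma> \<in> carrier (galois_group KK) \<Longrightarrow> lab e \<sigma> = qone \<Longrightarrow> \<sigma> x = x"
  shows "x \<in> Lf u"
  unfolding Lf_def
proof (rule galois_fixed_by[OF quartic_simps(2) sep(2) assms(1)])
  fix \<sigma> assume "\<sigma> \<in> carrier (galois_group KK)" "\<And>r. r \<in> RA \<Longrightarrow> \<sigma> r = r"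
  then show "\<sigma> x = x" using A.lab_one[OF galois_roots(1)] assms(2) by blast
qed

lemma in_Lf_u':
  assumes "x \<in> KK" "\<And>\<sigma>. \<sigma> \<in> carrier (galois_group KK) \<Longrightarrow> lab e' \<sigma> = qone \<Longrightarrow> \<sigma> x = x"
  shows "x \<in> Lf u'"
  unfolding Lf_def
proof (rule galois_fixed_by[OF quartic_simps(2) sep(1)])
  show "x \<in> splitting_field (quartic u' * quartic u)" using assms(1) by (simp add: mult.commute)
  fix \<sigma> assume "\<sigma> \<in> carrier (galois_group (splitting_field (quartic u' * quartic u)))"
    and r: "\<And>r. r \<in> RB \<Longrightarrow> \<sigma> r = r"
  then have "\<sigma> \<in> carrier (galois_group KK)" by (simp add: mult.commute)
  then show "\<sigma> x = x" using B.lab_one[OF galois_roots(2)] assms(2) r by blast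
qed

lemma Lf_le: "Lf u \<subseteq> KK" "Lf u' \<subseteq> KK"
  unfolding Lf_def by (rule splitting_mono_mult)+

lemma Lf_fixed:
  assumes "\<sigma> \<in> carrier (galois_group KK)" "\<tau> \<in> carrier (galois_group KK)"
  shows "lab e \<sigma> = lab e \<tau> \<Longrightarrow> x \<in> Lf u \<Longrightarrow> \<sigma> x = \<tau> x"
    "lab e' \<sigma> = lab e' \<tau> \<Longrightarrow> x \<in> Lf u' \<Longrightarrow> \<sigma> x = \<tau> x"
proof -
  show "lab e \<sigma> = lab e \<tau> \<Longrightarrow> x \<in> Lf u \<Longrightarrow> \<sigma> x = \<tau> x"
    using galois_agree[OF assms splitting_mono_mult(1), of x] A.lab_cong[OF galois_roots(1)[OF assms(1)] galois_roots(1)[OF assms(2)]]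
    by (simp add: Lf_def)
  show "lab e' \<sigma> = lab e' \<tau> \<Longrightarrow> x \<in> Lf u' \<Longrightarrow> \<sigma> x = \<tau> x"
    using galois_agree[OF assms splitting_mono_mult(2), of x] B.lab_cong[OF galois_roots(2)[OF assms(1)] galois_roots(2)[OF assms(2)]]
    by (simp add: Lf_def)
qed

lemma intersection_fixed: "Lf u \<inter> Lf u' = {x \<in> KK. \<forall>h\<in>HH. h x = x}"
proof (intro equalityI subsetI)
  fix x assume x: "x \<in> Lf u \<inter> Lf u'"
  have "h x = x" if h: "h \<in> HH" for h
  proof -
    have hG: "h \<in> carrier (galois_group KK)" "(lab e h, qone) \<in> \<Gamma>"
      using h by (auto simp: HH_def left_kernel_def)
    then obtain \<tau> where t: "\<tau> \<in> carrier (galois_group KK)" "lab e \<tau> = lab e h" "lab e' \<tau> = qone"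
      by (auto simp: \<Gamma>_def)
    have "h x = \<tau> x" using Lf_fixed(1)[OF hG(1) t(1)] t(2) x by simp
    also have "\<dots> = \<one>\<^bsub>galois_group KK\<^esub> x" using Lf_fixed(2)[OF t(1) one_closed] t(3) lab_identity x by simp
    also have "\<dots> = x" using G_one x Lf_le by auto
    finally show ?thesis .
  qed
  then show "x \<in> {x \<in> KK. \<forall>h\<in>HH. h x = x}" using x Lf_le by auto
next
  fix x assume x: "x \<in> {x \<in> KK. \<forall>h\<in>HH. h x = x}"
  \<comment> \<open>An automorphism trivial on L has first label 1, and one trivial on L' has its
    first label in the left kernel; both kinds lie in \<open>HH\<close>.\<close>
  have "qone \<in> left_kernel \<Gamma>" using pgroupD(3)[OF pgroup_\<Gamma>] by (simp add: left_kernel_def)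
  then have "x \<in> Lf u" using x by (intro in_Lf_u) (auto simp: HH_def)
  moreover have "x \<in> Lf u'"
  proof (rule in_Lf_u')
    fix \<sigma> assume s: "\<sigma> \<in> carrier (galois_group KK)" "lab e' \<sigma> = qone"
    then have "\<sigma> \<in> HH" using \<Gamma>I[OF s(1)] by (simp add: HH_def left_kernel_def)
    then show "\<sigma> x = x" using x by auto
  qed (use x in auto)
  ultimately show "x \<in> Lf u \<inter> Lf u'" by blast
qed

lemma card_\<Gamma>: "Coset.order (galois_group KK) = card \<Gamma>"
  using card_image[OF inj_lab] by (simp add: Coset.order_def \<Gamma>_def)

lemma degree_intersection:
  assumes "n * (card (left_kernel \<Gamma>) * card (right_kernel \<Gamma>)) = card \<Gamma>"
  shows "degree_over_base (Lf u \<inter> Lf u') n"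
  unfolding intersection_fixed
  by (rule dimension_fixed_field[OF subgroup_HH]) (use assms card_\<Gamma> card_HH in simp)

lemma intersection_base:
  assumes "left_kernel \<Gamma> = fst ` \<Gamma>" shows "Lf u \<inter> Lf u' = base_field"
proof -
  have "HH = carrier (galois_group KK)" using assms by (force simp: HH_def \<Gamma>_def)
  then show ?thesis unfolding intersection_fixed using fixed G_fix MK by blast
qed

text \<open>With trivial kernels an automorphism of the compositum that is trivial on either field
  is the identity, so each field is the whole compositum.\<close>

lemma Lf_equal:
  assumes "left_kernel \<Gamma> = {qone}" "right_kernel \<Gamma> = {qone}" shows "Lf u = Lf u'"
proof -
  have one: "\<sigma> = \<one>\<^bsub>galois_group KK\<^esub>" if "\<sigma> \<in> carrier (galois_group KK)" "lab e \<sigma> = qone \<or> lab e' \<sigma> = qone" for \<sigma>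
  proof (rule inj_onD[OF inj_lab _ that(1) one_closed])
    show "(lab e \<sigma>, lab e' \<sigma>) = (lab e \<one>\<^bsub>galois_group KK\<^esub>, lab e' \<one>\<^bsub>galois_group KK\<^esub>)"
    proof (cases "lab e \<sigma> = qone")
      case True
      then have "lab e' \<sigma> \<in> right_kernel \<Gamma>" using \<Gamma>I[OF that(1)] by (simp add: right_kernel_def)
      then show ?thesis using True assms(2) lab_identity by simp
    next
      case False
      then have "lab e \<sigma> \<in> left_kernel \<Gamma>" using \<Gamma>I[OF that(1)] that(2) by (simp add: left_kernel_def)
      then show ?thesis using False assms(1) by simp
    qed
  qed
  have "x \<in> Lf u" "x \<in> Lf u'" if "x \<in> KK" for x
    using one G_one[OF that] by (auto intro!: in_Lf_u in_Lf_u' that)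
  then show ?thesis using Lf_le by blast
qed

section \<open>Bijections between the root sets\<close>

definition bij_of :: "quad \<Rightarrow> 'm alg_closure \<Rightarrow> 'm alg_closure" where
  "bij_of \<phi> = (\<lambda>a\<in>RA. e' (app \<phi> (inv_into UNIV e a)))"

lemma bij_of_app: "bij_of \<phi> (e x) = e' (app \<phi> x)"
  using A.inj A.range by (auto simp: bij_of_def)

lemma bij_of_inj: "bij_of \<phi> = bij_of \<psi> \<Longrightarrow> \<phi> = \<psi>"
  using bij_of_app B.inj by (intro quad_eqI) (metis injD)

lemma image_bij_of: "bij_of ` set perms = root_bijections u u'"
proof (intro equalityI subsetI)
  fix g assume "g \<in> bij_of ` set perms"
  then obtain \<phi> where \<phi>: "\<phi> \<in> set perms" "g = bij_of \<phi>" by auto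
  have inj: "inj (app \<phi>)" using \<phi>(1) perms_iff by blast
  then have surj: "surj (app \<phi>)" by (intro finite_UNIV_inj_surj) (simp_all add: pt_UNIV)
  have "inj_on (bij_of \<phi>) RA"
  proof (rule inj_onI)
    fix a b assume "a \<in> RA" "b \<in> RA" and eq: "bij_of \<phi> a = bij_of \<phi> b"
    then obtain x y where "a = e x" "b = e y" using A.range by blast
    moreover then have "app \<phi> x = app \<phi> y" using eq injD[OF B.inj] by (simp add: bij_of_app)
    ultimately show "a = b" using injD[OF inj] by blast
  qed
  moreover have "bij_of \<phi> ` RA = RB"
  proof -
    have "bij_of \<phi> ` RA = range (\<lambda>x. e' (app \<phi> x))"
      unfolding A.range[symmetric] by (simp add: image_image bij_of_app)
    also have "\<dots> = e' ` range (app \<phi>)" by (simp add: image_image)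
    finally show ?thesis using surj B.range by simp
  qed
  ultimately show "g \<in> root_bijections u u'"
    by (simp add: \<phi>(2) root_bijections_def bij_betw_def) (simp add: bij_of_def)
next
  fix g assume "g \<in> root_bijections u u'"
  then have g: "g \<in> extensional RA" "bij_betw g RA RB" by (auto simp: root_bijections_def)
  have ei: "e' (inv_into UNIV e' (g (e x))) = g (e x)" for x
    using g(2) A.range B.range bij_betwE by (intro f_inv_into_f) blast
  define \<phi> where "\<phi> = Q (inv_into UNIV e' (g (e P1))) (inv_into UNIV e' (g (e P2)))
    (inv_into UNIV e' (g (e P3))) (inv_into UNIV e' (g (e P4)))"
  have app: "app \<phi> x = inv_into UNIV e' (g (e x))" for x by (cases x) (simp_all add: \<phi>_def)
  have "inj (app \<phi>)"
  proof (rule injI)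
    fix x y assume "app \<phi> x = app \<phi> y"
    then have "g (e x) = g (e y)" using ei[of x] ei[of y] unfolding app by metis
    then show "x = y" using g(2) A.range A.inj by (metis bij_betw_def inj_onD injD rangeI)
  qed
  moreover have "bij_of \<phi> = g"
  proof (rule extensionalityI[of _ RA])
    show "bij_of \<phi> \<in> extensional RA" by (simp add: bij_of_def)
    fix a assume "a \<in> RA"
    then obtain x where "a = e x" using A.range by auto
    then show "bij_of \<phi> a = g a" using ei by (simp add: bij_of_app app)
  qed (rule g(1))
  ultimately show "g \<in> bij_of ` set perms" using perms_iff by blast
qed

lemma action_bij_of:
  assumes s: "\<sigma> \<in> carrier (galois_group KK)"
  shows "bijection_action u u' \<sigma> (bij_of \<phi>) = bij_of (mul (mul (lab e' \<sigma>) \<phi>) (qinv (lab e \<sigma>)))"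
proof (rule extensionalityI[of _ RA])
  show "bijection_action u u' \<sigma> (bij_of \<phi>) \<in> extensional RA" by (simp add: bijection_action_def)
  show "bij_of (mul (mul (lab e' \<sigma>) \<phi>) (qinv (lab e \<sigma>))) \<in> extensional RA" by (simp add: bij_of_def)
  fix a assume a: "a \<in> RA"
  then obtain x where x: "a = e x" using A.range by auto
  note i = inv_closed[OF s]
  have "(inv\<^bsub>galois_group KK\<^esub> \<sigma>) (e x) = e (app (qinv (lab e \<sigma>)) x)"
    using A.e_lab[OF galois_roots(1)[OF i]] lab_inv[OF s] by simp
  then have "bijection_action u u' \<sigma> (bij_of \<phi>) a = \<sigma> (e' (app \<phi> (app (qinv (lab e \<sigma>)) x)))"
    using a x by (simp add: bijection_action_def Gal2_eq bij_of_app)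
  also have "\<dots> = e' (app (lab e' \<sigma>) (app \<phi> (app (qinv (lab e \<sigma>)) x)))"
    using B.e_lab[OF galois_roots(2)[OF s]] by simp
  finally show "bijection_action u u' \<sigma> (bij_of \<phi>) a =
      bij_of (mul (mul (lab e' \<sigma>) \<phi>) (qinv (lab e \<sigma>))) a"
    by (simp add: x bij_of_app app_mul)
qed

text \<open>The coding of bijections by quads is injective, so it preserves the number and the sizes
  of the orbits.\<close>

lemma decomposition_type_eq: "decomposition_type u u' = dtype \<Gamma>"
proof -
  have "orbit (galois_group KK) (bijection_action u u') (bij_of \<phi>) = bij_of ` orb \<Gamma> \<phi>" for \<phi>
  proof -
    have "orbit (galois_group KK) (bijection_action u u') (bij_of \<phi>) =
        (\<lambda>\<sigma>. bijection_action u u' \<sigma> (bij_of \<phi>)) ` carrier (galois_group KK)"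
      by (auto simp: orbit_def)
    also have "\<dots> = (\<lambda>\<sigma>. bij_of (mul (mul (lab e' \<sigma>) \<phi>) (qinv (lab e \<sigma>)))) ` carrier (galois_group KK)"
      using action_bij_of by (intro image_cong) auto
    finally show ?thesis by (simp add: orb_def \<Gamma>_def image_image)
  qed
  then have "orbits (Gal2 u u') (root_bijections u u') (bijection_action u u') =
      (\<lambda>Y. bij_of ` Y) ` orb \<Gamma> ` set perms"
    unfolding image_bij_of[symmetric] Gal2_eq orbits_def by auto
  moreover have inj: "inj bij_of" using bij_of_inj by (auto intro: injI)
  moreover have "inj_on (\<lambda>Y. bij_of ` Y) (orb \<Gamma> ` set perms)"
    using inj by (intro inj_onI) (simp add: inj_image_eq_iff)
  moreover have "card (bij_of ` Y) = card Y" for Y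
    using inj by (intro card_image) (auto intro: inj_on_subset)
  ultimately show ?thesis
    by (simp add: decomposition_type_def dtype_def image_mset_mset_set[symmetric] multiset.map_comp o_def)
qed

end

text \<open>An abstract isomorphism with S4 or A4 does not say how the group acts on the roots. Its
  order does: the remaining transitive subgroups of S4 have at most 8 elements. The second numbering
  is then adjusted to reach the standard form.\<close>

lemma (in quartic_pair) standard_labeling:
  assumes A: "A \<in> {perms, alts}" "Gal u \<cong> qgrp (set A)" and le: "Coset.order (Gal u') \<le> Coset.order (Gal u)"
  obtains e e' where "labeled_pair u u' e e'" "standard (labeled_pair.\<Gamma> u u' e e')"
proof -
  obtain e :: "pt \<Rightarrow> 'm alg_closure" where e: "inj e" "range e = RA"
    using labeling_exists[OF card_roots(1)] .
  obtain d :: "pt \<Rightarrow> 'm alg_closure" where d: "inj d" "range d = RB"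
    using labeling_exists[OF card_roots(2)] .
  interpret L: labeled_pair u u' e d
    using e d by unfold_locales auto
  have c: "card (fst ` L.\<Gamma>) = card (set A)" "card (snd ` L.\<Gamma>) = Coset.order (Gal u')"
    "Coset.order (Gal u) = card (set A)"
    using iso_same_card[OF L.Gal_iso(1)] iso_same_card[OF L.Gal_iso(2)] iso_same_card[OF A(2)]
    by (simp_all add: Coset.order_def)
  have q: "qsubgroup (fst ` L.\<Gamma>)" by (rule qsubgroup_fst[OF L.pgroup_\<Gamma>])
  have small: "\<not> pattern (fst ` L.\<Gamma>) H" if "length H \<le> 8" "set H \<subseteq> set perms" for H
  proof
    assume "pattern (fst ` L.\<Gamma>) H"
    then have "fst ` L.\<Gamma> = set H" using pattern_eq that(2) q by (auto simp: qsubgroup_def)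
    then have "card (set A) \<le> 8" using c(1) card_length[of H] that(1) by simp
    then show False using A(1) group_cards by auto
  qed
  have p: "Q P1 P3 P2 P4 \<in> set perms" "Q P1 P4 P3 P2 \<in> set perms" by (simp_all add: perms_def)
  have len: "length klein = 4" "length dih1 = 8" "length cyc1 = 4" by (simp_all add: klein_def dih1_def cyc1_def)
  have sub: "set klein \<subseteq> set perms" "set dih1 \<subseteq> set perms" "set cyc1 \<subseteq> set perms" "set alts \<subseteq> set perms"
    using list_subsets by auto
  have img: "set (map (qconj c) H) \<subseteq> set perms" if "c \<in> set perms" "set H \<subseteq> set perms" for c H
    using that qconj_perms by auto
  have "pattern (fst ` L.\<Gamma>) perms \<or> pattern (fst ` L.\<Gamma>) alts"
    using transitive_patterns[OF q L.transitive_\<Gamma>(1)] small[OF _ sub(1)] small[OF _ sub(2)] small[OF _ sub(3)]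
      small[OF _ img[OF p(1) sub(2)]] small[OF _ img[OF p(2) sub(2)]]
      small[OF _ img[OF p(1) sub(3)]] small[OF _ img[OF p(2) sub(3)]]
    unfolding list_ex_Cons_iff list_ex_Nil_iff by (simp only: length_map len) simp
  then have "fst ` L.\<Gamma> = set perms \<or> fst ` L.\<Gamma> = set alts"
    using pattern_eq q sub(4) by (auto simp: qsubgroup_def)
  then have F: "fst ` L.\<Gamma> = set A" using A(1) c(1) group_cards by auto
  obtain k where k: "k \<in> set perms" "standard (cj k L.\<Gamma>)"
    using standard_form[OF L.pgroup_\<Gamma> A(1) F L.transitive_\<Gamma>(2)] c le by auto
  interpret M: labeled_pair u u' e "d \<circ> app (qinv k)"
    using L.B.relabel(1)[OF k(1)] L.A.labeled_axioms quartic_pair_axioms by (intro labeled_pair.intro)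
  have "M.\<Gamma> = cj k L.\<Gamma>"
    unfolding M.\<Gamma>_def L.\<Gamma>_def cj_def image_image
    using L.B.relabel(2)[OF k(1)] galois_roots(2) by (intro image_cong) auto
  then show ?thesis using that[OF M.labeled_pair_axioms] k(2) by simp
qed

section \<open>The rows of the table\<close>

lemma standard_cases:
  assumes "standard \<Gamma>"
  obtains (times) A B where "A \<in> {perms, alts}" "B \<in> {perms, alts, klein, dih1, cyc1}"
      "\<not> (A = alts \<and> B = perms)" "\<Gamma> = set A \<times> set B"
    | (perms_alts) "\<Gamma> = fib (set perms) (set alts)"
    | (dih1_cyc1) "\<Gamma> = fib (set dih1) (set cyc1)"
    | (dih1_klein) "\<Gamma> = fib (set dih1) (set klein)"
    | (dih1_klein2) "\<Gamma> = fib (set dih1) (set klein2)"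
    | (cyc1_two1) "\<Gamma> = fib (set cyc1) (set two1)"
    | (klein_two1) "\<Gamma> = fib (set klein) (set two1)"
    | (perms_klein) "\<Gamma> = cong (set perms) (set klein)"
    | (alts_klein) "\<Gamma> = cong (set alts) (set klein)"
    | (perms_one) "\<Gamma> = cong (set perms) (set [qone])"
    | (alts_one) "\<Gamma> = cong (set alts) (set [qone])"
  using assms unfolding standard_def
proof (elim disjE)
  assume "\<exists>A\<in>{perms, alts}. \<exists>B\<in>{perms, alts, klein, dih1, cyc1}. \<not> (A = alts \<and> B = perms) \<and>
    \<Gamma> = set A \<times> set B"
  then show thesis by (elim bexE conjE) (rule times)
next
  assume "\<exists>(B, E)\<in>{(perms, alts), (dih1, cyc1), (dih1, klein), (dih1, klein2), (cyc1, two1), (klein, two1)}.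
    \<Gamma> = fib (set B) (set E)"
  then show thesis
    by (simp only: bex_simps prod.case)
      (elim disjE FalseE; erule perms_alts dih1_cyc1 dih1_klein dih1_klein2 cyc1_two1 klein_two1)
next
  assume "\<exists>A\<in>{perms, alts}. \<exists>N\<in>{klein, [qone]}. \<Gamma> = cong (set A) (set N)"
  then show thesis
    by (simp only: bex_simps) (elim disjE FalseE; erule perms_klein alts_klein perms_one alts_one)
qed

lemma table_isos: "qgrp (set perms) \<cong> S4" "qgrp (set alts) \<cong> A4" "qgrp (set klein) \<cong> V4"
  "qgrp (set dih1) \<cong> Dih 4" "qgrp (set cyc1) \<cong> Cyc 4"
  by (rule group.iso_sym[OF group_S4 S4_iso] group.iso_sym[OF group_A4 A4_iso] Dih4_iso
      group.iso_sym[OF group_V4 V4_iso] group.iso_sym[OF group_integer_mod_group Cyc4_iso])+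

lemma times_iso:
  assumes "qsubgroup P" "qgrp P \<cong> G" "qgrp R \<cong> H" shows "pgrp (P \<times> R) \<cong> G \<times>\<times> H"
  unfolding pgrp_times using group.DirProd_iso_trans[OF group_qgrp[OF assms(1)] assms(2,3)] .

lemma list_parities:
  "\<exists>t\<in>set perms. \<not> qeven t" "\<exists>t\<in>set dih1. \<not> qeven t" "\<exists>t\<in>set cyc1. \<not> qeven t"
  "t \<in> set alts \<Longrightarrow> qeven t" "t \<in> set klein \<Longrightarrow> qeven t" "qeven qone"
  by (auto simp: perms_def dih1_def cyc1_def klein_def qeven_def alts_def)

context labeled_pair
begin

lemma times_row:
  assumes \<Gamma>: "\<Gamma> = set A \<times> set B" and A: "A \<in> {perms, alts}" and B: "qone \<in> set B"
    and iso: "qgrp (set A) \<cong> G" "qgrp (set B) \<cong> H"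
  shows "Gal u \<cong> G" "Gal u' \<cong> H" "Gal2 u u' \<cong> G \<times>\<times> H" "Lf u \<inter> Lf u' = base_field"
    "(\<exists>s\<in>set A. \<exists>t\<in>set B. qeven s \<noteq> qeven t) \<Longrightarrow> decomposition_type u u' = {#24#}"
    "(\<forall>s\<in>set A. \<forall>t\<in>set B. qeven s = qeven t) \<Longrightarrow> decomposition_type u u' = {#12, 12#}"
proof -
  have sub: "set alts \<subseteq> set A" "qone \<in> set A" "qsubgroup (set A)"
    using A list_subsets qsubgroup_lists transpose_in perms_one by auto
  have p: "fst ` \<Gamma> = set A" "snd ` \<Gamma> = set B" "left_kernel \<Gamma> = set A"
    using sub B by (auto simp: \<Gamma> left_kernel_def)
  show "Gal u \<cong> G" "Gal u' \<cong> H" using Gal_iso p iso iso_trans by metis+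
  show "Gal2 u u' \<cong> G \<times>\<times> H" using Gal2_iso times_iso[OF sub(3) iso] iso_trans by (metis \<Gamma>)
  show "Lf u \<inter> Lf u' = base_field" using intersection_base p by simp
  have a: "(a, qone) \<in> \<Gamma>" if "a \<in> set alts" for a using that sub B by (auto simp: \<Gamma>)
  show "(\<exists>s\<in>set A. \<exists>t\<in>set B. qeven s \<noteq> qeven t) \<Longrightarrow> decomposition_type u u' = {#24#}"
    "(\<forall>s\<in>set A. \<forall>t\<in>set B. qeven s = qeven t) \<Longrightarrow> decomposition_type u u' = {#12, 12#}"
    using dtype_alternating[OF pgroup_\<Gamma> a] by (auto simp: decomposition_type_eq \<Gamma>)
qed

text \<open>Multiplying by the order of the right kernel turns the index of the left kernel in the
  first projection into the index of \<open>HH\<close> in the Galois group.\<close>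

lemma degree_row: "n * card (left_kernel \<Gamma>) = card (fst ` \<Gamma>) \<Longrightarrow> degree_over_base (Lf u \<inter> Lf u') n"
  using card_pgroup_right[OF pgroup_\<Gamma>] by (intro degree_intersection) (simp add: algebra_simps)

lemma fib_row:
  assumes \<Gamma>: "\<Gamma> = fib (set B) (set E)" and B: "qone \<in> set B" "qone \<in> set E" and t: "t \<in> set B" "t \<notin> set E"
    and iso: "qgrp (set B) \<cong> H" and T: "pgrp (fib (set B) (set E)) \<cong> T"
  shows "Gal u \<cong> S4" "Gal u' \<cong> H" "Gal2 u u' \<cong> T" "degree_over_base (Lf u \<inter> Lf u') 2"
    "(\<exists>t\<in>set B. qeven t \<noteq> (t \<in> set E)) \<Longrightarrow> decomposition_type u u' = {#24#}"
    "(\<forall>t\<in>set B. qeven t = (t \<in> set E)) \<Longrightarrow> decomposition_type u u' = {#12, 12#}"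
proof -
  note fp = fib_props[OF B, folded \<Gamma>]
  obtain s0 where s0: "s0 \<in> set perms" "\<not> qeven s0" using list_parities(1) by blast
  have "fst ` \<Gamma> = set perms"
  proof
    show "set perms \<subseteq> fst ` \<Gamma>"
    proof
      fix s assume "s \<in> set perms"
      then have "(s, if qeven s then qone else t) \<in> \<Gamma>" using B t by (simp add: \<Gamma> fib_def)
      then show "s \<in> fst ` \<Gamma>" by force
    qed
  qed (rule fp)
  then show "Gal u \<cong> S4" "degree_over_base (Lf u \<inter> Lf u') 2"
    using Gal_iso(1) table_isos(1) iso_trans fp(1) group_cards by (metis, intro degree_row, simp)
  show "Gal u' \<cong> H" using Gal_iso(2) fp(3) iso iso_trans by metis
  show "Gal2 u u' \<cong> T" using Gal2_iso T iso_trans by (metis \<Gamma>)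
  have a: "(a, qone) \<in> \<Gamma>" if "a \<in> set alts" for a using that fp(1) by (auto simp: left_kernel_def)
  show "decomposition_type u u' = {#24#}" if ex: "\<exists>t\<in>set B. qeven t \<noteq> (t \<in> set E)"
  proof -
    obtain r where r: "r \<in> set B" "qeven r \<noteq> (r \<in> set E)" using ex by blast
    \<comment> \<open>The partner of r takes the sign prescribed by E, which here differs from the
      sign of r.\<close>
    have "(if r \<in> set E then qone else s0, r) \<in> \<Gamma>"
      using r s0 list_parities(6) perms_one by (auto simp: \<Gamma> fib_def)
    moreover have "qeven (if r \<in> set E then qone else s0) \<noteq> qeven r" using r s0 list_parities(6) by auto
    ultimately show ?thesis using dtype_alternating(1)[OF pgroup_\<Gamma> a] by (auto simp only: decomposition_type_eq)
  qed
  show "(\<forall>t\<in>set B. qeven t = (t \<in> set E)) \<Longrightarrow> decomposition_type u u' = {#12, 12#}"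
    using dtype_alternating(2)[OF pgroup_\<Gamma> a] by (auto simp: decomposition_type_eq \<Gamma> fib_def)
qed

lemma cong_kernels:
  assumes \<Gamma>: "\<Gamma> = cong (set A) (set N)" and A: "A \<in> {perms, alts}" and N: "N \<in> {klein, [qone]}"
  shows "fst ` \<Gamma> = set A" "snd ` \<Gamma> = set A" "left_kernel \<Gamma> = set N" "right_kernel \<Gamma> = set N"
proof -
  have sub: "set A \<subseteq> set perms" "set N \<subseteq> set A" "qone \<in> set N" "qsubgroup (set N)" "qsubgroup (set A)" "set N \<subseteq> set perms"
    using A N list_subsets transpose_in perms_one qsubgroup_lists
    by (auto simp: qsubgroup_def mul_one qinv_one)
  have eq: "\<Gamma> = {(s, mul s v) | s v. s \<in> set A \<and> v \<in> set N}" using cong_eq[OF sub(1,6)] \<Gamma> by simp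
  have i: "(s, s) \<in> \<Gamma>" if "s \<in> set A" for s using that sub(3) mul_one(1)[of s] unfolding eq by force
  show "fst ` \<Gamma> = set A" using i unfolding eq by force
  have "mul s v \<in> set A" if "s \<in> set A" "v \<in> set N" for s v
    using that sub(2,5) unfolding qsubgroup_def by blast
  then show "snd ` \<Gamma> = set A" using i unfolding eq by force
  have "qinv v \<in> set N" "qinv (qinv v) = v" if "v \<in> set N" for v
    using that sub(4,6) perms_inv[of v] qinv_unique[of "qinv v" v] by (auto simp: qsubgroup_def)
  then have inv: "qinv s \<in> set N \<longleftrightarrow> s \<in> set N" if "s \<in> set A" for s
    using that sub(1) perms_inv[of s] qinv_unique[of "qinv s" s] by (metis subsetD)
  show "left_kernel \<Gamma> = set N"
    using inv sub(2) perms_one by (auto simp: \<Gamma> left_kernel_def cong_def mul_one)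
  show "right_kernel \<Gamma> = set N"
    using sub by (auto simp: \<Gamma> right_kernel_def cong_def mul_one qinv_one)
qed

lemma cong_row:
  assumes \<Gamma>: "\<Gamma> = cong (set A) (set N)" and A: "A \<in> {perms, alts}" and N: "N \<in> {klein, [qone]}"
    and iso: "qgrp (set A) \<cong> H" and T: "pgrp (cong (set A) (set N)) \<cong> T"
  shows "Gal u \<cong> H" "Gal u' \<cong> H" "Gal2 u u' \<cong> T" "decomposition_type u u' = dtype (cong (set A) (set N))"
    "n * card (set N) = card (set A) \<Longrightarrow> degree_over_base (Lf u \<inter> Lf u') n"
    "N = [qone] \<Longrightarrow> Lf u = Lf u'" "pgroup (cong (set A) (set N))"
proof -
  note k = cong_kernels[OF \<Gamma> A N]
  show "Gal u \<cong> H" "Gal u' \<cong> H" using Gal_iso k(1,2) iso iso_trans by metis+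
  show "Gal2 u u' \<cong> T" using Gal2_iso T iso_trans by (metis \<Gamma>)
  show "decomposition_type u u' = dtype (cong (set A) (set N))" by (simp add: decomposition_type_eq \<Gamma>)
  show "n * card (set N) = card (set A) \<Longrightarrow> degree_over_base (Lf u \<inter> Lf u') n"
    using k by (intro degree_row) simp
  show "N = [qone] \<Longrightarrow> Lf u = Lf u'" using k by (intro Lf_equal) simp_all
  show "pgroup (cong (set A) (set N))" using pgroup_\<Gamma> \<Gamma> by simp
qed

end

text \<open>Equal splitting fields would have equal Galois groups, but the orders are 24 and
  4.\<close>

lemma Lf_neq:
  assumes "Gal u \<cong> S4" "Gal u' \<cong> H" "card (carrier H) = 4" shows "Lf u \<noteq> Lf u'"
  using iso_same_card[OF assms(1)] iso_same_card[OF assms(2)] assms(3) card_S4 by (auto simp: Gal_def)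

theorem theorem3p1:
  fixes \<iota> :: "'k::field \<Rightarrow> 'm::field" and u u' :: "'m \<times> 'm"
  assumes "CHAR('k) \<noteq> 2"
    and "\<iota> \<in> Ring.ring_hom ring_of_type_algebra ring_of_type_algebra"
    and "infinite (UNIV :: 'm set)"
    and "quartic_disc u * quartic_disc u' \<noteq> 0"
    and "Factorial_Ring.irreducible (quartic u)"
    and "Factorial_Ring.irreducible (quartic u')"
    and "Coset.order (Gal u) \<ge> Coset.order (Gal u')"
    and "Gal u \<cong> S4 \<or> Gal u \<cong> A4"
  shows "(Gal u \<cong> S4 \<and> Gal u' \<cong> S4 \<and>
       ((Gal2 u u' \<cong> S4 \<times>\<times> S4 \<and> Lf u \<inter> Lf u' = base_field \<and>
         decomposition_type u u' = {#24#}) \<or>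
        (Gal2 u u' \<cong> G_288_1026 \<and> degree_over_base (Lf u \<inter> Lf u') 2 \<and>
         decomposition_type u u' = {#12, 12#}) \<or>
        (Gal2 u u' \<cong> G_96_227 \<and> degree_over_base (Lf u \<inter> Lf u') 6 \<and>
         decomposition_type u u' = {#12, 8, 4#}) \<or>
        (Gal2 u u' \<cong> S4 \<and> Lf u = Lf u' \<and>
         decomposition_type u u' = {#8, 6, 6, 3, 1#}))) \<or>
     (Gal u \<cong> S4 \<and> Gal u' \<cong> A4 \<and>
       ((Gal2 u u' \<cong> S4 \<times>\<times> A4 \<and> Lf u \<inter> Lf u' = base_field \<and>
         decomposition_type u u' = {#24#}))) \<or>
     (Gal u \<cong> S4 \<and> Gal u' \<cong> Dih 4 \<and>
       ((Gal2 u u' \<cong> S4 \<times>\<times> Dih 4 \<and> Lf u \<inter> Lf u' = base_field \<and>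
         decomposition_type u u' = {#24#}) \<or>
        (Gal2 u u' \<cong> G_96_187 \<and> degree_over_base (Lf u \<inter> Lf u') 2 \<and>
         decomposition_type u u' = {#24#}) \<or>
        (Gal2 u u' \<cong> G_96_195 \<and> degree_over_base (Lf u \<inter> Lf u') 2 \<and>
         decomposition_type u u' = {#24#}) \<or>
        (Gal2 u u' \<cong> G_96_195 \<and> degree_over_base (Lf u \<inter> Lf u') 2 \<and>
         decomposition_type u u' = {#12, 12#}))) \<or>
     (Gal u \<cong> S4 \<and> Gal u' \<cong> Cyc 4 \<and>
       ((Gal2 u u' \<cong> S4 \<times>\<times> Cyc 4 \<and> Lf u \<noteq> Lf u' \<and>
         decomposition_type u u' = {#24#}) \<or>
        (Gal2 u u' \<cong> G_48_30 \<and> degree_over_base (Lf u \<inter> Lf u') 2 \<and>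
         decomposition_type u u' = {#12, 12#}))) \<or>
     (Gal u \<cong> S4 \<and> Gal u' \<cong> V4 \<and>
       ((Gal2 u u' \<cong> S4 \<times>\<times> V4 \<and> Lf u \<noteq> Lf u' \<and>
         decomposition_type u u' = {#24#}) \<or>
        (Gal2 u u' \<cong> S4 \<times>\<times> Cyc 2 \<and> degree_over_base (Lf u \<inter> Lf u') 2 \<and>
         decomposition_type u u' = {#24#}))) \<or>
     (Gal u \<cong> A4 \<and> Gal u' \<cong> A4 \<and>
       ((Gal2 u u' \<cong> A4 \<times>\<times> A4 \<and> Lf u \<inter> Lf u' = base_field \<and>
         decomposition_type u u' = {#12, 12#}) \<or>
        (Gal2 u u' \<cong> G_48_50 \<and> degree_over_base (Lf u \<inter> Lf u') 3 \<and>
         decomposition_type u u' = {#12, 4, 4, 4#}) \<or>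
        (Gal2 u u' \<cong> A4 \<and> Lf u = Lf u' \<and>
         decomposition_type u u' = {#6, 6, 4, 4, 3, 1#}))) \<or>
     (Gal u \<cong> A4 \<and> Gal u' \<cong> Dih 4 \<and>
       ((Gal2 u u' \<cong> A4 \<times>\<times> Dih 4 \<and> Lf u \<inter> Lf u' = base_field \<and>
         decomposition_type u u' = {#24#}))) \<or>
     (Gal u \<cong> A4 \<and> Gal u' \<cong> Cyc 4 \<and>
       ((Gal2 u u' \<cong> A4 \<times>\<times> Cyc 4 \<and> Lf u \<inter> Lf u' = base_field \<and>
         decomposition_type u u' = {#24#}))) \<or>
     (Gal u \<cong> A4 \<and> Gal u' \<cong> V4 \<and>
       ((Gal2 u u' \<cong> A4 \<times>\<times> V4 \<and> Lf u \<inter> Lf u' = base_field \<and>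
         decomposition_type u u' = {#12, 12#})))"
proof -
  have char: "CHAR('m) \<noteq> 2" using CHAR_ring_hom[OF assms(2)] assms(1) by simp
  interpret quartic_pair u u' by unfold_locales (use assms char in auto)
  obtain A where A: "A \<in> {perms, alts}" "Gal u \<cong> qgrp (set A)"
    using assms(8) iso_trans[OF _ S4_iso] iso_trans[OF _ A4_iso] by blast
  obtain e e' where L: "labeled_pair u u' e e'" and std: "standard (labeled_pair.\<Gamma> u u' e e')"
    using standard_labeling[OF A assms(7)] .
  interpret L: labeled_pair u u' e e' by (rule L)
  have diag: "pgrp (cong (set A) (set [qone])) \<cong> H" if "A \<in> {perms, alts}" "qgrp (set A) \<cong> H" for A H
  proof -
    have "qsubgroup (set A)" using that(1) qsubgroup_lists by auto
    then show ?thesis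
      using group.iso_sym[OF group_qgrp diagonal_iso[OF that(1)]] that(2) iso_trans by blast
  qed
  from std show ?thesis
  proof (cases rule: standard_cases)
    case (times A B)
    have one: "qone \<in> set B" using times(2) transpose_in perms_one by auto
    note row = L.times_row[OF times(4,1) one]
    have alts: "\<forall>t\<in>set alts. qeven t" "\<forall>t\<in>set klein. qeven t"
      using list_parities(4,5) by blast+
    \<comment> \<open>Direct products are sorted by parity: an odd element in either factor merges
      the two cosets of A4, so only A4 paired with A4 or V4 keeps two orbits.\<close>
    consider "A = perms" | "A = alts" "B = dih1 \<or> B = cyc1" | "A = alts" "B = alts \<or> B = klein"
      using times(1,2,3) by blast
    then show ?thesis
    proof cases
      case 1
      note r = row[unfolded 1, OF table_isos(1)]
      have d: "\<exists>s\<in>set perms. \<exists>t\<in>set B. qeven s \<noteq> qeven t"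
        using one list_parities(1,6) by blast
      consider "B = perms" | "B = alts" | "B = klein" | "B = dih1" | "B = cyc1" using times(2) by blast
      then show ?thesis
      proof cases
        case 1
        note q = r[unfolded 1, OF table_isos(1)]
        show ?thesis using q(1-4) q(5)[OF d[unfolded 1]] by (simp only: simp_thms)
      next
        case 2
        note q = r[unfolded 2, OF table_isos(2)]
        show ?thesis using q(1-4) q(5)[OF d[unfolded 2]] by (simp only: simp_thms)
      next
        case 3
        note q = r[unfolded 3, OF table_isos(3)]
        show ?thesis using q(1-4) q(5)[OF d[unfolded 3]] Lf_neq[OF q(1,2) card_V4] by (simp only: simp_thms)
      next
        case 4
        note q = r[unfolded 4, OF table_isos(4)]
        show ?thesis using q(1-4) q(5)[OF d[unfolded 4]] by (simp only: simp_thms)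
      next
        case 5
        note q = r[unfolded 5, OF table_isos(5)]
        show ?thesis using q(1-4) q(5)[OF d[unfolded 5]] Lf_neq[OF q(1,2) cpow_Cyc4(6)] by (simp only: simp_thms)
      qed
    next
      case 2
      note r = row[unfolded 2(1), OF table_isos(2)]
      have d: "\<exists>s\<in>set alts. \<exists>t\<in>set B. qeven s \<noteq> qeven t"
        using 2(2) transpose_in(7) list_parities(2,3,6) by blast
      show ?thesis using 2(2)
      proof
        assume B: "B = dih1"
        note q = r[unfolded B, OF table_isos(4)]
        show ?thesis using q(1-4) q(5)[OF d[unfolded B]] by (simp only: simp_thms)
      next
        assume B: "B = cyc1"
        note q = r[unfolded B, OF table_isos(5)]
        show ?thesis using q(1-4) q(5)[OF d[unfolded B]] by (simp only: simp_thms)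
      qed
    next
      case 3
      note r = row[unfolded 3(1), OF table_isos(2)]
      have d: "\<forall>s\<in>set alts. \<forall>t\<in>set B. qeven s = qeven t" using 3(2) alts by blast
      show ?thesis using 3(2)
      proof
        assume B: "B = alts"
        note q = r[unfolded B, OF table_isos(2)]
        show ?thesis using q(1-4) q(6)[OF d[unfolded B]] by (simp only: simp_thms)
      next
        assume B: "B = klein"
        note q = r[unfolded B, OF table_isos(3)]
        show ?thesis using q(1-4) q(6)[OF d[unfolded B]] by (simp only: simp_thms)
      qed
    qed
  next
    case perms_alts
    have t: "Q P2 P1 P3 P4 \<in> set perms" "Q P2 P1 P3 P4 \<notin> set alts" and d: "\<forall>t\<in>set perms. qeven t = (t \<in> set alts)"
      by (simp_all add: alts_def klein_def perms_def qeven_def)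
    have one: "qone \<in> set perms" "qone \<in> set alts" by (rule transpose_in perms_one)+
    note r = L.fib_row[OF perms_alts one t table_isos(1) perms_alts_iso[OF L.pgroup_\<Gamma>[unfolded perms_alts]]]
    show ?thesis using r(1-4) r(6)[OF d] by (simp only: simp_thms)
  next
    case dih1_cyc1
    have t: "Q P2 P1 P3 P4 \<in> set dih1" "Q P2 P1 P3 P4 \<notin> set cyc1" and d: "\<exists>t\<in>set dih1. qeven t \<noteq> (t \<in> set cyc1)"
      by (simp_all add: alts_def cyc1_def dih1_def klein_def qeven_def)
    have one: "qone \<in> set dih1" "qone \<in> set cyc1" by (rule transpose_in perms_one)+
    note r = L.fib_row[OF dih1_cyc1 one t table_isos(4) dih1_cyc1_iso[OF L.pgroup_\<Gamma>[unfolded dih1_cyc1]]]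
    show ?thesis using r(1-4) r(5)[OF d] by (simp only: simp_thms)
  next
    case dih1_klein
    have t: "Q P2 P1 P3 P4 \<in> set dih1" "Q P2 P1 P3 P4 \<notin> set klein" and d: "\<forall>t\<in>set dih1. qeven t = (t \<in> set klein)"
      by (simp_all add: alts_def dih1_def klein_def qeven_def)
    have one: "qone \<in> set dih1" "qone \<in> set klein" by (rule transpose_in perms_one)+
    note r = L.fib_row[OF dih1_klein one t table_isos(4) dih1_klein_iso[OF L.pgroup_\<Gamma>[unfolded dih1_klein]]]
    show ?thesis using r(1-4) r(6)[OF d] by (simp only: simp_thms)
  next
    case dih1_klein2
    \<comment> \<open>Since \<open>klein2\<close> contains the odd element (1 2), it is not the even
      part of D4, and all bijections form one orbit, unlike for \<open>klein\<close>.\<close>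
    have t: "Q P3 P4 P1 P2 \<in> set dih1" "Q P3 P4 P1 P2 \<notin> set klein2" and d: "\<exists>t\<in>set dih1. qeven t \<noteq> (t \<in> set klein2)"
      by (simp_all add: alts_def dih1_def klein2_def klein_def qeven_def)
    have one: "qone \<in> set dih1" "qone \<in> set klein2" by (rule transpose_in perms_one)+
    note r = L.fib_row[OF dih1_klein2 one t table_isos(4) dih1_klein2_iso[OF L.pgroup_\<Gamma>[unfolded dih1_klein2]]]
    show ?thesis using r(1-4) r(5)[OF d] by (simp only: simp_thms)
  next
    case cyc1_two1
    \<comment> \<open>The even elements of the cyclic group are exactly its squares, so the parities
      agree in every pair.\<close>
    have t: "Q P3 P4 P2 P1 \<in> set cyc1" "Q P3 P4 P2 P1 \<notin> set two1" and d: "\<forall>t\<in>set cyc1. qeven t = (t \<in> set two1)"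
      by (simp_all add: alts_def cyc1_def klein_def qeven_def two1_def)
    have one: "qone \<in> set cyc1" "qone \<in> set two1" by (rule transpose_in perms_one)+
    note r = L.fib_row[OF cyc1_two1 one t table_isos(5) cyc1_two1_iso[OF L.pgroup_\<Gamma>[unfolded cyc1_two1]]]
    show ?thesis using r(1-4) r(6)[OF d] by (simp only: simp_thms)
  next
    case klein_two1
    \<comment> \<open>The four-group is entirely even, while half of it lies outside
      \<open>two1\<close>; there an even t is paired with an odd s.\<close>
    have t: "Q P3 P4 P1 P2 \<in> set klein" "Q P3 P4 P1 P2 \<notin> set two1" and d: "\<exists>t\<in>set klein. qeven t \<noteq> (t \<in> set two1)"
      by (simp_all add: alts_def klein_def qeven_def two1_def)
    have one: "qone \<in> set klein" "qone \<in> set two1" by (rule transpose_in perms_one)+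
    note r = L.fib_row[OF klein_two1 one t table_isos(3) klein_two1_iso[OF L.pgroup_\<Gamma>[unfolded klein_two1]]]
    show ?thesis using r(1-4) r(5)[OF d] by (simp only: simp_thms)
  next
    case perms_klein
    have A: "perms \<in> {perms, alts}" and N: "klein \<in> {klein, [qone]}" by simp_all
    note r = L.cong_row[OF perms_klein A N table_isos(1) perms_klein_iso[OF L.pgroup_\<Gamma>[unfolded perms_klein]]]
    have "6 * card (set klein) = card (set perms)" by (simp add: group_cards)
    from r(5)[OF this] show ?thesis
      using r(1-4) dtype_standard_cong(1)[OF r(7)] by (simp only: simp_thms)
  next
    case alts_klein
    have A: "alts \<in> {perms, alts}" and N: "klein \<in> {klein, [qone]}" by simp_all
    note r = L.cong_row[OF alts_klein A N table_isos(2) alts_klein_iso[OF L.pgroup_\<Gamma>[unfolded alts_klein]]]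
    have "3 * card (set klein) = card (set alts)" by (simp add: group_cards)
    from r(5)[OF this] show ?thesis
      using r(1-4) dtype_standard_cong(2)[OF r(7)] by (simp only: simp_thms)
  next
    case perms_one
    have A: "perms \<in> {perms, alts}" and N: "[qone] \<in> {klein, [qone]}" by simp_all
    note r = L.cong_row[OF perms_one A N table_isos(1) diag[OF A table_isos(1)]]
    show ?thesis
      using r(1-4) r(6)[OF refl] dtype_standard_cong(3)[OF r(7)] by (simp only: simp_thms)
  next
    case alts_one
    have A: "alts \<in> {perms, alts}" and N: "[qone] \<in> {klein, [qone]}" by simp_all
    note r = L.cong_row[OF alts_one A N table_isos(2) diag[OF A table_isos(2)]]
    show ?thesis
      using r(1-4) r(6)[OF refl] dtype_standard_cong(4)[OF r(7)] by (simp only: simp_thms)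
  qed
qed

end
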